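(* Let $H\in W^{1,\infty}(\mathbb R)$ and let $u_0$ be a Radon measure on $\mathbb R$ with $u_{0s}=\sum_{j=1}^pc_j\delta_{x_j}$, $x_1<\dots<x_p$, $c_j\in\mathbb R\setminus\{0\}$; let $\mathcal J=\{x_1,\dots,x_p\}$. Let $u\in C([0,\infty);\mathcal M(\mathbb R))$ be the unique global entropy solution of the Cauchy problem $u_t+[H(u)]_x=0$ in $\mathbb R\times\mathbb R^+$, $u=u_0$ in $\mathbb R\times\{0\}$, which satisfies the compatibility condition at all $x_j\in\mathcal J$. Let $t_j:=\sup\{t>0:u_s(\cdot,t)(\{x_j\})\ne0\}$. Then the waiting time $t_j$ is finite if either $c_j>0$ and $H$ satisfies $(H_5)$-$(i)$ or $(H_6)$-$(i)$, or $c_j<0$ and $H$ satisfies $(H_5)$-$(ii)$ or $(H_6)$-$(ii)$, where, with $M_k^+:=\|H'\|_{L^\infty(k,\infty)}$, $M_k^-:=\|H'\|_{L^\infty(-\infty,k)}$: - $(H_5)$-$(i)$: the limit $H^+:=\lim_{\xi\to\infty}H(\xi)$ exists, there is no $c>0$ such that $H$ is constant in $(c,\infty)$, $\lim_{k\to\infty}M_k^+=0$, and $\limsup_{k\to\infty}\frac{|H(k)-H^+|}{M_k^+}\ge C_0^+$ for some constant $C_0^+>0$; - $(H_5)$-$(ii)$: the limit $H^-:=\lim_{\xi\to-\infty}H(\xi)$ exists, there is no $d<0$ such that $H$ is constant in $(-\infty,d)$, $\lim_{k\to-\infty}M_k^-=0$, and $\limsup_{k\to-\infty}\frac{|H(k)-H^-|}{M_k^-}\ge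 C_0^-$ for some constant $C_0^->0$; - $(H_6)$-$(i)$: the limit $H^+:=\lim_{\xi\to\infty}H(\xi)$ exists and there is $\overline k>0$ such that either $H(\xi)>H^+$ for all $\xi\ge\overline k$, or $H(\xi)<H^+$ for all $\xi\ge\overline k$; - $(H_6)$-$(ii)$: the limit $H^-:=\lim_{\xi\to-\infty}H(\xi)$ exists and there is $\underline k<0$ such that either $H(\xi)>H^-$ for all $\xi\le\underline k$, or $H(\xi)<H^-$ for all $\xi\le\underline k$.
   Context: **Measures.** $\mathcal M^+(\mathbb R)$: nonnegative Radon measures on $\mathbb R$; $\mathcal M(\mathbb R)$: signed Radon measures, i.e. $\mu$ for which there are $\nu\in\mathcal M^+(\mathbb R)$ and a locally $\nu$-summable $f$ with $\mu(K)=\int_Kf\,d\nu$ for all compact $K$. $\langle\cdot,\cdot\rangle$ is the duality with $C_c(\mathbb R)$. $\mu=\mu_{ac}+\mu_s$ is the Lebesgue decomposition, $\mu_r\in L^1_{\rm loc}(\mathbb R)$ the density of $\mu_{ac}$. Let $Q=\mathbb R\times(0,T)$. $L^\infty_{w*}(0,T;\mathcal M^+(\mathbb R))$ is the set of nonnegative Radon measures $u$ on $Q$ such that for a.e. $t\in(0,T)$ there is $u(\cdot,t)\in\mathcal M^+(\mathbb R)$ with: for $\zeta\in C([0,T];C_c(\mathbb R))$ the map $t\mapsto\langle u(\cdot,t),\zeta(\cdot,t)\rangle$ is in $L^1(0,T)$ and $\langle u,\zeta\rangle=\int_0^T\langle u(\cdot,t),\zeta(\cdot,t)\rangle dt$;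 and $t\mapsto\|u(\cdot,t)\|_{\mathcal M(K)}$ is in $L^\infty(0,T)$ for each compact $K$. A signed Radon measure $u$ on $Q$ is in $L^\infty_{w*}(0,T;\mathcal M(\mathbb R))$ if $u^+,u^-$ both are in $L^\infty_{w*}(0,T;\mathcal M^+(\mathbb R))$; $u(\cdot,t):=u^+(\cdot,t)-u^-(\cdot,t)$. For a.e. $t$, $u_s(\cdot,t)=[u(\cdot,t)]_s$ and $u_r(\cdot,t)=[u(\cdot,t)]_r$. $C([0,\infty);\mathcal M(\mathbb R))$: maps with $\|u(\cdot,t)-u(\cdot,t_0)\|_{\mathcal M(K)}\to0$ as $t\to t_0$ for each $t_0\ge0$ and compact $K$. **Signs.** ${\rm sgn}_+=\chi_{(0,\infty)}$, ${\rm sgn}_-=-\chi_{(-\infty,0)}$, ${\rm sgn}={\rm sgn}_++{\rm sgn}_-$. **Entropy solutions.** $u\in L^\infty_{w*}(0,T;\mathcal M(\mathbb R))$ is an entropy solution of the Cauchy problem in $Q$ if for all $\zeta\in C^1([0,T];C^1_c(\mathbb R))$ with $\zeta(\cdot,T)=0$ $$\iint_Q[u_r\zeta_t+H(u_r)\zeta_x]dxdt+\int_0^T\langle u_s(\cdot,t),\zeta_t(\cdot,t)\rangle dt=-\langle u_0,\zeta(\cdot,0)\rangle,$$ and for all $k\in\mathbb R$ and all such $\zeta\ge0$ $$\iint_Q\{|u_r-k|\zeta_t+{\rm sgn}(u_r-k)[H(u_r)-H(k)]\zeta_x\}dxdt+\int_0^T\langle|u_s(\cdot,t)|,\zeta_t(\cdot,t)\rangle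 dt\ge-\int_{\mathbb R}|u_{0r}-k|\zeta(x,0)dx-\langle|u_{0s}|,\zeta(\cdot,0)\rangle.$$ It is global if this holds for every $T>0$. **Compatibility condition** at $x_j$: for all $k\in\mathbb R$, $0\le\beta\in C_c^1(0,t_j)$, with $\sigma=-$ if $c_j>0$ and $\sigma=+$ if $c_j<0$, ${\rm ess}\lim_{x\to x_j^+}\int_0^{t_j}{\rm sgn}_\sigma(u_r(x,t)-k)[H(u_r(x,t))-H(k)]\beta(t)dt\le0$ and ${\rm ess}\lim_{x\to x_j^-}$ of the same integral is $\ge0$. (It is known that a unique global entropy solution satisfying the compatibility condition at all $x_j\in\mathcal J$ exists, that it belongs to $C([0,\infty);\mathcal M(\mathbb R))$, and that $t_j>0$.) *)

theory Defs
  imports "HOL-Probability.Essential_Supremum"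
begin

section \<open>Radon measures\<close>

definition radon_measure_on :: "'a::topological_space set \<Rightarrow> 'a measure \<Rightarrow> bool" where
  "radon_measure_on S \<nu> \<longleftrightarrow>
     sets \<nu> = sets (restrict_space borel S) \<and>
     (\<forall>K. compact K \<and> K \<subseteq> S \<longrightarrow> emeasure \<nu> K < \<infinity>)"

text \<open>
  A signed Radon measure need not be finite, so it is represented by its values on compact
  sets; the value of \<open>\<mu> A\<close> for noncompact \<open>A\<close> is meaningless and never used.
  \<open>represents S \<mu> \<nu> f\<close> says that \<open>\<mu> = f \<nu>\<close> on \<open>S\<close>.
\<close>

definition represents ::
  "'a::topological_space set \<Rightarrow> ('a set \<Rightarrow> real) \<Rightarrow> 'a measure \<Rightarrow> ('a \<Rightarrow> real) \<Rightarrow> bool" where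
  "represents S \<mu> \<nu> f \<longleftrightarrow>
     radon_measure_on S \<nu> \<and> f \<in> borel_measurable \<nu> \<and>
     (\<forall>K. compact K \<and> K \<subseteq> S \<longrightarrow> set_integrable \<nu> K f \<and> \<mu> K = (LINT x:K|\<nu>. f x))"

definition signed_radon_on :: "'a::topological_space set \<Rightarrow> ('a set \<Rightarrow> real) \<Rightarrow> bool" where
  "signed_radon_on S \<mu> \<longleftrightarrow> (\<exists>\<nu> f. represents S \<mu> \<nu> f)"

text \<open>
  The representation \<open>\<mu> = f \<nu>\<close> is not unique, but the measures \<open>\<mu>\<^sup>+ = f\<^sup>+ \<nu>\<close>, \<open>\<mu>\<^sup>- = f\<^sup>- \<nu>\<close>,
  \<open>\<bar>\<mu>\<bar> = \<bar>f\<bar> \<nu>\<close> and the pairing \<open>\<langle>\<mu>, \<zeta>\<rangle> = \<integral> f \<zeta> d\<nu>\<close> do not depend on the choice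
  (\<open>ennreal\<close> maps negative reals to 0).
\<close>

definition radon_rep ::
  "'a::topological_space set \<Rightarrow> ('a set \<Rightarrow> real) \<Rightarrow> 'a measure \<times> ('a \<Rightarrow> real)" where
  "radon_rep S \<mu> = (SOME (\<nu>, f). represents S \<mu> \<nu> f)"

definition pos_part :: "'a::topological_space set \<Rightarrow> ('a set \<Rightarrow> real) \<Rightarrow> 'a measure" where
  "pos_part S \<mu> = (case radon_rep S \<mu> of (\<nu>, f) \<Rightarrow> density \<nu> (\<lambda>x. ennreal (f x)))"

definition neg_part :: "'a::topological_space set \<Rightarrow> ('a set \<Rightarrow> real) \<Rightarrow> 'a measure" where
  "neg_part S \<mu> = (case radon_rep S \<mu> of (\<nu>, f) \<Rightarrow> density \<nu> (\<lambda>x. ennreal (- f x)))"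

definition tot_var :: "'a::topological_space set \<Rightarrow> ('a set \<Rightarrow> real) \<Rightarrow> 'a measure" where
  "tot_var S \<mu> = (case radon_rep S \<mu> of (\<nu>, f) \<Rightarrow> density \<nu> (\<lambda>x. ennreal \<bar>f x\<bar>))"

definition pairing :: "(real set \<Rightarrow> real) \<Rightarrow> (real \<Rightarrow> real) \<Rightarrow> real" where
  "pairing \<mu> \<zeta> = (case radon_rep UNIV \<mu> of (\<nu>, f) \<Rightarrow> (LINT x|\<nu>. f x * \<zeta> x))"

text \<open>
  Lebesgue decomposition on the real line: \<open>r\<close> is a density of \<open>\<mu>\<^sub>a\<^sub>c\<close>, and \<open>s\<close> is \<open>\<mu>\<^sub>s\<close>.
  The singular part is unique (on compact sets), the density is unique up to null sets.
\<close>

definition lebesgue_decomposition ::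
  "(real set \<Rightarrow> real) \<Rightarrow> (real \<Rightarrow> real) \<Rightarrow> (real set \<Rightarrow> real) \<Rightarrow> bool" where
  "lebesgue_decomposition \<mu> r s \<longleftrightarrow>
     r \<in> borel_measurable borel \<and> signed_radon_on UNIV s \<and>
     (\<exists>N \<in> null_sets lborel. emeasure (tot_var UNIV s) (- N) = 0) \<and>
     (\<forall>K. compact K \<longrightarrow> set_integrable lborel K r \<and> \<mu> K = (LINT x:K|lborel. r x) + s K)"

definition sing_part :: "(real set \<Rightarrow> real) \<Rightarrow> real set \<Rightarrow> real" where
  "sing_part \<mu> = (SOME s. \<exists>r. lebesgue_decomposition \<mu> r s)"

definition is_ac_density :: "(real set \<Rightarrow> real) \<Rightarrow> (real \<Rightarrow> real) \<Rightarrow> bool" where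
  "is_ac_density \<mu> r \<longleftrightarrow> (\<exists>s. lebesgue_decomposition \<mu> r s)"

definition ac_density :: "(real set \<Rightarrow> real) \<Rightarrow> real \<Rightarrow> real" where
  "ac_density \<mu> = (SOME r. is_ac_density \<mu> r)"

section \<open>Test functions\<close>

text \<open>\<open>f \<in> C\<^sup>1\<^sub>c(S)\<close> with derivative \<open>f'\<close>.\<close>

definition C1c :: "real set \<Rightarrow> (real \<Rightarrow> real) \<Rightarrow> (real \<Rightarrow> real) \<Rightarrow> bool" where
  "C1c S f f' \<longleftrightarrow>
     (\<forall>x. (f has_real_derivative f' x) (at x)) \<and> continuous_on UNIV f' \<and>
     (\<exists>K. compact K \<and> K \<subseteq> S \<and> (\<forall>x. x \<notin> K \<longrightarrow> f x = 0))"

text \<open>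
  Functions of \<open>(x, t)\<close> are written as curves \<open>t \<mapsto> \<zeta> t\<close> of functions of \<open>x\<close>.
  Continuity and differentiability of a curve are with respect to the sup norm.
\<close>

definition C0_curve :: "real \<Rightarrow> (real \<Rightarrow> real \<Rightarrow> real) \<Rightarrow> bool" where
  "C0_curve T g \<longleftrightarrow> (\<forall>t\<in>{0..T}. uniform_limit UNIV g (g t) (at t within {0..T}))"

definition C1_curve :: "real \<Rightarrow> (real \<Rightarrow> real \<Rightarrow> real) \<Rightarrow> (real \<Rightarrow> real \<Rightarrow> real) \<Rightarrow> bool" where
  "C1_curve T g g' \<longleftrightarrow>
     (\<forall>t\<in>{0..T}. uniform_limit UNIV (\<lambda>s x. (g s x - g t x) / (s - t)) (g' t) (at t within {0..T}))
     \<and> C0_curve T g'"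

text \<open>
  \<open>C\<^sub>c(\<real>)\<close> and \<open>C\<^sup>1\<^sub>c(\<real>)\<close> carry the usual inductive limit topology, so a continuous curve on
  the compact interval \<open>[0, T]\<close> has a common compact support.
\<close>

definition common_support :: "real \<Rightarrow> (real \<Rightarrow> real \<Rightarrow> real) \<Rightarrow> bool" where
  "common_support T \<zeta> \<longleftrightarrow> (\<exists>K. compact K \<and> (\<forall>t\<in>{0..T}. \<forall>x. x \<notin> K \<longrightarrow> \<zeta> t x = 0))"

text \<open>\<open>\<zeta> \<in> C([0,T]; C\<^sub>c(\<real>))\<close>.\<close>

definition C_Cc :: "real \<Rightarrow> (real \<Rightarrow> real \<Rightarrow> real) \<Rightarrow> bool" where
  "C_Cc T \<zeta> \<longleftrightarrow> common_support T \<zeta> \<and> (\<forall>t\<in>{0..T}. continuous_on UNIV (\<zeta> t)) \<and> C0_curve T \<zeta>"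

text \<open>
  \<open>\<zeta> \<in> C\<^sup>1([0,T]; C\<^sup>1\<^sub>c(\<real>))\<close> with partial derivatives \<open>\<zeta>t\<close>, \<open>\<zeta>x\<close>: the time derivative is taken
  in the \<open>C\<^sup>1\<close> norm, i.e. uniformly for \<open>\<zeta>\<close> and for \<open>\<zeta>x\<close>.
\<close>

definition C1_C1c ::
  "real \<Rightarrow> (real \<Rightarrow> real \<Rightarrow> real) \<Rightarrow> (real \<Rightarrow> real \<Rightarrow> real) \<Rightarrow> (real \<Rightarrow> real \<Rightarrow> real) \<Rightarrow> bool" where
  "C1_C1c T \<zeta> \<zeta>t \<zeta>x \<longleftrightarrow>
     common_support T \<zeta> \<and>
     (\<exists>\<zeta>tx. (\<forall>t\<in>{0..T}. C1c UNIV (\<zeta> t) (\<zeta>x t) \<and> C1c UNIV (\<zeta>t t) (\<zeta>tx t)) \<and>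
            C1_curve T \<zeta> \<zeta>t \<and> C1_curve T \<zeta>x \<zeta>tx)"

section \<open>Measure-valued functions of time\<close>

definition strip :: "real \<Rightarrow> (real \<times> real) set" where
  "strip T = UNIV \<times> {0<..<T}"

text \<open>
  \<open>U \<in> L\<^sup>\<infinity>\<^sub>w\<^sub>*(0,T; M\<^sup>+(\<real>))\<close> with time slices \<open>P t\<close>. A finite \<open>esssup\<close> includes measurability.
\<close>

definition Linf_wstar_pos ::
  "real \<Rightarrow> (real \<times> real) measure \<Rightarrow> (real \<Rightarrow> real measure) \<Rightarrow> bool" where
  "Linf_wstar_pos T U P \<longleftrightarrow>
     radon_measure_on (strip T) U \<and>
     (AE t in lebesgue_on {0<..<T}. radon_measure_on UNIV (P t)) \<and>
     (\<forall>\<zeta>. C_Cc T \<zeta> \<longrightarrow>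
        set_integrable lebesgue {0<..<T} (\<lambda>t. LINT x|P t. \<zeta> t x) \<and>
        integrable U (\<lambda>(x, t). \<zeta> t x) \<and>
        (LINT (x, t)|U. \<zeta> t x) = (LINT t:{0<..<T}|lebesgue. LINT x|P t. \<zeta> t x)) \<and>
     (\<forall>K. compact K \<longrightarrow> esssup (lebesgue_on {0<..<T}) (\<lambda>t. emeasure (P t) K) < \<infinity>)"

text \<open>
  The curve \<open>t \<mapsto> u t\<close> consists of the time slices \<open>u(\<cdot>,t) = u\<^sup>+(\<cdot>,t) - u\<^sup>-(\<cdot>,t)\<close> of an element
  \<open>U\<close> of \<open>L\<^sup>\<infinity>\<^sub>w\<^sub>*(0,T; M(\<real>))\<close>.
\<close>

definition Linf_wstar :: "real \<Rightarrow> (real \<Rightarrow> real set \<Rightarrow> real) \<Rightarrow> bool" where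
  "Linf_wstar T u \<longleftrightarrow>
     (\<exists>U P N. signed_radon_on (strip T) U \<and>
        Linf_wstar_pos T (pos_part (strip T) U) P \<and>
        Linf_wstar_pos T (neg_part (strip T) U) N \<and>
        (AE t in lebesgue_on {0<..<T}.
           \<forall>K. compact K \<longrightarrow> u t K = measure (P t) K - measure (N t) K))"

text \<open>\<open>u \<in> C([0,\<infinity>); M(\<real>))\<close>.\<close>

definition continuous_measure_curve :: "(real \<Rightarrow> real set \<Rightarrow> real) \<Rightarrow> bool" where
  "continuous_measure_curve u \<longleftrightarrow>
     (\<forall>t\<ge>0. signed_radon_on UNIV (u t)) \<and>
     (\<forall>t0\<ge>0. \<forall>K. compact K \<longrightarrow>
        ((\<lambda>t. measure (tot_var UNIV (\<lambda>A. u t A - u t0 A)) K) \<longlongrightarrow> 0) (at t0 within {0..}))"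

text \<open>
  \<open>ur\<close> is a representative of \<open>u\<^sub>r\<close>, jointly measurable in \<open>(x, t)\<close>. As for any \<open>L\<^sup>1\<^sub>l\<^sub>o\<^sub>c\<close> function,
  \<open>u\<^sub>r\<close> is only defined up to null sets of the plane; none of the conditions below depends on
  the representative. Choosing a density separately for each \<open>t\<close> would not guarantee joint
  measurability.
\<close>

definition is_regular_part ::
  "real \<Rightarrow> (real \<Rightarrow> real set \<Rightarrow> real) \<Rightarrow> (real \<Rightarrow> real \<Rightarrow> real) \<Rightarrow> bool" where
  "is_regular_part T u ur \<longleftrightarrow>
     (\<lambda>(x, t). ur t x) \<in> borel_measurable borel \<and>
     (AE t in lebesgue_on {0<..<T}. is_ac_density (u t) (ur t))"

section \<open>Entropy solutions\<close>

definition entropy_solution ::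
  "(real \<Rightarrow> real) \<Rightarrow> (real set \<Rightarrow> real) \<Rightarrow> real \<Rightarrow>
   (real \<Rightarrow> real set \<Rightarrow> real) \<Rightarrow> (real \<Rightarrow> real \<Rightarrow> real) \<Rightarrow> bool" where
  "entropy_solution H u0 T u ur \<longleftrightarrow>
     Linf_wstar T u \<and> is_regular_part T u ur \<and>
     (\<forall>\<zeta> \<zeta>t \<zeta>x. C1_C1c T \<zeta> \<zeta>t \<zeta>x \<and> (\<forall>x. \<zeta> T x = 0) \<longrightarrow>
        (LINT (x, t):strip T|lborel. ur t x * \<zeta>t t x + H (ur t x) * \<zeta>x t x)
        + (LINT t:{0<..<T}|lebesgue. pairing (sing_part (u t)) (\<zeta>t t))
        = - pairing u0 (\<zeta> 0)) \<and>
     (\<forall>k \<zeta> \<zeta>t \<zeta>x. C1_C1c T \<zeta> \<zeta>t \<zeta>x \<and> (\<forall>x. \<zeta> T x = 0) \<and> (\<forall>t\<in>{0..T}. \<forall>x. 0 \<le> \<zeta> t x) \<longrightarrow>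
        (LINT (x, t):strip T|lborel.
            \<bar>ur t x - k\<bar> * \<zeta>t t x + sgn (ur t x - k) * (H (ur t x) - H k) * \<zeta>x t x)
        + (LINT t:{0<..<T}|lebesgue. LINT x|tot_var UNIV (sing_part (u t)). \<zeta>t t x)
        \<ge> - (LINT x|lborel. \<bar>ac_density u0 x - k\<bar> * \<zeta> 0 x)
          - (LINT x|tot_var UNIV (sing_part u0). \<zeta> 0 x))"

definition global_entropy_solution ::
  "(real \<Rightarrow> real) \<Rightarrow> (real set \<Rightarrow> real) \<Rightarrow>
   (real \<Rightarrow> real set \<Rightarrow> real) \<Rightarrow> (real \<Rightarrow> real \<Rightarrow> real) \<Rightarrow> bool" where
  "global_entropy_solution H u0 u ur \<longleftrightarrow> (\<forall>T>0. entropy_solution H u0 T u ur)"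

definition waiting_time :: "(real \<Rightarrow> real set \<Rightarrow> real) \<Rightarrow> real \<Rightarrow> ennreal" where
  "waiting_time u a = (SUP t\<in>{t. 0 < t \<and> sing_part (u t) {a} \<noteq> 0}. ennreal t)"

definition sgn_plus :: "real \<Rightarrow> real" where
  "sgn_plus = indicator {0<..}"

definition sgn_minus :: "real \<Rightarrow> real" where
  "sgn_minus s = - indicator {..<0} s"

text \<open>Limits along these filters are the one-sided essential limits.\<close>

definition ess_at_right :: "real \<Rightarrow> real filter" where
  "ess_at_right a = inf (at_right a) (ae_filter lborel)"

definition ess_at_left :: "real \<Rightarrow> real filter" where
  "ess_at_left a = inf (at_left a) (ae_filter lborel)"

definition entropy_flux_integral ::
  "(real \<Rightarrow> real) \<Rightarrow> (real \<Rightarrow> real) \<Rightarrow> (real \<Rightarrow> real \<Rightarrow> real) \<Rightarrow> real set \<Rightarrow> real \<Rightarrow>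
   (real \<Rightarrow> real) \<Rightarrow> real \<Rightarrow> real" where
  "entropy_flux_integral sg H ur I k \<beta> x =
     (LINT t:I|lborel. sg (ur t x - k) * (H (ur t x) - H k) * \<beta> t)"

text \<open>Compatibility condition at the point \<open>a\<close> carrying the initial mass \<open>c \<noteq> 0\<close>.\<close>

definition compatibility_condition ::
  "(real \<Rightarrow> real) \<Rightarrow> (real \<Rightarrow> real set \<Rightarrow> real) \<Rightarrow> (real \<Rightarrow> real \<Rightarrow> real) \<Rightarrow> real \<Rightarrow> real \<Rightarrow> bool" where
  "compatibility_condition H u ur a c \<longleftrightarrow>
     (let I = {t. 0 < t \<and> ennreal t < waiting_time u a};
          sg = (if c > 0 then sgn_minus else sgn_plus)
      in \<forall>k \<beta> \<beta>'. C1c I \<beta> \<beta>' \<and> (\<forall>t. 0 \<le> \<beta> t) \<longrightarrow>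
           (\<exists>L\<le>0. (entropy_flux_integral sg H ur I k \<beta> \<longlongrightarrow> L) (ess_at_right a)) \<and>
           (\<exists>L\<ge>0. (entropy_flux_integral sg H ur I k \<beta> \<longlongrightarrow> L) (ess_at_left a)))"

section \<open>The flux function\<close>

definition Linf_norm :: "real set \<Rightarrow> (real \<Rightarrow> real) \<Rightarrow> ereal" where
  "Linf_norm S g = esssup (restrict_space lborel S) (\<lambda>x. ereal \<bar>g x\<bar>)"

definition is_weak_derivative :: "(real \<Rightarrow> real) \<Rightarrow> (real \<Rightarrow> real) \<Rightarrow> bool" where
  "is_weak_derivative H G \<longleftrightarrow>
     (\<forall>\<phi> \<phi>'. C1c UNIV \<phi> \<phi>' \<longrightarrow>
        (LINT x|lborel. H x * \<phi>' x) = - (LINT x|lborel. G x * \<phi> x))"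

definition is_bounded_weak_derivative :: "(real \<Rightarrow> real) \<Rightarrow> (real \<Rightarrow> real) \<Rightarrow> bool" where
  "is_bounded_weak_derivative H G \<longleftrightarrow>
     G \<in> borel_measurable borel \<and> Linf_norm UNIV G < \<infinity> \<and> is_weak_derivative H G"

text \<open>
  \<open>H \<in> W\<^sup>1\<^sup>,\<^sup>\<infinity>(\<real>)\<close>. As \<open>H\<close> is evaluated at points, it has to be the continuous representative.
\<close>

definition W1inf :: "(real \<Rightarrow> real) \<Rightarrow> bool" where
  "W1inf H \<longleftrightarrow>
     continuous_on UNIV H \<and> Linf_norm UNIV H < \<infinity> \<and> (\<exists>G. is_bounded_weak_derivative H G)"

definition weak_deriv :: "(real \<Rightarrow> real) \<Rightarrow> real \<Rightarrow> real" where
  "weak_deriv H = (SOME G. is_bounded_weak_derivative H G)"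

text \<open>Both norms are finite for \<open>H \<in> W\<^sup>1\<^sup>,\<^sup>\<infinity>(\<real>)\<close>.\<close>

definition M_plus :: "(real \<Rightarrow> real) \<Rightarrow> real \<Rightarrow> real" where
  "M_plus H k = real_of_ereal (Linf_norm {k<..} (weak_deriv H))"

definition M_minus :: "(real \<Rightarrow> real) \<Rightarrow> real \<Rightarrow> real" where
  "M_minus H k = real_of_ereal (Linf_norm {..<k} (weak_deriv H))"

definition H5_i :: "(real \<Rightarrow> real) \<Rightarrow> bool" where
  "H5_i H \<longleftrightarrow>
     (\<exists>Hp. (H \<longlongrightarrow> Hp) at_top \<and>
        \<not> (\<exists>c>0. H constant_on {c<..}) \<and>
        (M_plus H \<longlongrightarrow> 0) at_top \<and>
        (\<exists>C0>0. Limsup at_top (\<lambda>k. ereal (\<bar>H k - Hp\<bar> / M_plus H k)) \<ge> ereal C0))"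

definition H5_ii :: "(real \<Rightarrow> real) \<Rightarrow> bool" where
  "H5_ii H \<longleftrightarrow>
     (\<exists>Hm. (H \<longlongrightarrow> Hm) at_bot \<and>
        \<not> (\<exists>d<0. H constant_on {..<d}) \<and>
        (M_minus H \<longlongrightarrow> 0) at_bot \<and>
        (\<exists>C0>0. Limsup at_bot (\<lambda>k. ereal (\<bar>H k - Hm\<bar> / M_minus H k)) \<ge> ereal C0))"

definition H6_i :: "(real \<Rightarrow> real) \<Rightarrow> bool" where
  "H6_i H \<longleftrightarrow>
     (\<exists>Hp. (H \<longlongrightarrow> Hp) at_top \<and>
        (\<exists>k>0. (\<forall>\<xi>\<ge>k. H \<xi> > Hp) \<or> (\<forall>\<xi>\<ge>k. H \<xi> < Hp)))"

definition H6_ii :: "(real \<Rightarrow> real) \<Rightarrow> bool" where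
  "H6_ii H \<longleftrightarrow>
     (\<exists>Hm. (H \<longlongrightarrow> Hm) at_bot \<and>
        (\<exists>k<0. (\<forall>\<xi>\<le>k. H \<xi> > Hm) \<or> (\<forall>\<xi>\<le>k. H \<xi> < Hm)))"

end

theory Submission
  imports Defs
begin

text \<open>
  Write \<open>C\<close> for the sum of the \<open>\<bar>c i\<bar>\<close>, let \<open>a\<close> be the position of the atom, and suppose that its waiting time is
  infinite, so that the compatibility condition at \<open>a\<close> is available for all times. The substitution
  \<open>V(y, t) = \<sigma> u\<^sub>r(a + \<theta> y, t)\<close>, \<open>G(\<xi>) = \<theta> \<sigma> H(\<sigma> \<xi>)\<close>, with \<open>\<sigma>\<close> the sign of the mass and \<open>\<theta>\<close> the choice of a
  side of \<open>a\<close>, turns all cases of the theorem into one problem at \<open>y = 0\<close>, where a positive mass sits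
  and \<open>g = G - G(\<infinity>)\<close> is positive for suitable large arguments. The contradiction comes from two
  estimates of the flux that leaves the origin.

  The outflow is bounded. The entropy inequalities for \<open>k = n\<close> and \<open>k = - n\<close>, added and with
  \<open>n \<rightarrow> \<infinity>\<close>, retain only the singular part, and say that its total variation does not grow
  (\<open>singular_variation_bound\<close>). Hence, if the weak equation is tested with a bump that shrinks to the
  origin, times a function of time rising from \<open>0\<close> to \<open>1\<close> and falling back to \<open>0\<close>, then the time
  integral of the difference between the fluxes right and left of the origin is at most \<open>2 C\<close>
  (\<open>flux_through_bump\<close>), however long the time interval is. By the compatibility condition for large
  \<open>k\<close> the flux on the left is at most \<open>G(\<infinity>)\<close>, so \<open>2 C\<close> bounds the time integral of \<open>g(V)\<close> on the right.

  The outflow is large. By the compatibility condition for a fixed \<open>k\<close>, the trace of \<open>g(V)\<close> on the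
  right is at least \<open>g(k)\<close> plus the trace of the flux \<open>\<Psi>\<close> of the entropy \<open>(V - k)\<^sup>+\<close>, and \<open>\<Psi>\<close> is controlled by the
  entropy inequality in the triangle \<open>0 < y < X - s t\<close>: if \<open>g(\<xi>) + s (\<xi> - k) \<ge> \<mu>\<close> for all \<open>\<xi> \<ge> k\<close>, then the
  outflow during the time \<open>X / s\<close> is at least \<open>\<mu> X / (4 s) - C - \<integral> (V\<^sub>0 - k)\<^sup>+\<close>, the integral being over
  \<open>(0, X)\<close>; the factor \<open>1/4\<close> is due to a smooth weight. Both estimates together are \<open>flux_budget\<close>:
  \<open>\<mu> X / (4 s) \<le> 3 C + \<integral> (V\<^sub>0 - k)\<^sup>+ + 1\<close>.

  If \<open>g > 0\<close> on \<open>[k, \<infinity>)\<close>, fix \<open>X = 1\<close>. For given \<open>n\<close>, the choice \<open>s = min\<^bsub>[k, k + n]\<^esub> g / n\<close> allows \<open>\<mu> = s n\<close>, so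
  that \<open>n / 4\<close> is bounded independently of \<open>n\<close>, which is absurd
  (\<open>flux_not_eventually_above_limit\<close>). If \<open>g(k) \<ge> C\<^sub>1 M\<close> for arbitrarily large \<open>k\<close>, with \<open>M\<close> a bound
  for the slopes \<open>(G(\<xi>) - G(k)) / (\<xi> - k)\<close>, \<open>\<xi> > k\<close>, take \<open>s = M\<close> and \<open>\<mu> = g(k)\<close>. The integral of \<open>(V\<^sub>0 - k)\<^sup>+\<close> over \<open>(0, X)\<close> vanishes
  as \<open>k \<rightarrow> \<infinity>\<close>, so that \<open>C\<^sub>1 X / 4 \<le> 3 C + 2\<close> for every \<open>X\<close>, which is absurd too
  (\<open>flux_not_frequently_steep\<close>).

  The integrals used above make sense because of some measure theory. Signed Radon measures are given by their values on compact
  sets, and are compared by writing all those concerned as densities with respect to one dominating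
  Radon measure. The regular and singular parts of \<open>u(t)\<close> then inherit the continuity in time of
  \<open>u\<close> in total variation, and this makes all time integrals in the definition of an entropy solution
  genuine ones.
\<close>

section \<open>Radon measures on the line and their densities\<close>

lemma radon_sets: "radon_measure_on UNIV \<nu> \<Longrightarrow> sets \<nu> = sets borel"
  by (simp add: radon_measure_on_def sets_restrict_space)

lemma radon_space: "radon_measure_on UNIV \<nu> \<Longrightarrow> space \<nu> = UNIV"
  using sets_eq_imp_space_eq[OF radon_sets] by simp

lemma radon_borel_measurable:
  "radon_measure_on UNIV \<nu> \<Longrightarrow> f \<in> borel_measurable \<nu> \<longleftrightarrow> f \<in> borel_measurable borel"
  using measurable_cong_sets[OF radon_sets refl] by blast

lemma radon_compact: "radon_measure_on UNIV \<nu> \<Longrightarrow> compact K \<Longrightarrow> emeasure \<nu> K < \<infinity>"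
  by (simp add: radon_measure_on_def)

lemma radon_sigma_finite:
  fixes \<nu> :: "real measure"
  assumes "radon_measure_on UNIV \<nu>"
  shows "sigma_finite_measure \<nu>"
proof
  have "(\<Union>n::nat. cball (0::real) (real n)) = UNIV"
    using real_arch_simple by (auto simp: dist_real_def)
  then show "\<exists>A. countable A \<and> A \<subseteq> sets \<nu> \<and> \<Union> A = space \<nu> \<and> (\<forall>a\<in>A. emeasure \<nu> a \<noteq> \<infinity>)"
    using radon_compact[OF assms] radon_sets[OF assms] radon_space[OF assms]
    by (intro exI[of _ "range (\<lambda>n::nat. cball (0::real) (real n))"])
       (auto simp: less_top[symmetric])
qed

lemma radon_lborel: "radon_measure_on UNIV (lborel :: real measure)"
  using emeasure_bounded_finite[OF compact_imp_bounded]
  by (auto simp: radon_measure_on_def sets_restrict_space)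

text \<open>
  The supremum of the two measures is bounded by their sum, hence finite on compact sets.
\<close>

lemma radon_dominating:
  fixes \<mu> \<nu> :: "real measure"
  assumes \<mu>: "radon_measure_on UNIV \<mu>" and \<nu>: "radon_measure_on UNIV \<nu>"
  obtains \<omega> where "radon_measure_on UNIV \<omega>"
    "absolutely_continuous \<omega> \<mu>" "absolutely_continuous \<omega> \<nu>"
proof
  define l where "l = sup_measure' \<mu> \<nu>"
  have s: "sets \<nu> = sets \<mu>"
    using radon_sets[OF \<mu>] radon_sets[OF \<nu>] by simp
  have sl: "sets l = sets \<mu>"
    unfolding l_def by (rule sets_sup_measure'[OF s])
  have le: "emeasure l X \<le> emeasure \<mu> X + emeasure \<nu> X" if X: "X \<in> sets \<mu>" for X
    unfolding l_def
    by (subst emeasure_sup_measure'[OF s X], rule SUP_least)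
       (use X s in \<open>auto intro!: add_mono emeasure_mono\<close>)
  show "radon_measure_on UNIV l"
    unfolding radon_measure_on_def
  proof (intro conjI allI impI)
    show "sets l = sets (restrict_space borel UNIV)"
      using sl radon_sets[OF \<mu>] by (simp add: sets_restrict_space)
    fix K :: "real set" assume K: "compact K \<and> K \<subseteq> UNIV"
    then have "K \<in> sets \<mu>"
      using radon_sets[OF \<mu>] by (simp add: borel_compact)
    then show "emeasure l K < \<infinity>"
      using le[of K] radon_compact[OF \<mu>, of K] radon_compact[OF \<nu>, of K] K
      by (auto intro: le_less_trans)
  qed
  show "absolutely_continuous l \<mu>" "absolutely_continuous l \<nu>"
    unfolding absolutely_continuous_def null_sets_def l_def
    using le_emeasure_sup_measure'1[OF s] le_emeasure_sup_measure'2[OF s] s sl l_def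
    by fastforce+
qed

lemma radon_density:
  fixes \<nu> \<omega> :: "real measure"
  assumes \<nu>: "radon_measure_on UNIV \<nu>" and \<omega>: "radon_measure_on UNIV \<omega>"
    and ac: "absolutely_continuous \<omega> \<nu>"
  obtains h :: "real \<Rightarrow> real"
  where "h \<in> borel_measurable borel" "\<And>x. 0 \<le> h x" "\<nu> = density \<omega> (\<lambda>x. ennreal (h x))"
proof
  interpret sigma_finite_measure \<omega> by (rule radon_sigma_finite[OF \<omega>])
  have s: "sets \<nu> = sets \<omega>" using radon_sets[OF \<nu>] radon_sets[OF \<omega>] by simp
  let ?h = "\<lambda>x. enn2real (RN_deriv \<omega> \<nu> x)"
  have fin: "AE x in \<omega>. RN_deriv \<omega> \<nu> x \<noteq> \<infinity>"
    by (rule RN_deriv_finite[OF radon_sigma_finite[OF \<nu>] ac s])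
  have m: "RN_deriv \<omega> \<nu> \<in> borel_measurable \<omega>" by simp
  show "?h \<in> borel_measurable borel"
    using m measurable_cong_sets[OF radon_sets[OF \<omega>] refl] by (metis borel_measurable_enn2real)
  show "\<And>x. 0 \<le> ?h x" by simp
  have "density \<omega> (RN_deriv \<omega> \<nu>) = density \<omega> (\<lambda>x. ennreal (?h x))"
    using fin by (intro density_cong) (auto simp: less_top[symmetric])
  then show "\<nu> = density \<omega> (\<lambda>x. ennreal (?h x))"
    using density_RN_deriv[OF ac s] by simp
qed

section \<open>Representations of signed Radon measures\<close>

lemma representsD:
  fixes \<nu> :: "real measure"
  assumes "represents UNIV \<mu> \<nu> f"
  shows "radon_measure_on UNIV \<nu>" "f \<in> borel_measurable borel"
    "compact K \<Longrightarrow> set_integrable \<nu> K f" "compact K \<Longrightarrow> \<mu> K = (LINT x:K|\<nu>. f x)"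
  using assms radon_borel_measurable by (auto simp: represents_def)

lemma representsI:
  fixes \<nu> :: "real measure"
  assumes "radon_measure_on UNIV \<nu>" "f \<in> borel_measurable borel"
    "\<And>K. compact K \<Longrightarrow> set_integrable \<nu> K f" "\<And>K. compact K \<Longrightarrow> \<mu> K = (LINT x:K|\<nu>. f x)"
  shows "represents UNIV \<mu> \<nu> f"
  using assms radon_borel_measurable by (auto simp: represents_def)

lemma radon_rep_represents:
  assumes "signed_radon_on S \<mu>" "radon_rep S \<mu> = (\<nu>, f)"
  shows "represents S \<mu> \<nu> f"
proof -
  have "\<exists>z. case z of (\<nu>, f) \<Rightarrow> represents S \<mu> \<nu> f"
    using assms(1) by (auto simp: signed_radon_on_def)
  from someI_ex[OF this] show ?thesis
    using assms(2) by (simp add: radon_rep_def split: prod.splits)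
qed

lemma set_integrable_density_iff:
  fixes \<omega> :: "real measure" and f h :: "real \<Rightarrow> real"
  assumes "sets \<omega> = sets borel" "h \<in> borel_measurable borel" "f \<in> borel_measurable borel"
    "\<And>x. 0 \<le> h x" "A \<in> sets borel"
  shows "set_integrable (density \<omega> (\<lambda>x. ennreal (h x))) A f \<longleftrightarrow> set_integrable \<omega> A (\<lambda>x. h x * f x)"
    and "(LINT x:A|density \<omega> (\<lambda>x. ennreal (h x)). f x) = (LINT x:A|\<omega>. h x * f x)"
proof -
  have [measurable]: "h \<in> borel_measurable \<omega>" "f \<in> borel_measurable \<omega>" "A \<in> sets \<omega>"
    using assms measurable_cong_sets[OF assms(1) refl] by auto
  show "set_integrable (density \<omega> (\<lambda>x. ennreal (h x))) A f \<longleftrightarrow> set_integrable \<omega> A (\<lambda>x. h x * f x)"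
    using assms(4) unfolding set_integrable_def
    by (subst integrable_density) (auto simp: mult_ac)
  show "(LINT x:A|density \<omega> (\<lambda>x. ennreal (h x)). f x) = (LINT x:A|\<omega>. h x * f x)"
    using assms(4) unfolding set_lebesgue_integral_def
    by (subst integral_density) (auto simp: mult_ac)
qed

text \<open>
  Passing to a larger reference measure multiplies the density by a nonnegative function \<open>h\<close>, so
  total variation and pairing keep their meaning.
\<close>

lemma represents_change:
  fixes \<nu> \<omega> :: "real measure"
  assumes r: "represents UNIV \<mu> \<nu> f" and \<omega>: "radon_measure_on UNIV \<omega>"
    and ac: "absolutely_continuous \<omega> \<nu>"
  obtains F where "represents UNIV \<mu> \<omega> F"
    "density \<nu> (\<lambda>x. ennreal \<bar>f x\<bar>) = density \<omega> (\<lambda>x. ennreal \<bar>F x\<bar>)"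
    "\<forall>\<phi>\<in>borel_measurable borel. (LINT x|\<nu>. f x * \<phi> x) = (LINT x|\<omega>. F x * \<phi> x)"
proof -
  note n = representsD[OF r]
  obtain h where h: "h \<in> borel_measurable borel" "\<And>x. 0 \<le> h x"
    and d: "\<nu> = density \<omega> (\<lambda>x. ennreal (h x))"
    using radon_density[OF n(1) \<omega> ac] by blast
  note sl = radon_sets[OF \<omega>]
  have [measurable]: "h \<in> borel_measurable \<omega>" "f \<in> borel_measurable \<omega>"
    using h(1) n(2) measurable_cong_sets[OF sl refl] by auto
  show ?thesis
  proof
    show "represents UNIV \<mu> \<omega> (\<lambda>x. h x * f x)"
      using n h(1) set_integrable_density_iff[OF sl h(1) n(2) h(2)] d
      by (intro representsI \<omega>) (auto simp: borel_compact)
    show "density \<nu> (\<lambda>x. ennreal \<bar>f x\<bar>) = density \<omega> (\<lambda>x. ennreal \<bar>h x * f x\<bar>)"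
      unfolding d by (subst density_density_eq)
       (use h(2) in \<open>auto simp: abs_mult ennreal_mult\<close>)
    show "\<forall>\<phi>\<in>borel_measurable borel. (LINT x|\<nu>. f x * \<phi> x) = (LINT x|\<omega>. h x * f x * \<phi> x)"
    proof
    fix \<phi> :: "real \<Rightarrow> real" assume "\<phi> \<in> borel_measurable borel"
    then have [measurable]: "\<phi> \<in> borel_measurable \<omega>"
      using measurable_cong_sets[OF sl refl] by auto
    show "(LINT x|\<nu>. f x * \<phi> x) = (LINT x|\<omega>. h x * f x * \<phi> x)"
      unfolding d by (subst integral_density) (use h(2) in \<open>auto simp: mult_ac\<close>)
    qed
  qed
qed

text \<open>
  Restricted to a ball, \<open>D\<close> is integrable and its integral vanishes over all closed sets; these form a
  generator of the Borel sets that is stable under intersection.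
\<close>

lemma zero_on_compacts_AE_zero:
  fixes \<omega> :: "real measure" and D :: "real \<Rightarrow> real"
  assumes \<omega>: "radon_measure_on UNIV \<omega>" and D: "D \<in> borel_measurable borel"
    and int: "\<And>K. compact K \<Longrightarrow> set_integrable \<omega> K D"
    and zero: "\<And>K. compact K \<Longrightarrow> (LINT x:K|\<omega>. D x) = 0"
  shows "AE x in \<omega>. D x = 0"
proof -
  interpret sigma_finite_measure \<omega> by (rule radon_sigma_finite[OF \<omega>])
  note sl = radon_sets[OF \<omega>] note spl = radon_space[OF \<omega>]
  have "AE x in \<omega>. x \<in> cball 0 (real n) \<longrightarrow> D x = 0" for n :: nat
  proof -
    define E where "E x = indicator (cball 0 (real n)) x * D x" for x
    have iE: "integrable \<omega> E"
      using int[of "cball 0 (real n)"] by (simp add: set_integrable_def E_def[abs_def])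
    have sE: "set_integrable \<omega> A E" if "A \<in> sets borel" for A
      using iE that sl unfolding set_integrable_def
      by (intro integrable_mult_indicator) auto
    have "(LINT x:A|\<omega>. E x) = 0" if "A \<in> sigma_sets UNIV {S. closed S}" for A
    proof (rule sigma_sets_induct_disjoint[where G = "{S. closed S}" and \<Omega> = UNIV])
      show "Int_stable {S::real set. closed S}" by (auto simp: Int_stable_def)
    next
      show "{S::real set. closed S} \<subseteq> Pow UNIV" by simp
    next
      show "A \<in> sigma_sets UNIV {S. closed S}" by (rule that)
    next
      fix A :: "real set" assume "A \<in> {S. closed S}"
      then have "compact (cball 0 (real n) \<inter> A)" by (simp add: compact_Int_closed)
      from zero[OF this] show "(LINT x:A|\<omega>. E x) = 0"
        unfolding set_lebesgue_integral_def E_def by (simp add: indicator_inter_arith mult_ac)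
    next
      show "(LINT x:{}|\<omega>. E x) = 0" by (simp add: set_lebesgue_integral_def)
    next
      fix A :: "real set" assume A: "A \<in> sigma_sets UNIV {S. closed S}" and z: "(LINT x:A|\<omega>. E x) = 0"
      have Ab: "A \<in> sets borel" using A by (simp add: borel_eq_closed)
      have "(LINT x:cball 0 (real n)|\<omega>. D x) = 0" by (rule zero) simp
      then have t: "(LINT x|\<omega>. E x) = 0" by (simp add: set_lebesgue_integral_def E_def)
      have "(LINT x|\<omega>. E x) = (LINT x:A \<union> (UNIV - A)|\<omega>. E x)"
        by (simp add: set_lebesgue_integral_def)
      also have "\<dots> = (LINT x:A|\<omega>. E x) + (LINT x:UNIV - A|\<omega>. E x)"
        using Ab sE by (intro set_integral_Un) auto
      finally show "(LINT x:UNIV - A|\<omega>. E x) = 0" using t z by simp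
    next
      fix A :: "nat \<Rightarrow> real set"
      assume dj: "disjoint_family A" and A: "range A \<subseteq> sigma_sets UNIV {S. closed S}"
        and z: "\<And>i. (LINT x:A i|\<omega>. E x) = 0"
      have Ab: "A i \<in> sets borel" for i using A by (auto simp: borel_eq_closed)
      have "(LINT x:(\<Union>i. A i)|\<omega>. E x) = (\<Sum>i. (LINT x:A i|\<omega>. E x))"
        using dj Ab sl sE by (intro lebesgue_integral_countable_add)
          (auto simp: disjoint_family_on_def)
      then show "(LINT x:\<Union> (range A)|\<omega>. E x) = 0" using z by simp
    qed
    then have "AE x in \<omega>. E x = 0"
      using iE sl by (intro density_zero) (simp_all add: borel_eq_closed)
    then show ?thesis by eventually_elim (auto simp: E_def indicator_def)
  qed
  then have "AE x in \<omega>. \<forall>n::nat. x \<in> cball 0 (real n) \<longrightarrow> D x = 0"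
    by (subst AE_all_countable) blast
  then show ?thesis
    by eventually_elim (metis mem_cball_0 real_arch_simple)
qed

lemma represents_unique:
  fixes \<omega> :: "real measure"
  assumes F: "represents UNIV \<mu> \<omega> F" and G: "represents UNIV \<mu>' \<omega> G"
    and eq: "\<And>K. compact K \<Longrightarrow> \<mu> K = \<mu>' K"
  shows "AE x in \<omega>. F x = G x"
proof -
  note f = representsD[OF F] note g = representsD[OF G]
  have "AE x in \<omega>. F x - G x = 0"
    using f g eq by (intro zero_on_compacts_AE_zero) (auto simp: set_integral_diff)
  then show ?thesis by simp
qed

lemma tot_var_eq:
  "radon_rep S \<mu> = (\<nu>, f) \<Longrightarrow> tot_var S \<mu> = density \<nu> (\<lambda>x. ennreal \<bar>f x\<bar>)"
  by (simp add: tot_var_def)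

text \<open>
  The reference measure in \<open>radon_rep\<close> is an arbitrary choice for each signed measure. This lemma
  provides one Radon measure on which finitely many of them, and Lebesgue measure, have densities.
\<close>

lemma common_dominating_measure:
  assumes "\<And>\<mu>. \<mu> \<in> set \<mu>s \<Longrightarrow> signed_radon_on (UNIV :: real set) \<mu>"
  obtains \<omega> :: "real measure" where "radon_measure_on UNIV \<omega>" "absolutely_continuous \<omega> lborel"
    "\<And>\<mu>. \<mu> \<in> set \<mu>s \<Longrightarrow> absolutely_continuous \<omega> (fst (radon_rep UNIV \<mu>))"
  using assms
proof (induction \<mu>s arbitrary: thesis)
  case Nil
  show ?case by (rule Nil(1)[OF radon_lborel]) (auto simp: absolutely_continuous_def)
next
  case (Cons \<mu> \<mu>s)
  obtain \<omega>' :: "real measure" where o': "radon_measure_on UNIV \<omega>'" "absolutely_continuous \<omega>' lborel"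
    "\<And>\<mu>. \<mu> \<in> set \<mu>s \<Longrightarrow> absolutely_continuous \<omega>' (fst (radon_rep UNIV \<mu>))"
    by (rule Cons.IH) (use Cons.prems(2) in auto)
  obtain \<nu> f where r: "radon_rep UNIV \<mu> = (\<nu>, f)" by fastforce
  have "radon_measure_on UNIV \<nu>"
    using representsD(1)[OF radon_rep_represents[OF _ r]] Cons.prems(2) by simp
  then obtain \<omega> where o: "radon_measure_on UNIV \<omega>" "absolutely_continuous \<omega> \<omega>'"
    "absolutely_continuous \<omega> \<nu>"
    using radon_dominating[OF o'(1)] by metis
  show ?case
  proof (rule Cons.prems(1)[OF o(1)])
    show "absolutely_continuous \<omega> lborel"
      using o(2) o'(2) by (auto simp: absolutely_continuous_def)
    show "absolutely_continuous \<omega> (fst (radon_rep UNIV \<mu>'))" if "\<mu>' \<in> set (\<mu> # \<mu>s)" for \<mu>'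
      using that o o'(3)[of \<mu>'] r by (auto simp: absolutely_continuous_def)
  qed
qed

lemma signed_radon_represents:
  fixes \<omega> :: "real measure"
  assumes \<mu>: "signed_radon_on UNIV \<mu>" and \<omega>: "radon_measure_on UNIV \<omega>"
    and ac: "absolutely_continuous \<omega> (fst (radon_rep UNIV \<mu>))"
  obtains F where "represents UNIV \<mu> \<omega> F"
    "tot_var UNIV \<mu> = density \<omega> (\<lambda>x. ennreal \<bar>F x\<bar>)"
    "\<forall>\<phi>\<in>borel_measurable borel. pairing \<mu> \<phi> = (LINT x|\<omega>. F x * \<phi> x)"
proof -
  obtain \<nu> f where r: "radon_rep UNIV \<mu> = (\<nu>, f)" by fastforce
  note rr = radon_rep_represents[OF \<mu> r]
  from represents_change[OF rr \<omega>] ac r that show ?thesis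
    by (auto simp: tot_var_eq[OF r] pairing_def)
qed

lemma integral_tot_var:
  fixes \<omega> :: "real measure"
  assumes "radon_measure_on UNIV \<omega>" "F \<in> borel_measurable borel" "\<phi> \<in> borel_measurable borel"
  shows "(LINT x|density \<omega> (\<lambda>x. ennreal \<bar>F x\<bar>). \<phi> x) = (LINT x|\<omega>. \<bar>F x\<bar> * \<phi> x)"
  using assms by (subst integral_density) (auto simp: radon_borel_measurable)

lemma integrable_mult_bounded_compact:
  fixes \<omega> :: "real measure"
  assumes F: "represents UNIV \<mu> \<omega> F" and \<phi>: "\<phi> \<in> borel_measurable borel"
    and b: "\<And>x. \<bar>\<phi> x\<bar> \<le> B" and K: "compact K" "\<And>x. x \<notin> K \<Longrightarrow> \<phi> x = 0"
  shows "integrable \<omega> (\<lambda>x. F x * \<phi> x)"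
proof (rule Bochner_Integration.integrable_bound)
  note f = representsD[OF F]
  show "integrable \<omega> (\<lambda>x. B * (indicator K x * F x))"
    using f(3)[OF K(1)] by (simp add: set_integrable_def)
  show "(\<lambda>x. F x * \<phi> x) \<in> borel_measurable \<omega>"
    using f(2) \<phi> by (simp add: radon_borel_measurable[OF f(1)])
  show "AE x in \<omega>. norm (F x * \<phi> x) \<le> norm (B * (indicator K x * F x))"
  proof (rule AE_I2)
    fix x
    have "0 \<le> B" using b[of x] by linarith
    then show "norm (F x * \<phi> x) \<le> norm (B * (indicator K x * F x))"
      using mult_right_mono[OF b[of x], of "\<bar>F x\<bar>"] K(2)[of x]
      by (cases "x \<in> K") (auto simp: abs_mult mult.commute)
  qed
qed

section \<open>Lebesgue decompositions\<close>

lemma lebesgue_decompositionD: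
  assumes "lebesgue_decomposition \<mu> r s"
  shows "r \<in> borel_measurable borel" "signed_radon_on UNIV s"
    "compact K \<Longrightarrow> set_integrable lborel K r"
    "compact K \<Longrightarrow> \<mu> K = (LINT x:K|lborel. r x) + s K"
  using assms by (auto simp: lebesgue_decomposition_def)

text \<open>
  Over a dominating measure the Lebesgue decomposition becomes a sum of two densities, one of which
  vanishes wherever the other does not.
\<close>

lemma decomposition_on_dominating:
  fixes \<omega> :: "real measure"
  assumes d: "lebesgue_decomposition \<mu> r s"
    and \<omega>: "radon_measure_on UNIV \<omega>"
    and h: "h \<in> borel_measurable borel" "\<And>x. 0 \<le> h x" "lborel = density \<omega> (\<lambda>x. ennreal (h x))"
    and g: "represents UNIV s \<omega> g" "tot_var UNIV s = density \<omega> (\<lambda>x. ennreal \<bar>g x\<bar>)"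
  shows "represents UNIV \<mu> \<omega> (\<lambda>x. h x * r x + g x)"
    and "AE x in \<omega>. h x = 0 \<or> g x = 0"
proof -
  note D = lebesgue_decompositionD[OF d] note G = representsD[OF g(1)]
  note so = radon_sets[OF \<omega>] note I = set_integrable_density_iff[OF so h(1) D(1) h(2)]
  have 1: "set_integrable \<omega> K (\<lambda>x. h x * r x)" if "compact K" for K
    using D(3)[OF that] I(1)[of K] that h(3) by (simp add: borel_compact)
  have 2: "(LINT x:K|\<omega>. h x * r x) = (LINT x:K|lborel. r x)" if "compact K" for K
    using I(2)[of K] that h(3) by (simp add: borel_compact)
  show "represents UNIV \<mu> \<omega> (\<lambda>x. h x * r x + g x)"
    using h(1) D G 1 2 by (intro representsI \<omega>) (auto simp: set_integral_add)
  obtain N where N: "N \<in> null_sets lborel" "emeasure (tot_var UNIV s) (- N) = 0"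
    using d by (auto simp: lebesgue_decomposition_def)
  have Nb: "N \<in> sets borel" using N(1) by auto
  have [measurable]: "h \<in> borel_measurable \<omega>" "g \<in> borel_measurable \<omega>" "- N \<in> sets \<omega>"
    using h(1) G(2) Nb so by (auto simp: radon_borel_measurable[OF \<omega>])
  have "- N \<in> null_sets (density \<omega> (\<lambda>x. ennreal \<bar>g x\<bar>))"
    using N(2) g(2) Nb so by (intro null_setsI) auto
  then have a: "AE x in \<omega>. x \<in> - N \<longrightarrow> \<not> 0 < ennreal \<bar>g x\<bar>"
    by (subst (asm) null_sets_density_iff) auto
  have "N \<in> null_sets (density \<omega> (\<lambda>x. ennreal (h x)))" using N(1) h(3) by simp
  then have b: "AE x in \<omega>. x \<in> N \<longrightarrow> \<not> 0 < ennreal (h x)"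
    by (subst (asm) null_sets_density_iff) auto
  from a b show "AE x in \<omega>. h x = 0 \<or> g x = 0"
    by eventually_elim (use h(2) in \<open>auto simp: less_le\<close>)
qed

lemma signed_radon_diff:
  assumes "signed_radon_on (UNIV :: real set) \<mu>" "signed_radon_on UNIV \<mu>'"
  shows "signed_radon_on UNIV (\<lambda>A. \<mu> A - \<mu>' A)"
proof -
  obtain \<omega> :: "real measure" where o: "radon_measure_on UNIV \<omega>" 
    "\<And>\<rho>. \<rho> \<in> set [\<mu>, \<mu>'] \<Longrightarrow> absolutely_continuous \<omega> (fst (radon_rep UNIV \<rho>))"
    by (rule common_dominating_measure[of "[\<mu>, \<mu>']"]) (use assms in auto)
  have ac: "absolutely_continuous \<omega> (fst (radon_rep UNIV \<mu>))"
    "absolutely_continuous \<omega> (fst (radon_rep UNIV \<mu>'))"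
    using o(2) by auto
  obtain F where F: "represents UNIV \<mu> \<omega> F"
    by (rule signed_radon_represents[OF assms(1) o(1) ac(1)])
  obtain G where G: "represents UNIV \<mu>' \<omega> G"
    by (rule signed_radon_represents[OF assms(2) o(1) ac(2)])
  note f = representsD[OF F] note g = representsD[OF G]
  have "represents UNIV (\<lambda>A. \<mu> A - \<mu>' A) \<omega> (\<lambda>x. F x - G x)"
    using f g by (intro representsI) (auto simp: set_integral_diff)
  then show ?thesis by (auto simp: signed_radon_on_def)
qed

lemma decomposition_signed_radon:
  assumes d: "lebesgue_decomposition \<mu> r s"
  shows "signed_radon_on UNIV \<mu>"
proof -
  note D = lebesgue_decompositionD[OF d]
  obtain \<omega> :: "real measure" where o: "radon_measure_on UNIV \<omega>" "absolutely_continuous \<omega> lborel"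
    "\<And>\<rho>. \<rho> \<in> set [s] \<Longrightarrow> absolutely_continuous \<omega> (fst (radon_rep UNIV \<rho>))"
    by (rule common_dominating_measure[of "[s]"]) (use D(2) in auto)
  obtain h :: "real \<Rightarrow> real" where h: "h \<in> borel_measurable borel" "\<forall>x. 0 \<le> h x"
    "lborel = density \<omega> (\<lambda>x. ennreal (h x))"
    using radon_density[OF radon_lborel o(1,2)] by metis
  have ac: "absolutely_continuous \<omega> (fst (radon_rep UNIV s))"
    using o(3) by simp
  obtain g where g: "represents UNIV s \<omega> g" "tot_var UNIV s = density \<omega> (\<lambda>x. ennreal \<bar>g x\<bar>)"
    by (rule signed_radon_represents[OF D(2) o(1) ac])
  show ?thesis
    using decomposition_on_dominating(1)[OF d o(1) h(1) h(2)[rule_format] h(3) g] by (auto simp: signed_radon_on_def)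
qed

text \<open>
  The last identity is the core of the comparison of two measures. Where \<open>h\<close> is positive, both singular
  densities vanish; elsewhere the regular ones do. Hence there is no cancellation in \<open>F\<close>, and the
  total variation of \<open>\<mu> - \<mu>'\<close> controls both parts of the difference.
\<close>

lemma compare_decompositions:
  assumes d: "lebesgue_decomposition \<mu> r s" and d': "lebesgue_decomposition \<mu>' r' s'"
  obtains \<omega> :: "real measure" and h g g' F where
    "radon_measure_on UNIV \<omega>" "h \<in> borel_measurable borel" "\<forall>x. 0 \<le> h x"
    "lborel = density \<omega> (\<lambda>x. ennreal (h x))"
    "represents UNIV s \<omega> g" "tot_var UNIV s = density \<omega> (\<lambda>x. ennreal \<bar>g x\<bar>)"
    "\<forall>\<phi>\<in>borel_measurable borel. pairing s \<phi> = (LINT x|\<omega>. g x * \<phi> x)"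
    "represents UNIV s' \<omega> g'" "tot_var UNIV s' = density \<omega> (\<lambda>x. ennreal \<bar>g' x\<bar>)"
    "\<forall>\<phi>\<in>borel_measurable borel. pairing s' \<phi> = (LINT x|\<omega>. g' x * \<phi> x)"
    "represents UNIV (\<lambda>A. \<mu> A - \<mu>' A) \<omega> F"
    "tot_var UNIV (\<lambda>A. \<mu> A - \<mu>' A) = density \<omega> (\<lambda>x. ennreal \<bar>F x\<bar>)"
    "AE x in \<omega>. F x = h x * (r x - r' x) + (g x - g' x)"
    "AE x in \<omega>. \<bar>F x\<bar> = h x * \<bar>r x - r' x\<bar> + \<bar>g x - g' x\<bar>"
proof -
  let ?D = "\<lambda>A. \<mu> A - \<mu>' A"
  note D = lebesgue_decompositionD[OF d] note D' = lebesgue_decompositionD[OF d']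
  have sr: "signed_radon_on UNIV ?D"
    by (intro signed_radon_diff decomposition_signed_radon[OF d] decomposition_signed_radon[OF d'])
  obtain \<omega> :: "real measure" where o: "radon_measure_on UNIV \<omega>" "absolutely_continuous \<omega> lborel"
    "\<And>\<rho>. \<rho> \<in> set [s, s', ?D] \<Longrightarrow> absolutely_continuous \<omega> (fst (radon_rep UNIV \<rho>))"
    by (rule common_dominating_measure[of "[s, s', ?D]"]) (use D(2) D'(2) sr in auto)
  obtain h :: "real \<Rightarrow> real" where h: "h \<in> borel_measurable borel" "\<forall>x. 0 \<le> h x"
    "lborel = density \<omega> (\<lambda>x. ennreal (h x))"
    using radon_density[OF radon_lborel o(1,2)] by metis
  have ac: "absolutely_continuous \<omega> (fst (radon_rep UNIV s))"
    "absolutely_continuous \<omega> (fst (radon_rep UNIV s'))"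
    "absolutely_continuous \<omega> (fst (radon_rep UNIV ?D))"
    using o(3) by auto
  obtain g where g: "represents UNIV s \<omega> g" "tot_var UNIV s = density \<omega> (\<lambda>x. ennreal \<bar>g x\<bar>)"
    "\<forall>\<phi>\<in>borel_measurable borel. pairing s \<phi> = (LINT x|\<omega>. g x * \<phi> x)"
    by (rule signed_radon_represents[OF D(2) o(1) ac(1)])
  obtain g' where g': "represents UNIV s' \<omega> g'" "tot_var UNIV s' = density \<omega> (\<lambda>x. ennreal \<bar>g' x\<bar>)"
    "\<forall>\<phi>\<in>borel_measurable borel. pairing s' \<phi> = (LINT x|\<omega>. g' x * \<phi> x)"
    by (rule signed_radon_represents[OF D'(2) o(1) ac(2)])
  obtain F where F: "represents UNIV ?D \<omega> F" "tot_var UNIV ?D = density \<omega> (\<lambda>x. ennreal \<bar>F x\<bar>)"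
    by (rule signed_radon_represents[OF sr o(1) ac(3)])
  note R = decomposition_on_dominating[OF d o(1) h(1) h(2)[rule_format] h(3) g(1,2)]
  note R' = decomposition_on_dominating[OF d' o(1) h(1) h(2)[rule_format] h(3) g'(1,2)]
  note r1 = representsD[OF R(1)] note r2 = representsD[OF R'(1)]
  have "represents UNIV ?D \<omega> (\<lambda>x. (h x * r x + g x) - (h x * r' x + g' x))"
    using r1 r2 by (intro representsI) (auto simp: set_integral_diff)
  from represents_unique[OF F(1) this refl]
  have e: "AE x in \<omega>. F x = h x * (r x - r' x) + (g x - g' x)"
    by (simp add: algebra_simps)
  have e': "AE x in \<omega>. \<bar>F x\<bar> = h x * \<bar>r x - r' x\<bar> + \<bar>g x - g' x\<bar>"
    using e R(2) R'(2) by eventually_elim (use h(2) in \<open>auto simp: abs_mult\<close>)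
  show ?thesis
    by (rule that[OF o(1) h g g' F e e'])
qed

text \<open>
  Both inequalities integrate the identity for \<open>\<bar>F\<bar>\<close>, the second one with
  \<open>\<bar>\<bar>g\<bar> - \<bar>g'\<bar>\<bar> \<le> \<bar>g - g'\<bar>\<close>.
\<close>

lemma decomposition_distance:
  assumes d: "lebesgue_decomposition \<mu> r s" and d': "lebesgue_decomposition \<mu>' r' s'"
    and K: "compact K"
  shows regular_part_distance:
      "(LINT x:K|lborel. \<bar>r x - r' x\<bar>) \<le> measure (tot_var UNIV (\<lambda>A. \<mu> A - \<mu>' A)) K"
    and singular_part_distance:
      "\<lbrakk>\<phi> \<in> borel_measurable borel; \<And>x. \<bar>\<phi> x\<bar> \<le> B; \<And>x. x \<notin> K \<Longrightarrow> \<phi> x = 0\<rbrakk> \<Longrightarrow>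
       \<bar>(LINT x|tot_var UNIV s. \<phi> x) - (LINT x|tot_var UNIV s'. \<phi> x)\<bar>
         \<le> B * measure (tot_var UNIV (\<lambda>A. \<mu> A - \<mu>' A)) K"
proof -
  let ?D = "\<lambda>A. \<mu> A - \<mu>' A"
  note D = lebesgue_decompositionD[OF d] note D' = lebesgue_decompositionD[OF d']
  obtain \<omega> :: "real measure" and h g g' F where
    o: "radon_measure_on UNIV \<omega>" and h: "h \<in> borel_measurable borel" "\<forall>x. 0 \<le> h x"
    "lborel = density \<omega> (\<lambda>x. ennreal (h x))"
    and g: "represents UNIV s \<omega> g" "tot_var UNIV s = density \<omega> (\<lambda>x. ennreal \<bar>g x\<bar>)"
    "\<forall>\<phi>\<in>borel_measurable borel. pairing s \<phi> = (LINT x|\<omega>. g x * \<phi> x)"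
    and g': "represents UNIV s' \<omega> g'" "tot_var UNIV s' = density \<omega> (\<lambda>x. ennreal \<bar>g' x\<bar>)"
    "\<forall>\<phi>\<in>borel_measurable borel. pairing s' \<phi> = (LINT x|\<omega>. g' x * \<phi> x)"
    and F: "represents UNIV ?D \<omega> F"
    "tot_var UNIV ?D = density \<omega> (\<lambda>x. ennreal \<bar>F x\<bar>)"
    and e: "AE x in \<omega>. F x = h x * (r x - r' x) + (g x - g' x)"
    and ae: "AE x in \<omega>. \<bar>F x\<bar> = h x * \<bar>r x - r' x\<bar> + \<bar>g x - g' x\<bar>"
    by (rule compare_decompositions[OF d d'])
  have Kb: "K \<in> sets borel" by (rule borel_compact[OF K])
  have iF: "integrable \<omega> (\<lambda>x. indicator K x * \<bar>F x\<bar>)"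
    using representsD(3)[OF F(1) K] integrable_abs[of \<omega> "\<lambda>x. indicator K x * F x"]
    by (simp add: set_integrable_def abs_mult)
  have mF: "measure (tot_var UNIV ?D) K = (LINT x|\<omega>. indicator K x * \<bar>F x\<bar>)"
  proof -
    have "measure (tot_var UNIV ?D) K = (LINT x|tot_var UNIV ?D. indicator K x)"
      using Kb F(2) radon_sets[OF o] by simp
    also have "\<dots> = (LINT x|\<omega>. \<bar>F x\<bar> * indicator K x)"
      unfolding F(2) using integral_tot_var[OF o representsD(2)[OF F(1)], of "indicator K"] Kb by simp
    finally show ?thesis by (simp add: mult.commute)
  qed
  have "(LINT x:K|lborel. \<bar>r x - r' x\<bar>) = (LINT x|\<omega>. indicator K x * (h x * \<bar>r x - r' x\<bar>))"
    using set_integrable_density_iff(2)[OF radon_sets[OF o] h(1) _ h(2)[rule_format] Kb, of "\<lambda>x. \<bar>r x - r' x\<bar>"]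
      D(1) D'(1) h(3) by (simp add: set_lebesgue_integral_def)
  also have "\<dots> \<le> (LINT x|\<omega>. indicator K x * \<bar>F x\<bar>)"
    using ae by (intro integral_mono_AE' iF) (auto simp: indicator_def)
  finally show "(LINT x:K|lborel. \<bar>r x - r' x\<bar>) \<le> measure (tot_var UNIV ?D) K"
    by (simp add: mF)
  assume \<phi>: "\<phi> \<in> borel_measurable borel" "\<And>x. \<bar>\<phi> x\<bar> \<le> B" "\<And>x. x \<notin> K \<Longrightarrow> \<phi> x = 0"
  have B: "0 \<le> B" using \<phi>(2)[of 0] by linarith
  have i: "integrable \<omega> (\<lambda>x. \<bar>f x\<bar> * \<phi> x)" if "represents UNIV m \<omega> f" for m f
    using integrable_abs[OF integrable_mult_bounded_compact[OF that \<phi>(1,2) K \<phi>(3)]]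
      representsD(2)[OF that] \<phi>(1)
    by (subst integrable_abs_iff[symmetric]) (auto simp: abs_mult radon_borel_measurable[OF o])
  have "(LINT x|tot_var UNIV s. \<phi> x) - (LINT x|tot_var UNIV s'. \<phi> x)
      = (LINT x|\<omega>. \<bar>g x\<bar> * \<phi> x - \<bar>g' x\<bar> * \<phi> x)"
    unfolding g(2) g'(2) integral_tot_var[OF o representsD(2)[OF g(1)] \<phi>(1)]
      integral_tot_var[OF o representsD(2)[OF g'(1)] \<phi>(1)]
    by (rule Bochner_Integration.integral_diff[OF i[OF g(1)] i[OF g'(1)], symmetric])
  also have "\<bar>\<dots>\<bar> \<le> (LINT x|\<omega>. \<bar>\<bar>g x\<bar> * \<phi> x - \<bar>g' x\<bar> * \<phi> x\<bar>)"
    by (rule integral_abs_bound)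
  also have "\<dots> \<le> (LINT x|\<omega>. B * (indicator K x * \<bar>F x\<bar>))"
  proof (rule integral_mono_AE')
    show "integrable \<omega> (\<lambda>x. B * (indicator K x * \<bar>F x\<bar>))" using iF by simp
    show "AE x in \<omega>. \<bar>\<bar>g x\<bar> * \<phi> x - \<bar>g' x\<bar> * \<phi> x\<bar> \<le> B * (indicator K x * \<bar>F x\<bar>)"
      using ae
    proof eventually_elim
      case (elim x)
      have "0 \<le> h x * \<bar>r x - r' x\<bar>" using h(2) by simp
      then have "\<bar>\<bar>g x\<bar> - \<bar>g' x\<bar>\<bar> \<le> \<bar>F x\<bar>" using elim by linarith
      then have "\<bar>\<bar>g x\<bar> - \<bar>g' x\<bar>\<bar> * \<bar>\<phi> x\<bar> \<le> \<bar>F x\<bar> * B"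
        by (intro mult_mono \<phi>(2)) auto
      moreover have "\<bar>\<bar>g x\<bar> * \<phi> x - \<bar>g' x\<bar> * \<phi> x\<bar> = \<bar>\<bar>g x\<bar> - \<bar>g' x\<bar>\<bar> * \<bar>\<phi> x\<bar>"
        by (simp add: abs_mult[symmetric] left_diff_distrib)
      ultimately show ?case using \<phi>(3)[of x] by (cases "x \<in> K") (auto simp: mult.commute)
    qed
    show "AE x in \<omega>. 0 \<le> B * (indicator K x * \<bar>F x\<bar>)" using B by simp
  qed
  finally show "\<bar>(LINT x|tot_var UNIV s. \<phi> x) - (LINT x|tot_var UNIV s'. \<phi> x)\<bar>
     \<le> B * measure (tot_var UNIV ?D) K"
    by (simp add: mF)
qed

lemma tot_var_represents:
  fixes \<nu> :: "real measure"
  assumes r: "represents UNIV \<mu> \<nu> f"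
  shows "tot_var UNIV \<mu> = density \<nu> (\<lambda>x. ennreal \<bar>f x\<bar>)"
proof -
  note n = representsD[OF r]
  have sr: "signed_radon_on UNIV \<mu>" using r by (auto simp: signed_radon_on_def)
  obtain \<omega>' :: "real measure" where o': "radon_measure_on UNIV \<omega>'" 
    "\<And>\<rho>. \<rho> \<in> set [\<mu>] \<Longrightarrow> absolutely_continuous \<omega>' (fst (radon_rep UNIV \<rho>))"
    by (rule common_dominating_measure[of "[\<mu>]"]) (use sr in auto)
  obtain \<omega> where o: "radon_measure_on UNIV \<omega>" "absolutely_continuous \<omega> \<omega>'"
    "absolutely_continuous \<omega> \<nu>"
    by (rule radon_dominating[OF o'(1) n(1)])
  have ac: "absolutely_continuous \<omega> (fst (radon_rep UNIV \<mu>))"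
    using o(2) o'(2)[of \<mu>] by (auto simp: absolutely_continuous_def)
  obtain F where F: "represents UNIV \<mu> \<omega> F"
    "tot_var UNIV \<mu> = density \<omega> (\<lambda>x. ennreal \<bar>F x\<bar>)"
    "\<forall>\<phi>\<in>borel_measurable borel. pairing \<mu> \<phi> = (LINT x|\<omega>. F x * \<phi> x)"
    by (rule signed_radon_represents[OF sr o(1) ac])
  obtain G where G: "represents UNIV \<mu> \<omega> G"
    "density \<nu> (\<lambda>x. ennreal \<bar>f x\<bar>) = density \<omega> (\<lambda>x. ennreal \<bar>G x\<bar>)"
    "\<forall>\<phi>\<in>borel_measurable borel. (LINT x|\<nu>. f x * \<phi> x) = (LINT x|\<omega>. G x * \<phi> x)"
    by (rule represents_change[OF r o(1,3)])
  have "density \<omega> (\<lambda>x. ennreal \<bar>F x\<bar>) = density \<omega> (\<lambda>x. ennreal \<bar>G x\<bar>)"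
    using represents_unique[OF F(1) G(1) refl] representsD(2)[OF F(1)] representsD(2)[OF G(1)]
    by (intro density_cong) (auto simp: radon_borel_measurable[OF o(1)])
  then show ?thesis using F(2) G(2) by simp
qed

text \<open>
  If \<open>h\<close> is the density of Lebesgue measure over a dominating measure, then the singular part lives
  on the Lebesgue null set \<open>{h = 0}\<close>, and \<open>F / h\<close> is the regular density outside of it.
\<close>

lemma lebesgue_decomposition_exists:
  assumes sr: "signed_radon_on (UNIV :: real set) \<mu>"
  shows "\<exists>r s. lebesgue_decomposition \<mu> r s"
proof -
  obtain \<omega> :: "real measure" where o: "radon_measure_on UNIV \<omega>" "absolutely_continuous \<omega> lborel"
    "\<And>\<rho>. \<rho> \<in> set [\<mu>] \<Longrightarrow> absolutely_continuous \<omega> (fst (radon_rep UNIV \<rho>))"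
    by (rule common_dominating_measure[of "[\<mu>]"]) (use sr in auto)
  have ac: "absolutely_continuous \<omega> (fst (radon_rep UNIV \<mu>))"
    using o(3) by simp
  obtain h :: "real \<Rightarrow> real" where h: "h \<in> borel_measurable borel" "\<And>x. 0 \<le> h x"
    "lborel = density \<omega> (\<lambda>x. ennreal (h x))"
    using radon_density[OF radon_lborel o(1,2)] by metis
  obtain F where F: "represents UNIV \<mu> \<omega> F"
    "tot_var UNIV \<mu> = density \<omega> (\<lambda>x. ennreal \<bar>F x\<bar>)"
    "\<forall>\<phi>\<in>borel_measurable borel. pairing \<mu> \<phi> = (LINT x|\<omega>. F x * \<phi> x)"
    by (rule signed_radon_represents[OF sr o(1) ac])
  note f = representsD[OF F(1)] note so = radon_sets[OF o(1)]
  define N where "N = {x. h x = 0}"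
  have Nb[measurable]: "N \<in> sets borel" using h(1) unfolding N_def by measurable
  define r where "r x = (if x \<in> N then 0 else F x / h x)" for x
  have rb: "r \<in> borel_measurable borel" using h(1) f(2) unfolding r_def by measurable
  define g where "g x = F x * indicator N x" for x
  define s where "s K = (LINT x:K|\<omega>. g x)" for K
  have F_eq: "F x = h x * r x + g x" for x
    by (auto simp: r_def g_def N_def)
  have ig: "set_integrable \<omega> K g" if "compact K" for K
  proof -
    have "K \<inter> N \<in> sets \<omega>" unfolding so using Nb borel_compact[OF that] by (rule sets.Int[rotated])
    then have "set_integrable \<omega> (K \<inter> N) F"
      by (rule set_integrable_subset[OF f(3)[OF that]]) simp
    then show ?thesis
      by (simp add: set_integrable_def g_def indicator_inter_arith mult_ac)
  qed
  have gr: "represents UNIV s \<omega> g"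
    using ig f(2) by (intro representsI o(1)) (auto simp: s_def g_def[abs_def])
  have ihr: "set_integrable \<omega> K (\<lambda>x. h x * r x)" if "compact K" for K
  proof -
    have "(\<lambda>x. h x * r x) = (\<lambda>x. F x - g x)" by (rule ext) (use F_eq in \<open>metis add_diff_cancel_right'\<close>)
    then show ?thesis using set_integral_diff(1)[OF f(3)[OF that] ig[OF that]] by simp
  qed
  have ir: "set_integrable lborel K r"
    "(LINT x:K|lborel. r x) = (LINT x:K|\<omega>. h x * r x)" if "compact K" for K
    using ihr[OF that] set_integrable_density_iff[OF so h(1) rb h(2), of K] h(3) that
    by (auto simp: borel_compact)
  have "lebesgue_decomposition \<mu> r s"
    unfolding lebesgue_decomposition_def
  proof (intro conjI allI impI bexI[of _ N])
    show "r \<in> borel_measurable borel" by (rule rb)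
    show "signed_radon_on UNIV s" using gr by (auto simp: signed_radon_on_def)
    have [measurable]: "h \<in> borel_measurable \<omega>" "g \<in> borel_measurable \<omega>" "N \<in> sets \<omega>" "- N \<in> sets \<omega>"
      using h(1) representsD(2)[OF gr] Nb so by (auto simp: radon_borel_measurable[OF o(1)])
    show "N \<in> null_sets lborel"
      unfolding h(3) by (subst null_sets_density_iff) (use Nb so in \<open>auto simp: N_def\<close>)
    have "(\<integral>\<^sup>+ x. ennreal \<bar>g x\<bar> * indicator (- N) x \<partial>\<omega>) = (\<integral>\<^sup>+ x. 0 \<partial>\<omega>)"
      by (intro nn_integral_cong) (auto simp: g_def indicator_def)
    then show "emeasure (tot_var UNIV s) (- N) = 0"
      unfolding tot_var_represents[OF gr] by (subst emeasure_density) auto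
    fix K :: "real set" assume K: "compact K"
    show "set_integrable lborel K r" by (rule ir(1)[OF K])
    have "\<mu> K = (LINT x:K|\<omega>. h x * r x + g x)" using f(4)[OF K] F_eq by simp
    also have "\<dots> = (LINT x:K|\<omega>. h x * r x) + (LINT x:K|\<omega>. g x)"
      by (rule set_integral_add(2)[OF ihr[OF K] ig[OF K]])
    finally show "\<mu> K = (LINT x:K|lborel. r x) + s K"
      using ir(2)[OF K] by (simp add: s_def)
  qed
  then show ?thesis by blast
qed

text \<open>
  The comparison of the measure with itself: the difference is \<open>0\<close>, and there is no cancellation.
\<close>

lemma regular_part_unique:
  assumes d: "lebesgue_decomposition \<mu> r s" and d': "lebesgue_decomposition \<mu> r' s'"
  shows "AE x in lborel. r x = r' x"
proof -
  obtain \<omega> :: "real measure" and h g g' F where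
    o: "radon_measure_on UNIV \<omega>" and h: "h \<in> borel_measurable borel" "\<forall>x. 0 \<le> h x"
    "lborel = density \<omega> (\<lambda>x. ennreal (h x))"
    and g: "represents UNIV s \<omega> g" "tot_var UNIV s = density \<omega> (\<lambda>x. ennreal \<bar>g x\<bar>)"
    "\<forall>\<phi>\<in>borel_measurable borel. pairing s \<phi> = (LINT x|\<omega>. g x * \<phi> x)"
    and g': "represents UNIV s' \<omega> g'" "tot_var UNIV s' = density \<omega> (\<lambda>x. ennreal \<bar>g' x\<bar>)"
    "\<forall>\<phi>\<in>borel_measurable borel. pairing s' \<phi> = (LINT x|\<omega>. g' x * \<phi> x)"
    and F: "represents UNIV (\<lambda>A. \<mu> A - \<mu> A) \<omega> F"
    "tot_var UNIV (\<lambda>A. \<mu> A - \<mu> A) = density \<omega> (\<lambda>x. ennreal \<bar>F x\<bar>)"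
    and e: "AE x in \<omega>. F x = h x * (r x - r' x) + (g x - g' x)"
    and ae: "AE x in \<omega>. \<bar>F x\<bar> = h x * \<bar>r x - r' x\<bar> + \<bar>g x - g' x\<bar>"
    by (rule compare_decompositions[OF d d'])
  have "represents UNIV (\<lambda>A. \<mu> A - \<mu> A) \<omega> (\<lambda>x. 0)"
    by (intro representsI o) (auto simp: set_integrable_def set_lebesgue_integral_def)
  from represents_unique[OF F(1) this refl] ae
  have "AE x in \<omega>. 0 < ennreal (h x) \<longrightarrow> r x = r' x"
  proof eventually_elim
    case (elim x)
    then have "h x * \<bar>r x - r' x\<bar> = 0"
      using h(2)[rule_format, of x] mult_nonneg_nonneg[of "h x" "\<bar>r x - r' x\<bar>"] by linarith
    then show ?case by auto
  qed
  then show ?thesis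
    unfolding h(3) using h(1) by (subst AE_density) (auto simp: radon_borel_measurable[OF o])
qed

lemma lebesgue_decomposition_cong:
  assumes d: "lebesgue_decomposition \<mu> r s" and r': "r' \<in> borel_measurable borel"
    "AE x in lborel. r x = r' x"
  shows "lebesgue_decomposition \<mu> r' s"
proof -
  note D = lebesgue_decompositionD[OF d]
  have "set_integrable lborel K r' \<and> (LINT x:K|lborel. r' x) = (LINT x:K|lborel. r x)"
    if "compact K" for K
  proof
    have K: "K \<in> sets borel" using that by (rule borel_compact)
    show "(LINT x:K|lborel. r' x) = (LINT x:K|lborel. r x)"
      using r' D(1) K unfolding set_lebesgue_integral_def
      by (intro integral_cong_AE) auto
    have "set_integrable lborel K r' \<longleftrightarrow> set_integrable lborel K r"
      using r' D(1) K unfolding set_integrable_def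
      by (intro integrable_cong_AE) auto
    then show "set_integrable lborel K r'" using D(3)[OF that] by simp
  qed
  then show ?thesis using d r'(1) by (auto simp: lebesgue_decomposition_def)
qed

text \<open>
  \<open>sing_part\<close> and \<open>ac_density\<close> are chosen independently of each other, so it takes the uniqueness of the
  density to see that they belong to the same decomposition.
\<close>

lemma decomposition_parts:
  assumes "signed_radon_on (UNIV :: real set) \<mu>"
  shows "lebesgue_decomposition \<mu> (ac_density \<mu>) (sing_part \<mu>)"
proof -
  obtain r0 s0 where "lebesgue_decomposition \<mu> r0 s0"
    using lebesgue_decomposition_exists[OF assms] by blast
  then have ex: "\<exists>s r. lebesgue_decomposition \<mu> r s" "\<exists>r. is_ac_density \<mu> r"
    by (auto simp: is_ac_density_def)
  from someI_ex[OF ex(1)] obtain r where r: "lebesgue_decomposition \<mu> r (sing_part \<mu>)"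
    unfolding sing_part_def by blast
  from someI_ex[OF ex(2)] obtain s where s: "lebesgue_decomposition \<mu> (ac_density \<mu>) s"
    unfolding ac_density_def is_ac_density_def by blast
  show ?thesis
    using lebesgue_decomposition_cong[OF r lebesgue_decompositionD(1)[OF s] regular_part_unique[OF r s]] .
qed

lemma decomposition_ac_density:
  assumes sr: "signed_radon_on (UNIV :: real set) \<mu>" and r: "is_ac_density \<mu> r"
  shows "lebesgue_decomposition \<mu> r (sing_part \<mu>)"
proof -
  obtain s where s: "lebesgue_decomposition \<mu> r s" using r by (auto simp: is_ac_density_def)
  show ?thesis
    by (rule lebesgue_decomposition_cong[OF decomposition_parts[OF sr] lebesgue_decompositionD(1)[OF s]
          regular_part_unique[OF decomposition_parts[OF sr] s]])
qed

lemma pairing_decomposition: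
  assumes d: "lebesgue_decomposition \<mu> r s"
    and \<phi>: "\<phi> \<in> borel_measurable borel" "\<And>x. \<bar>\<phi> x\<bar> \<le> B" "compact K" "\<And>x. x \<notin> K \<Longrightarrow> \<phi> x = 0"
  shows "pairing \<mu> \<phi> = (LINT x|lborel. r x * \<phi> x) + pairing s \<phi>"
proof -
  note sr = decomposition_signed_radon[OF d] note D = lebesgue_decompositionD[OF d]
  obtain \<omega> :: "real measure" where o: "radon_measure_on UNIV \<omega>" "absolutely_continuous \<omega> lborel"
    "\<And>\<rho>. \<rho> \<in> set [\<mu>, s] \<Longrightarrow> absolutely_continuous \<omega> (fst (radon_rep UNIV \<rho>))"
    by (rule common_dominating_measure[of "[\<mu>, s]"]) (use sr D(2) in auto)
  have ac: "absolutely_continuous \<omega> (fst (radon_rep UNIV \<mu>))"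
    "absolutely_continuous \<omega> (fst (radon_rep UNIV s))"
    using o(3) by auto
  obtain h :: "real \<Rightarrow> real" where h: "h \<in> borel_measurable borel" "\<And>x. 0 \<le> h x"
    "lborel = density \<omega> (\<lambda>x. ennreal (h x))"
    using radon_density[OF radon_lborel o(1,2)] by metis
  obtain F where F: "represents UNIV \<mu> \<omega> F"
    "tot_var UNIV \<mu> = density \<omega> (\<lambda>x. ennreal \<bar>F x\<bar>)"
    "\<forall>\<phi>\<in>borel_measurable borel. pairing \<mu> \<phi> = (LINT x|\<omega>. F x * \<phi> x)"
    by (rule signed_radon_represents[OF sr o(1) ac(1)])
  obtain g where g: "represents UNIV s \<omega> g"
    "tot_var UNIV s = density \<omega> (\<lambda>x. ennreal \<bar>g x\<bar>)"
    "\<forall>\<phi>\<in>borel_measurable borel. pairing s \<phi> = (LINT x|\<omega>. g x * \<phi> x)"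
    by (rule signed_radon_represents[OF D(2) o(1) ac(2)])
  note R = decomposition_on_dominating(1)[OF d o(1) h g(1,2)]
  have e: "AE x in \<omega>. F x = h x * r x + g x"
    by (rule represents_unique[OF F(1) R refl])
  note meas = representsD(2)[OF F(1)] representsD(2)[OF g(1)] h(1) D(1) \<phi>(1)
  have ig: "integrable \<omega> (\<lambda>x. g x * \<phi> x)"
    by (rule integrable_mult_bounded_compact[OF g(1) \<phi>])
  have "integrable \<omega> (\<lambda>x. (h x * r x + g x) * \<phi> x)"
    by (rule integrable_mult_bounded_compact[OF R \<phi>])
  from Bochner_Integration.integrable_diff[OF this ig]
  have ih: "integrable \<omega> (\<lambda>x. h x * (r x * \<phi> x))" by (simp add: algebra_simps)
  have "pairing \<mu> \<phi> = (LINT x|\<omega>. F x * \<phi> x)" using F(3) \<phi>(1) by simp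
  also have "\<dots> = (LINT x|\<omega>. h x * (r x * \<phi> x) + g x * \<phi> x)"
    using e meas by (intro integral_cong_AE) (auto simp: radon_borel_measurable[OF o(1)] algebra_simps)
  also have "\<dots> = (LINT x|\<omega>. h x * (r x * \<phi> x)) + (LINT x|\<omega>. g x * \<phi> x)"
    by (rule Bochner_Integration.integral_add[OF ih ig])
  also have "(LINT x|\<omega>. h x * (r x * \<phi> x)) = (LINT x|lborel. r x * \<phi> x)"
    unfolding h(3) using meas h(2)
    by (subst integral_density) (auto simp: radon_borel_measurable[OF o(1)])
  finally show ?thesis using g(3) \<phi>(1) by simp
qed

text \<open>
  The function \<open>\<psi>\<close> may be arbitrary, because a nonintegrable integrand has integral \<open>0\<close>.
\<close>

lemma abs_pairing_le:
  assumes sr: "signed_radon_on (UNIV :: real set) s"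
    and \<phi>: "\<phi> \<in> borel_measurable borel" "\<And>x. \<bar>\<phi> x\<bar> \<le> B" "compact K" "\<And>x. x \<notin> K \<Longrightarrow> \<phi> x = 0"
    and le: "\<And>x. \<bar>\<psi> x\<bar> \<le> \<phi> x"
  shows "\<bar>pairing s \<psi>\<bar> \<le> (LINT x|tot_var UNIV s. \<phi> x)"
proof -
  obtain \<nu> f where r: "radon_rep UNIV s = (\<nu>, f)" by fastforce
  note R = radon_rep_represents[OF sr r]
  note n = representsD[OF R]
  have nn: "0 \<le> \<phi> x" for x by (rule order_trans[OF abs_ge_zero le])
  have i: "integrable \<nu> (\<lambda>x. \<bar>f x\<bar> * \<phi> x)"
    using integrable_abs[OF integrable_mult_bounded_compact[OF R \<phi>]]
    by (simp add: abs_mult abs_of_nonneg[OF nn])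
  have "\<bar>pairing s \<psi>\<bar> \<le> (LINT x|\<nu>. \<bar>f x * \<psi> x\<bar>)"
    unfolding pairing_def r by simp
  also have "\<dots> \<le> (LINT x|\<nu>. \<bar>f x\<bar> * \<phi> x)"
    using le nn by (intro integral_mono' i) (auto simp: abs_mult intro!: mult_left_mono)
  also have "\<dots> = (LINT x|tot_var UNIV s. \<phi> x)"
    unfolding tot_var_eq[OF r] by (rule integral_tot_var[OF n(1,2) \<phi>(1), symmetric])
  finally show ?thesis .
qed

text \<open>
  The atoms have the density \<open>f\<close> with respect to the image of the counting measure under \<open>x\<close>.
\<close>

lemma tot_var_atoms:
  fixes x c :: "nat \<Rightarrow> real"
  assumes inj: "inj_on x {1..p}"
    and s: "\<And>K. compact K \<Longrightarrow> s K = (\<Sum>i=1..p. c i * indicator K (x i))"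
    and \<phi>: "\<phi> \<in> borel_measurable borel"
  shows "(LINT y|tot_var UNIV s. \<phi> y) = (\<Sum>i=1..p. \<bar>c i\<bar> * \<phi> (x i))"
proof -
  define \<nu> where "\<nu> = distr (count_space {1..p}) borel x"
  define f where "f y = (\<Sum>i=1..p. c i * indicator {x i} y)" for y
  have fx: "f (x i) = c i" if "i \<in> {1..p}" for i
  proof -
    have "f (x i) = (\<Sum>k=1..p. if k = i then c k else 0)"
      unfolding f_def by (intro sum.cong refl) (simp add: indicator_def inj_on_eq_iff[OF inj that])
    then show ?thesis using that by simp
  qed
  have fb: "f \<in> borel_measurable borel" unfolding f_def by measurable
  have int: "integrable \<nu> k" "(LINT y|\<nu>. k y) = (\<Sum>i=1..p. k (x i))"
    if "k \<in> borel_measurable borel" for k :: "real \<Rightarrow> real"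
  proof -
    have x: "x \<in> measurable (count_space {1..p}) borel" by simp
    show "integrable \<nu> k"
      unfolding \<nu>_def integrable_distr_eq[OF x that] by (rule integrable_count_space) simp
    show "(LINT y|\<nu>. k y) = (\<Sum>i=1..p. k (x i))"
      unfolding \<nu>_def integral_distr[OF x that] by (rule lebesgue_integral_count_space_finite) simp
  qed
  have "emeasure \<nu> K < \<infinity>" if "compact K" for K
  proof -
    have "emeasure \<nu> K = emeasure (count_space {1..p}) (x -` K \<inter> {1..p})"
      unfolding \<nu>_def using borel_compact[OF that] by (subst emeasure_distr) auto
    also have "\<dots> < \<infinity>"
      by (subst emeasure_count_space_finite) (auto simp: of_nat_less_top)
    finally show ?thesis .
  qed
  then have rad: "radon_measure_on UNIV \<nu>"
    by (auto simp: radon_measure_on_def sets_restrict_space \<nu>_def)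
  have "represents UNIV s \<nu> f"
  proof (rule representsI[OF rad fb])
    fix K :: "real set" assume K: "compact K"
    have kb: "(\<lambda>y. indicator K y * f y) \<in> borel_measurable borel"
      using fb borel_compact[OF K] by measurable
    show "set_integrable \<nu> K f" using int(1)[OF kb] by (simp add: set_integrable_def)
    show "s K = (LINT y:K|\<nu>. f y)"
      using int(2)[OF kb] s[OF K] fx by (simp add: set_lebesgue_integral_def mult.commute)
  qed
  note tot_var_represents[OF this]
  then have "(LINT y|tot_var UNIV s. \<phi> y) = (LINT y|\<nu>. \<bar>f y\<bar> * \<phi> y)"
    using integral_tot_var[OF rad fb \<phi>] by simp
  also have "\<dots> = (\<Sum>i=1..p. \<bar>f (x i)\<bar> * \<phi> (x i))"
    using fb \<phi> by (subst int(2)) auto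
  finally show ?thesis using fx by simp
qed

section \<open>Cutoff functions\<close>

lemma DERIV_max0_power:
  "((\<lambda>y::real. max 0 y ^ Suc (Suc m)) has_real_derivative real (Suc (Suc m)) * max 0 y ^ Suc m) (at y)"
proof -
  consider "y > 0" | "y < 0" | "y = 0" by linarith
  then show ?thesis
  proof cases
    case 1
    have "((\<lambda>y::real. y ^ Suc (Suc m)) has_real_derivative real (Suc (Suc m)) * y ^ Suc m) (at y)"
      using DERIV_pow[of "Suc (Suc m)" y] by simp
    then have "((\<lambda>y::real. max 0 y ^ Suc (Suc m)) has_real_derivative real (Suc (Suc m)) * y ^ Suc m) (at y)"
      by (rule has_field_derivative_transform_within_open[where S = "{0<..}"]) (use 1 in auto)
    then show ?thesis using 1 by (simp add: max_def)
  next
    case 2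
    have "((\<lambda>y::real. 0) has_real_derivative 0) (at y)" by simp
    then have "((\<lambda>y::real. max 0 y ^ Suc (Suc m)) has_real_derivative 0) (at y)"
      by (rule has_field_derivative_transform_within_open[where S = "{..<0}"]) (use 2 in auto)
    then show ?thesis using 2 by (simp add: max_def)
  next
    case 3
    have "((\<lambda>h::real. \<bar>h\<bar> ^ Suc m) \<longlongrightarrow> \<bar>0\<bar> ^ Suc m) (at 0)" by (intro tendsto_intros)
    then have z: "((\<lambda>h::real. \<bar>h\<bar> ^ Suc m) \<longlongrightarrow> 0) (at 0)" by simp
    have "((\<lambda>h::real. max 0 h ^ Suc (Suc m) / h) \<longlongrightarrow> 0) (at 0)"
    proof (rule Lim_null_comparison[OF _ z])
      have "norm (max 0 h ^ Suc (Suc m) / h) \<le> \<bar>h\<bar> ^ Suc m" if "h \<noteq> 0" for h :: real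
      proof (cases "h > 0")
        case False
        then have "max 0 h = 0" by simp
        then show ?thesis by (simp del: power_Suc add: zero_le_power)
      qed (simp add: max_def abs_mult)
      then show "\<forall>\<^sub>F h::real in at 0. norm (max 0 h ^ Suc (Suc m) / h) \<le> \<bar>h\<bar> ^ Suc m"
        by (auto simp: eventually_at_filter)
    qed
    then show ?thesis using 3 by (simp add: DERIV_def)
  qed
qed

text \<open>
  A \<open>C\<^sup>1\<close> replacement of the Heaviside function, increasing from \<open>0\<close> on \<open>(-\<infinity>, 0]\<close> to \<open>1\<close> on \<open>[1, \<infinity>)\<close>.
  Truncated powers keep all formulas global, without case distinctions.
\<close>

definition step :: "real \<Rightarrow> real" where
  "step y = 1 - max 0 (1 - max 0 y ^ 2) ^ 2"

definition step_deriv :: "real \<Rightarrow> real" where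
  "step_deriv y = 4 * max 0 (1 - max 0 y ^ 2) * max 0 y"

lemma DERIV_step: "(step has_real_derivative step_deriv y) (at y)"
proof -
  have p: "((\<lambda>y::real. max 0 y ^ 2) has_real_derivative 2 * max 0 y) (at y)" for y
    using DERIV_max0_power[of 0 y] by (simp add: numeral_2_eq_2)
  have "((\<lambda>y. 1 - max 0 (1 - max 0 y ^ 2) ^ 2) has_real_derivative
      0 - 2 * max 0 (1 - max 0 y ^ 2) * (0 - 2 * max 0 y)) (at y)"
    by (intro DERIV_diff DERIV_const DERIV_chain'[OF _ p] p)
  then show ?thesis unfolding step_def[abs_def] by (simp add: step_deriv_def mult_ac)
qed

lemma DERIV_step_chain [derivative_intros]:
  "(g has_real_derivative d) (at x) \<Longrightarrow>
   ((\<lambda>x. step (g x)) has_real_derivative step_deriv (g x) * d) (at x)"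
  by (rule DERIV_chain2[OF DERIV_step])

lemma continuous_step [continuous_intros]:
  "continuous_on A f \<Longrightarrow> continuous_on A (\<lambda>x. step (f x))"
  "continuous_on A f \<Longrightarrow> continuous_on A (\<lambda>x. step_deriv (f x))"
  unfolding step_def step_deriv_def by (auto intro!: continuous_intros)

lemma step_measurable [measurable]:
  "step \<in> borel_measurable borel" "step_deriv \<in> borel_measurable borel"
  by (auto intro!: borel_measurable_continuous_onI continuous_intros)

lemma step_bounds: "0 \<le> step y" "step y \<le> 1"
proof -
  have "max 0 (1 - max 0 y ^ 2) ^ 2 \<le> 1" by (intro power_le_one) auto
  then show "0 \<le> step y" "step y \<le> 1" by (auto simp: step_def)
qed

lemma step_eq_0: "y \<le> 0 \<Longrightarrow> step y = 0"
  by (simp add: step_def max_def)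

lemma max_square_eq_0:
  fixes y :: real
  assumes "1 \<le> y" shows "max 0 (1 - max 0 y ^ 2) = 0"
proof -
  have "1 \<le> y ^ 2" using assms by (rule one_le_power)
  moreover have "max 0 y = y" using assms by simp
  ultimately show ?thesis by simp
qed

lemma step_eq_1: "1 \<le> y \<Longrightarrow> step y = 1"
  by (simp add: step_def max_square_eq_0)

lemma step_deriv_nonneg: "0 \<le> step_deriv y"
  by (simp add: step_deriv_def)

lemma step_deriv_eq_0: "y \<le> 0 \<or> 1 \<le> y \<Longrightarrow> step_deriv y = 0"
  by (auto simp: step_deriv_def max_square_eq_0 max_absorb1)

text \<open>An approximate identity concentrated on \<open>(0, \<epsilon>)\<close>.\<close>

definition kern :: "real \<Rightarrow> real \<Rightarrow> real" where
  "kern \<epsilon> y = step_deriv (y / \<epsilon>) / \<epsilon>"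

lemma kern_measurable [measurable]: "kern \<epsilon> \<in> borel_measurable borel"
  unfolding kern_def[abs_def] by measurable

lemma continuous_kern [continuous_intros]:
  "\<epsilon> \<noteq> 0 \<Longrightarrow> continuous_on A f \<Longrightarrow> continuous_on A (\<lambda>x. kern \<epsilon> (f x))"
  unfolding kern_def by (intro continuous_intros) auto

lemma kern_nonneg: "0 < \<epsilon> \<Longrightarrow> 0 \<le> kern \<epsilon> y"
  by (simp add: kern_def step_deriv_nonneg)

lemma kern_eq_0: "0 < \<epsilon> \<Longrightarrow> y \<le> 0 \<or> \<epsilon> \<le> y \<Longrightarrow> kern \<epsilon> y = 0"
  by (auto simp: kern_def step_deriv_eq_0 divide_nonpos_pos)

lemma has_bochner_integral_kern:
  assumes "0 < \<epsilon>"
  shows "has_bochner_integral lborel (kern \<epsilon>) 1"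
proof -
  have "has_bochner_integral lborel (\<lambda>y. kern \<epsilon> y * indicator {0..\<epsilon>} y) (step (\<epsilon> / \<epsilon>) - step (0 / \<epsilon>))"
  proof (rule has_bochner_integral_FTC_Icc_real)
    show "0 \<le> \<epsilon>" using assms by simp
    show "((\<lambda>y. step (y / \<epsilon>)) has_real_derivative kern \<epsilon> y) (at y)" for y
      using assms by (auto intro!: derivative_eq_intros simp: kern_def)
    show "isCont (kern \<epsilon>) y" for y
      using continuous_kern[of \<epsilon> UNIV "\<lambda>x. x"] assms by (simp add: continuous_on_eq_continuous_at)
  qed
  moreover have "(\<lambda>y. kern \<epsilon> y * indicator {0..\<epsilon>} y) = kern \<epsilon>"
  proof
    fix y show "kern \<epsilon> y * indicator {0..\<epsilon>} y = kern \<epsilon> y"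
      using kern_eq_0[OF assms, of y] by (cases "y \<in> {0..\<epsilon>}") auto
  qed
  ultimately show ?thesis using assms by (simp add: step_eq_0 step_eq_1)
qed

lemma integral_kern:
  assumes "0 < \<epsilon>"
  shows "integrable lborel (kern \<epsilon>)" "(LINT y|lborel. kern \<epsilon> y) = 1"
  using has_bochner_integral_kern[OF assms] by (auto simp: has_bochner_integral_iff)

text \<open>A bump which equals \<open>1\<close> at \<open>a\<close> and is supported in \<open>[a - \<epsilon>, a + \<epsilon>]\<close>.\<close>

definition bump :: "real \<Rightarrow> real \<Rightarrow> real \<Rightarrow> real" where
  "bump a \<epsilon> x = 1 - step ((x - a) / \<epsilon>) - step ((a - x) / \<epsilon>)"

lemma bump_measurable [measurable]: "bump a \<epsilon> \<in> borel_measurable borel"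
  unfolding bump_def[abs_def] by measurable

lemma bump_bounds:
  assumes "0 < \<epsilon>" shows "0 \<le> bump a \<epsilon> x" "bump a \<epsilon> x \<le> 1"
  using step_bounds[of "(x - a) / \<epsilon>"] step_bounds[of "(a - x) / \<epsilon>"]
    step_eq_0[of "(x - a) / \<epsilon>"] step_eq_0[of "(a - x) / \<epsilon>"] assms
  by (cases "x \<le> a"; force simp: bump_def divide_nonpos_pos)+

lemma bump_eq_0:
  assumes "0 < \<epsilon>" "\<epsilon> \<le> \<bar>x - a\<bar>" shows "bump a \<epsilon> x = 0"
  using assms by (cases "x \<le> a") (auto simp: bump_def step_eq_0 step_eq_1 divide_nonpos_pos)

lemma DERIV_bump:
  "0 < \<epsilon> \<Longrightarrow> (bump a \<epsilon> has_real_derivative kern \<epsilon> (a - x) - kern \<epsilon> (x - a)) (at x)"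
  unfolding bump_def[abs_def] kern_def by (auto intro!: derivative_eq_intros simp: field_simps)

text \<open>A \<open>C\<^sup>2\<close> weight decreasing from \<open>1\<close> at \<open>0\<close> to \<open>0\<close> at \<open>X\<close>.\<close>

definition weight :: "real \<Rightarrow> real \<Rightarrow> real" where
  "weight X y = max 0 (1 - y / X) ^ 3"

definition weight_deriv :: "real \<Rightarrow> real \<Rightarrow> real" where
  "weight_deriv X y = - 3 / X * max 0 (1 - y / X) ^ 2"

definition weight_deriv2 :: "real \<Rightarrow> real \<Rightarrow> real" where
  "weight_deriv2 X y = 6 / X\<^sup>2 * max 0 (1 - y / X)"

lemma DERIV_weight:
  assumes "X \<noteq> 0"
  shows "(weight X has_real_derivative weight_deriv X y) (at y)"
    and "(weight_deriv X has_real_derivative weight_deriv2 X y) (at y)"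
proof -
  have p2: "((\<lambda>y::real. max 0 y ^ 2) has_real_derivative 2 * max 0 y) (at y)" for y
    using DERIV_max0_power[of 0 y] by (simp add: numeral_2_eq_2)
  have p3: "((\<lambda>y::real. max 0 y ^ 3) has_real_derivative 3 * max 0 y ^ 2) (at y)" for y
    using DERIV_max0_power[of 1 y] by (simp add: numeral_3_eq_3 numeral_2_eq_2)
  have l: "((\<lambda>y. 1 - y / X) has_real_derivative - 1 / X) (at y)"
    using assms by (auto intro!: derivative_eq_intros)
  show "(weight X has_real_derivative weight_deriv X y) (at y)"
    unfolding weight_def[abs_def] weight_deriv_def using DERIV_chain2[OF p3 l] by (simp add: mult_ac)
  show "(weight_deriv X has_real_derivative weight_deriv2 X y) (at y)"
    unfolding weight_deriv_def[abs_def] weight_deriv2_def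
    using DERIV_cmult[OF DERIV_chain2[OF p2 l], of "- 3 / X"]
    by (simp add: mult_ac power2_eq_square)
qed

lemma continuous_weight [continuous_intros]:
  "continuous_on A f \<Longrightarrow> continuous_on A (\<lambda>x. weight X (f x))"
  "continuous_on A f \<Longrightarrow> continuous_on A (\<lambda>x. weight_deriv X (f x))"
  "continuous_on A f \<Longrightarrow> continuous_on A (\<lambda>x. weight_deriv2 X (f x))"
  unfolding weight_def weight_deriv_def weight_deriv2_def divide_inverse
  by (auto intro!: continuous_intros)

lemma weight_measurable [measurable]:
  "weight X \<in> borel_measurable borel" "weight_deriv X \<in> borel_measurable borel"
  by (auto intro!: borel_measurable_continuous_onI continuous_intros)

lemma weight_nonneg: "0 \<le> weight X y"
  by (simp add: weight_def)

lemma weight_deriv_nonpos: "0 < X \<Longrightarrow> weight_deriv X y \<le> 0"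
  by (simp add: weight_deriv_def)

lemma weight_le_1: "0 < X \<Longrightarrow> 0 \<le> y \<Longrightarrow> weight X y \<le> 1"
  unfolding weight_def by (intro power_le_one) auto

lemma weight_eq_0:
  assumes "0 < X" "X \<le> y"
  shows "weight X y = 0" "weight_deriv X y = 0" "weight_deriv2 X y = 0"
  using assms by (auto simp: weight_def weight_deriv_def weight_deriv2_def max_def)

text \<open>
  Near \<open>y = 0\<close>, where \<open>kern\<close> concentrates, the travelling weight may be replaced by its value at the
  origin, which depends on time only.
\<close>

lemma weight_lipschitz:
  assumes "0 < X" "0 \<le> y" "0 \<le> z"
  shows "\<bar>weight X (y + z) - weight X z\<bar> \<le> 3 / X * y"
proof (cases "y = 0")
  case False
  then have "z < y + z" using assms by simp
  then obtain \<xi> where \<xi>: "z < \<xi>" "\<xi> < y + z"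
    "weight X (y + z) - weight X z = (y + z - z) * weight_deriv X \<xi>"
    using MVT2[of z "y + z" "weight X" "weight_deriv X"] DERIV_weight(1)[of X] assms by auto
  have "max 0 (1 - \<xi> / X) ^ 2 \<le> 1" using assms \<xi> by (intro power_le_one) auto
  then have "\<bar>weight_deriv X \<xi>\<bar> \<le> 3 / X"
    using assms by (auto simp: weight_deriv_def abs_mult field_simps)
  from mult_left_mono[OF this assms(2)] show ?thesis
    using \<xi> assms by (simp add: abs_mult mult.commute)
qed simp

lemma integral_weight:
  assumes "0 < X" "0 < s"
  shows "has_bochner_integral lborel (\<lambda>t. weight X (s * t) * indicator {0..X / s} t) (X / (4 * s))"
proof -
  let ?F = "\<lambda>t. - (X / (4 * s)) * (1 - s * t / X) ^ 4"
  have "has_bochner_integral lborel (\<lambda>t. (1 - s * t / X) ^ 3 * indicator {0..X / s} t)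
      (?F (X / s) - ?F 0)"
  proof (rule has_bochner_integral_FTC_Icc_real)
    show "0 \<le> X / s" using assms by simp
    have l: "((\<lambda>t. 1 - s * t / X) has_real_derivative - (s / X)) (at t)" for t
      using assms by (auto intro!: derivative_eq_intros)
    show "(?F has_real_derivative (1 - s * t / X) ^ 3) (at t)" for t
      using DERIV_cmult[OF DERIV_power[OF l[of t], where n = 4], of "- (X / (4 * s))"] assms by simp
    show "isCont (\<lambda>t. (1 - s * t / X) ^ 3) t" for t
      using assms by (intro continuous_intros) auto
  qed
  moreover have "(1 - s * t / X) ^ 3 * indicator {0..X / s} t = weight X (s * t) * indicator {0..X / s} t" for t
    using assms by (auto simp: weight_def indicator_def max_def field_simps)
  ultimately show ?thesis using assms by simp
qed

section \<open>Test functions\<close>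

text \<open>
  Stronger than \<open>C1_C1c\<close>: the partial derivatives exist and are continuous on the whole plane, so that
  the fundamental theorem of calculus and Fubini's theorem apply, and uniformity in \<open>x\<close> follows from
  the compact support. Test functions vanish at the final time.
\<close>

definition smooth_test ::
  "real \<Rightarrow> (real \<Rightarrow> real \<Rightarrow> real) \<Rightarrow> (real \<Rightarrow> real \<Rightarrow> real) \<Rightarrow> (real \<Rightarrow> real \<Rightarrow> real) \<Rightarrow> bool" where
  "smooth_test T Z Zt Zx \<longleftrightarrow> (\<forall>x. Z T x = 0) \<and>
     (\<exists>K Ztx. compact K \<and>
       (\<forall>t\<in>{0..T}. \<forall>x. x \<notin> K \<longrightarrow> Z t x = 0 \<and> Zt t x = 0 \<and> Zx t x = 0 \<and> Ztx t x = 0) \<and>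
       (\<forall>t x. (Z t has_real_derivative Zx t x) (at x)) \<and>
       (\<forall>t x. (Zt t has_real_derivative Ztx t x) (at x)) \<and>
       (\<forall>t x. ((\<lambda>t. Z t x) has_real_derivative Zt t x) (at t)) \<and>
       (\<forall>t x. ((\<lambda>t. Zx t x) has_real_derivative Ztx t x) (at t)) \<and>
       continuous_on UNIV (\<lambda>(t, x). Z t x) \<and> continuous_on UNIV (\<lambda>(t, x). Zt t x) \<and>
       continuous_on UNIV (\<lambda>(t, x). Zx t x) \<and> continuous_on UNIV (\<lambda>(t, x). Ztx t x))"

lemma C0_curveI:
  assumes c: "continuous_on UNIV (\<lambda>(t, x). g t x)" and K: "compact K"
    and z: "\<And>t x. t \<in> {0..T} \<Longrightarrow> x \<notin> K \<Longrightarrow> g t x = 0"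
  shows "C0_curve T g"
    and "\<And>e. 0 < e \<Longrightarrow> \<exists>d>0. \<forall>s\<in>{0..T}. \<forall>t\<in>{0..T}. \<forall>x. \<bar>s - t\<bar> < d \<longrightarrow> \<bar>g s x - g t x\<bar> < e"
proof -
  have u: "uniformly_continuous_on ({0..T} \<times> K) (\<lambda>(t, x). g t x)"
    by (intro compact_uniformly_continuous continuous_on_subset[OF c] compact_Times K) auto
  show *: "\<exists>d>0. \<forall>s\<in>{0..T}. \<forall>t\<in>{0..T}. \<forall>x. \<bar>s - t\<bar> < d \<longrightarrow> \<bar>g s x - g t x\<bar> < e" if e: "0 < e" for e
  proof -
    obtain d where d: "d > 0" "\<And>p q. p \<in> {0..T} \<times> K \<Longrightarrow> q \<in> {0..T} \<times> K \<Longrightarrow> dist p q < d \<Longrightarrow>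
        dist ((\<lambda>(t, x). g t x) p) ((\<lambda>(t, x). g t x) q) < e"
      using u e unfolding uniformly_continuous_on_def by (metis dist_commute)
    have "\<bar>g s x - g t x\<bar> < e" if "s \<in> {0..T}" "t \<in> {0..T}" "\<bar>s - t\<bar> < d" for s t x
      using d(2)[of "(s, x)" "(t, x)"] that z e
      by (cases "x \<in> K") (auto simp: dist_Pair_Pair dist_real_def)
    then show ?thesis using d(1) by blast
  qed
  show "C0_curve T g"
    unfolding C0_curve_def
  proof (intro ballI uniform_limitI)
    fix t e :: real assume t: "t \<in> {0..T}" and e: "0 < e"
    obtain d where d: "d > 0" "\<forall>s\<in>{0..T}. \<forall>t\<in>{0..T}. \<forall>x. \<bar>s - t\<bar> < d \<longrightarrow> \<bar>g s x - g t x\<bar> < e"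
      using *[OF e] by blast
    then show "\<forall>\<^sub>F s in at t within {0..T}. \<forall>x\<in>UNIV. dist (g s x) (g t x) < e"
      unfolding eventually_at using t by (intro exI[of _ d]) (auto simp: dist_real_def)
  qed
qed

text \<open>
  By the mean value theorem a difference quotient is a value of \<open>g'\<close> at an intermediate time, and
  \<open>g'\<close> is uniformly continuous in time because of its compact support.
\<close>

lemma C1_curveI:
  assumes d: "\<And>t x. ((\<lambda>t. g t x) has_real_derivative g' t x) (at t)"
    and c: "continuous_on UNIV (\<lambda>(t, x). g' t x)" and K: "compact K"
    and z: "\<And>t x. t \<in> {0..T} \<Longrightarrow> x \<notin> K \<Longrightarrow> g' t x = 0"
  shows "C1_curve T g g'"
  unfolding C1_curve_def
proof (intro conjI ballI uniform_limitI)
  show "C0_curve T g'" by (rule C0_curveI(1)[OF c K z])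
  fix t e :: real assume t: "t \<in> {0..T}" and e: "0 < e"
  obtain \<delta> where \<delta>: "\<delta> > 0" "\<forall>s\<in>{0..T}. \<forall>t\<in>{0..T}. \<forall>x. \<bar>s - t\<bar> < \<delta> \<longrightarrow> \<bar>g' s x - g' t x\<bar> < e"
    using C0_curveI(2)[OF c K z e] by blast
  have q: "\<bar>(g s x - g t x) / (s - t) - g' t x\<bar> < e" if s: "s \<in> {0..T}" "s \<noteq> t" "\<bar>s - t\<bar> < \<delta>" for s x
  proof -
    have "\<exists>r. r \<in> {0..T} \<and> \<bar>r - t\<bar> < \<delta> \<and> (g s x - g t x) / (s - t) = g' r x"
    proof (cases "s < t")
      case True
      obtain r where "s < r" "r < t" "g t x - g s x = (t - s) * g' r x"
        using MVT2[OF True, of "\<lambda>t. g t x" "\<lambda>t. g' t x"] d by blast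
      then show ?thesis using s t True by (intro exI[of _ r]) (auto simp: field_simps)
    next
      case False
      then have "t < s" using s by simp
      then obtain r where "t < r" "r < s" "g s x - g t x = (s - t) * g' r x"
        using MVT2[of t s "\<lambda>t. g t x" "\<lambda>t. g' t x"] d by blast
      then show ?thesis using s t by (intro exI[of _ r]) (auto simp: field_simps)
    qed
    then show ?thesis using \<delta>(2) t by auto
  qed
  show "\<forall>\<^sub>F s in at t within {0..T}. \<forall>x\<in>UNIV. dist ((g s x - g t x) / (s - t)) (g' t x) < e"
    unfolding eventually_at using q \<delta>(1) by (intro exI[of _ \<delta>]) (auto simp: dist_real_def)
qed

lemma continuous_slice:
  "continuous_on UNIV (\<lambda>(t, x). g t x) \<Longrightarrow> continuous_on UNIV (g t)"
  using continuous_on_compose2[of UNIV "\<lambda>(t, x). g t x" UNIV "\<lambda>x. (t, x)"]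
  by (simp add: continuous_on_Pair continuous_on_const continuous_on_id)

lemma smooth_test_C1_C1c:
  assumes "smooth_test T Z Zt Zx"
  shows "C1_C1c T Z Zt Zx"
proof -
  obtain K Ztx where K: "compact K"
    and z: "\<And>t x. t \<in> {0..T} \<Longrightarrow> x \<notin> K \<Longrightarrow> Z t x = 0 \<and> Zt t x = 0 \<and> Zx t x = 0 \<and> Ztx t x = 0"
    and d: "\<And>t x. (Z t has_real_derivative Zx t x) (at x)"
       "\<And>t x. (Zt t has_real_derivative Ztx t x) (at x)"
       "\<And>t x. ((\<lambda>t. Z t x) has_real_derivative Zt t x) (at t)"
       "\<And>t x. ((\<lambda>t. Zx t x) has_real_derivative Ztx t x) (at t)"
    and c: "continuous_on UNIV (\<lambda>(t, x). Z t x)" "continuous_on UNIV (\<lambda>(t, x). Zt t x)"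
       "continuous_on UNIV (\<lambda>(t, x). Zx t x)" "continuous_on UNIV (\<lambda>(t, x). Ztx t x)"
    using assms unfolding smooth_test_def by metis
  have "common_support T Z" using K z unfolding common_support_def by blast
  moreover have "C1c UNIV (Z t) (Zx t) \<and> C1c UNIV (Zt t) (Ztx t)" if "t \<in> {0..T}" for t
    using d c K z[OF that] unfolding C1c_def by (auto intro!: continuous_slice)
  moreover have "C1_curve T Z Zt" by (rule C1_curveI[OF d(3) c(2) K]) (use z in auto)
  moreover have "C1_curve T Zx Ztx" by (rule C1_curveI[OF d(4) c(4) K]) (use z in auto)
  ultimately show ?thesis unfolding C1_C1c_def by blast
qed

lemma smooth_test_product:
  assumes e: "0 < \<epsilon>" and b: "\<And>t. (b has_real_derivative b' t) (at t)"
    and b': "continuous_on UNIV b'" and bT: "b T = 0"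
  shows "smooth_test T (\<lambda>t x. bump a \<epsilon> x * b t) (\<lambda>t x. bump a \<epsilon> x * b' t)
    (\<lambda>t x. (kern \<epsilon> (a - x) - kern \<epsilon> (x - a)) * b t)"
proof -
  let ?K = "{a - \<epsilon>..a + \<epsilon>}"
  have cb: "continuous_on UNIV b" using b by (intro DERIV_continuous_on) auto
  have ct: "continuous_on UNIV (\<lambda>p::real \<times> real. b (fst p))" "continuous_on UNIV (\<lambda>p::real \<times> real. b' (fst p))"
    by (auto intro!: continuous_on_compose2[OF cb] continuous_on_compose2[OF b'] continuous_intros)
  have cx: "continuous_on UNIV (\<lambda>p::real \<times> real. bump a \<epsilon> (snd p))"
    unfolding bump_def using e by (auto intro!: continuous_intros)
  have ck: "continuous_on UNIV (\<lambda>p::real \<times> real. kern \<epsilon> (a - snd p) - kern \<epsilon> (snd p - a))"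
    using e by (auto intro!: continuous_intros)
  have z: "bump a \<epsilon> x = 0 \<and> kern \<epsilon> (a - x) = 0 \<and> kern \<epsilon> (x - a) = 0" if "x \<notin> ?K" for x
    using that e by (auto intro!: bump_eq_0 kern_eq_0)
  show ?thesis
    unfolding smooth_test_def
  proof (intro conjI exI[of _ ?K] exI[of _ "\<lambda>t x. (kern \<epsilon> (a - x) - kern \<epsilon> (x - a)) * b' t"] allI ballI impI)
    show "bump a \<epsilon> x * b T = 0" for x using bT by simp
    show "((\<lambda>x. bump a \<epsilon> x * b t) has_real_derivative (kern \<epsilon> (a - x) - kern \<epsilon> (x - a)) * b t) (at x)" for t x
      by (rule DERIV_cmult_right[OF DERIV_bump[OF e]])
    show "((\<lambda>x. bump a \<epsilon> x * b' t) has_real_derivative (kern \<epsilon> (a - x) - kern \<epsilon> (x - a)) * b' t) (at x)" for t x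
      by (rule DERIV_cmult_right[OF DERIV_bump[OF e]])
    show "((\<lambda>t. bump a \<epsilon> x * b t) has_real_derivative bump a \<epsilon> x * b' t) (at t)" for t x
      by (rule DERIV_cmult[OF b])
    show "((\<lambda>t. (kern \<epsilon> (a - x) - kern \<epsilon> (x - a)) * b t) has_real_derivative
        (kern \<epsilon> (a - x) - kern \<epsilon> (x - a)) * b' t) (at t)" for t x
      by (rule DERIV_cmult[OF b])
  qed (use z ct cx ck in \<open>auto simp: case_prod_unfold intro!: continuous_on_mult\<close>)
qed

text \<open>
  The test function for the triangle \<open>0 < y < X - s t\<close>: the weight is constant on the lines on which
  \<open>y + s t\<close> is constant, and \<open>step\<close> cuts it off at \<open>y = 0\<close>. The functions \<open>wave_t\<close> and \<open>wave_x\<close> are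
  its partial derivatives.
\<close>

definition wave :: "real \<Rightarrow> real \<Rightarrow> real \<Rightarrow> real \<Rightarrow> real \<Rightarrow> real" where
  "wave \<epsilon> X s t y = step (y / \<epsilon>) * weight X (y + s * t)"

definition wave_t :: "real \<Rightarrow> real \<Rightarrow> real \<Rightarrow> real \<Rightarrow> real \<Rightarrow> real" where
  "wave_t \<epsilon> X s t y = step (y / \<epsilon>) * (s * weight_deriv X (y + s * t))"

definition wave_x :: "real \<Rightarrow> real \<Rightarrow> real \<Rightarrow> real \<Rightarrow> real \<Rightarrow> real" where
  "wave_x \<epsilon> X s t y = kern \<epsilon> y * weight X (y + s * t) + step (y / \<epsilon>) * weight_deriv X (y + s * t)"

lemma smooth_test_wave:
  assumes e: "0 < \<epsilon>" and X: "0 < X" and s: "0 < s" and \<theta>: "\<theta> = 1 \<or> \<theta> = -1"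
  shows "smooth_test (X / s) (\<lambda>t x. wave \<epsilon> X s t (\<theta> * (x - a))) (\<lambda>t x. wave_t \<epsilon> X s t (\<theta> * (x - a)))
    (\<lambda>t x. \<theta> * wave_x \<epsilon> X s t (\<theta> * (x - a)))"
proof -
  define w2 where "w2 t y = s * (kern \<epsilon> y * weight_deriv X (y + s * t) + step (y / \<epsilon>) * weight_deriv2 X (y + s * t))" for t y
  have X0: "X \<noteq> 0" using X by simp
  note W = DERIV_chain2[OF DERIV_weight(1)[OF X0]] DERIV_chain2[OF DERIV_weight(2)[OF X0]]
  have l: "((\<lambda>x. \<theta> * (x - a)) has_real_derivative \<theta>) (at x)" for x
    by (auto intro!: derivative_eq_intros)
  have st: "((\<lambda>y. step (y / \<epsilon>)) has_real_derivative kern \<epsilon> y) (at y)" for y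
    using e by (auto intro!: derivative_eq_intros simp: kern_def)
  have wy: "((\<lambda>y. weight X (y + s * t)) has_real_derivative weight_deriv X (y + s * t)) (at y)"
    "((\<lambda>y. weight_deriv X (y + s * t)) has_real_derivative weight_deriv2 X (y + s * t)) (at y)" for t y
    by (rule W[THEN DERIV_cong], (auto intro!: derivative_eq_intros)[1], simp)+
  have wt: "((\<lambda>t. weight X (y + s * t)) has_real_derivative s * weight_deriv X (y + s * t)) (at t)"
    "((\<lambda>t. weight_deriv X (y + s * t)) has_real_derivative s * weight_deriv2 X (y + s * t)) (at t)" for t y
    by (rule W[THEN DERIV_cong], (auto intro!: derivative_eq_intros)[1], simp)+
  have dy: "(wave \<epsilon> X s t has_real_derivative wave_x \<epsilon> X s t y) (at y)"
    "(wave_t \<epsilon> X s t has_real_derivative w2 t y) (at y)" for t y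
    unfolding wave_def[abs_def] wave_x_def wave_t_def[abs_def] w2_def
    by (rule DERIV_cong[OF DERIV_mult[OF st wy(1)]], simp add: mult_ac,
        rule DERIV_cong[OF DERIV_mult[OF st DERIV_cmult[OF wy(2)]]], simp add: algebra_simps)
  have dt: "((\<lambda>t. wave \<epsilon> X s t y) has_real_derivative wave_t \<epsilon> X s t y) (at t)"
    "((\<lambda>t. wave_x \<epsilon> X s t y) has_real_derivative w2 t y) (at t)" for t y
    unfolding wave_def[abs_def] wave_x_def[abs_def] wave_t_def[abs_def] w2_def
    by (rule DERIV_cmult[OF wt(1)],
        rule DERIV_cong[OF DERIV_add[OF DERIV_cmult[OF wt(1)] DERIV_cmult[OF wt(2)]]], simp add: algebra_simps)
  have z: "wave \<epsilon> X s t y = 0 \<and> wave_t \<epsilon> X s t y = 0 \<and> wave_x \<epsilon> X s t y = 0 \<and> w2 t y = 0"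
    if "0 \<le> t" "X < \<bar>y\<bar>" for t y
  proof (cases "y < 0")
    case True
    then show ?thesis
      using e by (simp add: wave_def wave_t_def wave_x_def w2_def kern_eq_0 step_eq_0 divide_nonpos_pos)
  next
    case False
    have "0 \<le> s * t" using s that by simp
    then have "X \<le> y + s * t" using False that by simp
    then show ?thesis
      using X by (simp add: wave_def wave_t_def wave_x_def w2_def weight_eq_0)
  qed
  have zT: "wave \<epsilon> X s (X / s) y = 0" for y
    using e s X by (cases "y \<le> 0") (auto simp: wave_def step_eq_0 weight_eq_0 divide_nonpos_pos)
  note lc = DERIV_chain2[OF _ l]
  let ?K = "{a - X..a + X}"
  have zK: "X < \<bar>\<theta> * (x - a)\<bar>" if "x \<notin> ?K" for x
    using that \<theta> by (auto simp: abs_if)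
  have c1: "continuous_on UNIV (\<lambda>p::real \<times> real. \<theta> * (snd p - a))"
    "continuous_on UNIV (\<lambda>p::real \<times> real. \<theta> * (snd p - a) / \<epsilon>)"
    "continuous_on UNIV (\<lambda>p::real \<times> real. \<theta> * (snd p - a) + s * fst p)"
    using e by (auto intro!: continuous_intros)
  have c: "continuous_on UNIV (\<lambda>p::real \<times> real. wave \<epsilon> X s (fst p) (\<theta> * (snd p - a)))"
    "continuous_on UNIV (\<lambda>p::real \<times> real. wave_t \<epsilon> X s (fst p) (\<theta> * (snd p - a)))"
    "continuous_on UNIV (\<lambda>p::real \<times> real. \<theta> * wave_x \<epsilon> X s (fst p) (\<theta> * (snd p - a)))"
    "continuous_on UNIV (\<lambda>p::real \<times> real. \<theta> * w2 (fst p) (\<theta> * (snd p - a)))"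
    unfolding wave_def wave_t_def wave_x_def w2_def using e
    by (intro continuous_on_mult continuous_on_add continuous_on_const continuous_step continuous_weight
        continuous_kern c1; simp)+
  show ?thesis
    unfolding smooth_test_def
  proof (intro conjI exI[of _ ?K] exI[of _ "\<lambda>t x. \<theta> * w2 t (\<theta> * (x - a))"] allI ballI impI)
    show "wave \<epsilon> X s (X / s) (\<theta> * (x - a)) = 0" for x by (rule zT)
    show "((\<lambda>x. wave \<epsilon> X s t (\<theta> * (x - a))) has_real_derivative \<theta> * wave_x \<epsilon> X s t (\<theta> * (x - a))) (at x)" for t x
      by (rule DERIV_cong[OF lc[OF dy(1)]]) simp
    show "((\<lambda>x. wave_t \<epsilon> X s t (\<theta> * (x - a))) has_real_derivative \<theta> * w2 t (\<theta> * (x - a))) (at x)" for t x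
      by (rule DERIV_cong[OF lc[OF dy(2)]]) simp
    show "((\<lambda>t. wave \<epsilon> X s t (\<theta> * (x - a))) has_real_derivative wave_t \<epsilon> X s t (\<theta> * (x - a))) (at t)" for t x
      by (rule dt(1))
    show "((\<lambda>t. \<theta> * wave_x \<epsilon> X s t (\<theta> * (x - a))) has_real_derivative \<theta> * w2 t (\<theta> * (x - a))) (at t)" for t x
      by (rule DERIV_cmult[OF dt(2)])
  qed (use z zK c in \<open>auto simp: case_prod_unfold\<close>)
qed

section \<open>Integrals over the strip\<close>

lemma strip_borel [measurable]: "strip T \<in> sets borel"
  unfolding strip_def by (intro borel_open open_Times) auto

lemma set_integrable_strip:
  assumes f: "f \<in> borel_measurable borel" and K: "compact K"
    and b: "\<And>x t. 0 < t \<Longrightarrow> t < T \<Longrightarrow> \<bar>f (x, t)\<bar> \<le> B"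
    and z: "\<And>x t. 0 < t \<Longrightarrow> t < T \<Longrightarrow> x \<notin> K \<Longrightarrow> f (x, t) = 0"
  shows "set_integrable lborel (strip T) (f :: real \<times> real \<Rightarrow> real)"
  unfolding set_integrable_def
proof (rule integrableI_bounded_set[where A = "K \<times> {0..T}" and B = "\<bar>B\<bar>"])
  have c: "compact (K \<times> {0..T})" using K by (intro compact_Times) auto
  show "K \<times> {0..T} \<in> sets lborel" using borel_compact[OF c] by simp
  show "emeasure lborel (K \<times> {0..T}) < \<infinity>" using compact_imp_bounded[OF c] by (rule emeasure_bounded_finite)
  show "(\<lambda>x. indicat_real (strip T) x *\<^sub>R f x) \<in> borel_measurable lborel" using f by measurable
  have "norm (indicat_real (strip T) (x, t) *\<^sub>R f (x, t)) \<le> \<bar>B\<bar>" for x t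
    using b[of t x] by (cases "0 < t \<and> t < T") (auto simp: strip_def indicator_def)
  then show "AE p in lborel. p \<in> K \<times> {0..T} \<longrightarrow> norm (indicat_real (strip T) p *\<^sub>R f p) \<le> \<bar>B\<bar>"
    by (intro AE_I2) (metis surj_pair)
  show "AE p in lborel. p \<notin> K \<times> {0..T} \<longrightarrow> indicat_real (strip T) p *\<^sub>R f p = 0"
  proof (rule AE_I2)
    fix p show "p \<notin> K \<times> {0..T} \<longrightarrow> indicat_real (strip T) p *\<^sub>R f p = 0"
      using z[of "snd p" "fst p"] by (cases p) (auto simp: strip_def indicator_def)
  qed
qed

lemma indicator_strip: "indicat_real (strip T) (x, t) = indicat_real {0<..<T} t"
  by (simp add: strip_def indicator_def)

lemma strip_Fubini:
  fixes f :: "real \<times> real \<Rightarrow> real"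
  assumes f: "set_integrable lborel (strip T) f"
  shows "(LINT p:strip T|lborel. f p) = (LINT x|lborel. (LINT t:{0<..<T}|lborel. f (x, t)))"
    and "(LINT p:strip T|lborel. f p) = (LINT t:{0<..<T}|lborel. (LINT x|lborel. f (x, t)))"
proof -
  have i: "integrable (lborel \<Otimes>\<^sub>M lborel) (\<lambda>(x, t). indicat_real (strip T) (x, t) *\<^sub>R f (x, t))"
    using f by (simp add: set_integrable_def lborel_prod case_prod_unfold)
  have e: "(LINT p:strip T|lborel. f p) =
      integral\<^sup>L (lborel \<Otimes>\<^sub>M lborel) (\<lambda>(x, t). indicat_real (strip T) (x, t) *\<^sub>R f (x, t))"
    by (simp add: set_lebesgue_integral_def lborel_prod case_prod_unfold)
  show "(LINT p:strip T|lborel. f p) = (LINT x|lborel. (LINT t:{0<..<T}|lborel. f (x, t)))"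
    unfolding e lborel_pair.integral_fst[OF i, symmetric]
    by (simp add: set_lebesgue_integral_def indicator_strip)
  show "(LINT p:strip T|lborel. f p) = (LINT t:{0<..<T}|lborel. (LINT x|lborel. f (x, t)))"
    unfolding e lborel_pair.integral_snd[OF i, symmetric]
    by (simp add: set_lebesgue_integral_def indicator_strip)
qed

lemma FTC_open_interval:
  fixes F f :: "real \<Rightarrow> real"
  assumes "a \<le> b" "\<And>t. (F has_real_derivative f t) (at t)" "continuous_on UNIV f"
  shows "set_integrable lborel {a<..<b} f" "(LINT t:{a<..<b}|lborel. f t) = F b - F a"
proof -
  have c: "isCont f t" for t using assms(3) by (simp add: continuous_on_eq_continuous_at)
  have h: "has_bochner_integral lborel (\<lambda>t. f t * indicator {a..b} t) (F b - F a)"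
    by (rule has_bochner_integral_FTC_Icc_real[OF assms(1,2) c])
  have fb: "f \<in> borel_measurable borel" by (rule borel_measurable_continuous_onI[OF assms(3)])
  have ae: "AE t in lborel. indicator {a<..<b} t *\<^sub>R f t = f t * indicator {a..b} t"
    using AE_lborel_singleton[of a] AE_lborel_singleton[of b]
    by eventually_elim (auto simp: indicator_def)
  show "set_integrable lborel {a<..<b} f"
    unfolding set_integrable_def
    using h integrable_cong_AE[OF _ _ ae] fb by (auto simp: has_bochner_integral_iff)
  show "(LINT t:{a<..<b}|lborel. f t) = F b - F a"
    unfolding set_lebesgue_integral_def
    using h integral_cong_AE[OF _ _ ae] fb by (auto simp: has_bochner_integral_iff)
qed

lemma bounded_of_compact_support:
  fixes g :: "real \<Rightarrow> real \<Rightarrow> real"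
  assumes c: "continuous_on UNIV (\<lambda>(t, x). g t x)" and K: "compact K"
    and z: "\<And>t x. t \<in> {0..T} \<Longrightarrow> x \<notin> K \<Longrightarrow> g t x = 0"
  shows "\<exists>B. \<forall>t\<in>{0..T}. \<forall>x. \<bar>g t x\<bar> \<le> B"
proof -
  have "bounded ((\<lambda>(t, x). g t x) ` ({0..T} \<times> K))"
    by (intro compact_imp_bounded compact_continuous_image compact_Times K
        continuous_on_subset[OF c]) auto
  then obtain B where B: "\<And>t x. t \<in> {0..T} \<Longrightarrow> x \<in> K \<Longrightarrow> \<bar>g t x\<bar> \<le> B"
    by (force simp: bounded_iff)
  have "\<bar>g t x\<bar> \<le> max 0 B" if "t \<in> {0..T}" for t x
    using B[OF that] z[OF that] by (cases "x \<in> K") (auto simp: le_max_iff_disj)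
  then show ?thesis by blast
qed

lemma smooth_test_bounded:
  assumes "smooth_test T Z Zt Zx"
  obtains K B where "compact K" "0 \<le> B"
    "\<forall>t\<in>{0..T}. \<forall>x. \<bar>Z t x\<bar> \<le> B \<and> \<bar>Zt t x\<bar> \<le> B \<and> \<bar>Zx t x\<bar> \<le> B"
    "\<forall>t\<in>{0..T}. \<forall>x. x \<notin> K \<longrightarrow> Z t x = 0 \<and> Zt t x = 0 \<and> Zx t x = 0"
    "(\<lambda>(x, t). Z t x) \<in> borel_measurable borel" "(\<lambda>(x, t). Zt t x) \<in> borel_measurable borel"
    "(\<lambda>(x, t). Zx t x) \<in> borel_measurable borel"
proof -
  obtain K where K: "compact K"
    and z: "\<And>t x. t \<in> {0..T} \<Longrightarrow> x \<notin> K \<Longrightarrow> Z t x = 0 \<and> Zt t x = 0 \<and> Zx t x = 0"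
    and c: "continuous_on UNIV (\<lambda>(t, x). Z t x)" "continuous_on UNIV (\<lambda>(t, x). Zt t x)"
       "continuous_on UNIV (\<lambda>(t, x). Zx t x)"
    using assms unfolding smooth_test_def by metis
  obtain B1 B2 B3 where B: "\<forall>t\<in>{0..T}. \<forall>x. \<bar>Z t x\<bar> \<le> B1" "\<forall>t\<in>{0..T}. \<forall>x. \<bar>Zt t x\<bar> \<le> B2"
    "\<forall>t\<in>{0..T}. \<forall>x. \<bar>Zx t x\<bar> \<le> B3"
    using bounded_of_compact_support[OF c(1) K] bounded_of_compact_support[OF c(2) K]
      bounded_of_compact_support[OF c(3) K] z by metis
  have m: "(\<lambda>(x, t). g t x) \<in> borel_measurable borel" if "continuous_on UNIV (\<lambda>(t, x). g t x)"
    for g :: "real \<Rightarrow> real \<Rightarrow> real"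
    by (intro borel_measurable_continuous_onI)
      (use continuous_on_compose2[OF that, of UNIV prod.swap] in \<open>simp add: case_prod_unfold continuous_on_swap\<close>)
  show ?thesis
  proof (rule that[OF K, of "max 0 (max B1 (max B2 B3))"])
    show "\<forall>t\<in>{0..T}. \<forall>x. \<bar>Z t x\<bar> \<le> max 0 (max B1 (max B2 B3)) \<and>
        \<bar>Zt t x\<bar> \<le> max 0 (max B1 (max B2 B3)) \<and> \<bar>Zx t x\<bar> \<le> max 0 (max B1 (max B2 B3))"
      using B by (simp add: le_max_iff_disj)
  qed (use z m c in auto)
qed

text \<open>
  These are the weak formulations for constant solutions. They allow constants to be subtracted from
  the entropy and from the flux.
\<close>

lemma smooth_test_integrals:
  assumes st: "smooth_test T Z Zt Zx" and T: "0 < T"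
  shows "(LINT (x, t):strip T|lborel. Zt t x) = - (LINT x|lborel. Z 0 x)"
    and "(LINT (x, t):strip T|lborel. Zx t x) = 0"
    and "integrable lborel (Z 0)"
proof -
  obtain K B where K: "compact K" and B0: "0 \<le> B"
    and B: "\<forall>t\<in>{0..T}. \<forall>x. \<bar>Z t x\<bar> \<le> B \<and> \<bar>Zt t x\<bar> \<le> B \<and> \<bar>Zx t x\<bar> \<le> B"
    and z: "\<forall>t\<in>{0..T}. \<forall>x. x \<notin> K \<longrightarrow> Z t x = 0 \<and> Zt t x = 0 \<and> Zx t x = 0"
    and m: "(\<lambda>(x, t). Z t x) \<in> borel_measurable borel" "(\<lambda>(x, t). Zt t x) \<in> borel_measurable borel"
    "(\<lambda>(x, t). Zx t x) \<in> borel_measurable borel"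
    by (rule smooth_test_bounded[OF st])
  have ZT: "Z T x = 0" for x using st by (simp add: smooth_test_def)
  have d: "(Z t has_real_derivative Zx t x) (at x)" "((\<lambda>t. Z t x) has_real_derivative Zt t x) (at t)" for t x
    using st unfolding smooth_test_def by blast+
  have c: "continuous_on UNIV (\<lambda>(t, x). Zt t x)" "continuous_on UNIV (\<lambda>(t, x). Zx t x)"
    using st unfolding smooth_test_def by blast+
  have ct: "continuous_on UNIV (\<lambda>t. Zt t x)" for x
    using continuous_on_compose2[OF c(1), of UNIV "\<lambda>t. (t, x)"]
    by (simp add: continuous_on_Pair continuous_on_const continuous_on_id)
  have it: "set_integrable lborel (strip T) (\<lambda>(x, t). Zt t x)"
    using B z by (intro set_integrable_strip[OF m(2) K, where B = B]) auto
  have ix: "set_integrable lborel (strip T) (\<lambda>(x, t). Zx t x)"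
    using B z by (intro set_integrable_strip[OF m(3) K, where B = B]) auto
  have "(LINT t:{0<..<T}|lborel. Zt t x) = - Z 0 x" for x
    using FTC_open_interval(2)[OF _ d(2) ct, of 0 T] T ZT by simp
  then show "(LINT (x, t):strip T|lborel. Zt t x) = - (LINT x|lborel. Z 0 x)"
    unfolding strip_Fubini(1)[OF it] by simp
  obtain R where R: "K \<subseteq> {-R<..<R}" "0 < R"
  proof -
    obtain R where "R > 0" "K \<subseteq> ball 0 R" using compact_imp_bounded[OF K] bounded_subset_ballD by blast
    then show ?thesis by (intro that[of R]) (auto simp: dist_real_def subset_iff abs_less_iff)
  qed
  have "(LINT x|lborel. Zx t x) = 0" if t: "t \<in> {0<..<T}" for t
  proof -
    have t': "t \<in> {0..T}" using t by simp
    have e: "indicator {-R<..<R} x * Zx t x = Zx t x" for x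
    proof (cases "x \<in> {-R<..<R}")
      case False
      then have "x \<notin> K" using R(1) by blast
      then have "Zx t x = 0" using z t' by blast
      then show ?thesis by simp
    qed simp
    have "(LINT x|lborel. Zx t x) = (LINT x:{-R<..<R}|lborel. Zx t x)"
      unfolding set_lebesgue_integral_def real_scaleR_def e ..
    also have "\<dots> = Z t R - Z t (- R)"
      by (rule FTC_open_interval(2)[OF _ d(1) continuous_slice[OF c(2)]]) (use R(2) in simp)
    also have "\<dots> = 0"
    proof -
      have "R \<notin> K" "- R \<notin> K" using R(1) by auto
      then show ?thesis using z t' by simp
    qed
    finally show ?thesis .
  qed
  then have "(LINT t:{0<..<T}|lborel. (LINT x|lborel. Zx t x)) = (LINT t:{0<..<T}|lborel. 0)"
    by (intro set_lebesgue_integral_cong) auto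
  then show "(LINT (x, t):strip T|lborel. Zx t x) = 0"
    using strip_Fubini(2)[OF ix] by (simp add: set_lebesgue_integral_def)
  show "integrable lborel (Z 0)"
  proof (rule integrableI_bounded_set[where A = K and B = B])
    show "Z 0 \<in> borel_measurable lborel"
    proof -
      have "continuous_on UNIV (Z 0)" using d(1)[of 0] by (intro DERIV_continuous_on) auto
      then show ?thesis by (simp add: borel_measurable_continuous_onI)
    qed
    show "emeasure lborel K < \<infinity>" using compact_imp_bounded[OF K] by (rule emeasure_bounded_finite)
  qed (use K B z T in \<open>auto simp: borel_compact\<close>)
qed

section \<open>Time slices of the solution\<close>

lemma tot_var_finite_on_compact:
  assumes s: "signed_radon_on (UNIV :: real set) s" and K: "compact K"
  shows "sets (tot_var UNIV s) = sets borel" "emeasure (tot_var UNIV s) K < \<infinity>"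
proof -
  obtain \<nu> f where r: "radon_rep UNIV s = (\<nu>, f)" by fastforce
  note n = representsD[OF radon_rep_represents[OF s r]]
  show "sets (tot_var UNIV s) = sets borel"
    using radon_sets[OF n(1)] by (simp add: tot_var_eq[OF r])
  have "emeasure (tot_var UNIV s) K = (\<integral>\<^sup>+ x. ennreal \<bar>f x\<bar> * indicator K x \<partial>\<nu>)"
    unfolding tot_var_eq[OF r] using n(2) borel_compact[OF K] radon_sets[OF n(1)]
    by (subst emeasure_density) (auto simp: radon_borel_measurable[OF n(1)])
  also have "\<dots> = (\<integral>\<^sup>+ x. ennreal (norm (indicator K x *\<^sub>R f x)) \<partial>\<nu>)"
    by (intro nn_integral_cong) (auto simp: indicator_def)
  also have "\<dots> < \<infinity>"
    using n(3)[OF K] by (simp add: set_integrable_def integrable_iff_bounded)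
  finally show "emeasure (tot_var UNIV s) K < \<infinity>" .
qed

lemma integrable_tot_var:
  assumes s: "signed_radon_on (UNIV :: real set) s" and K: "compact K"
    and \<phi>: "\<phi> \<in> borel_measurable borel" "\<And>x. \<bar>\<phi> x\<bar> \<le> B" "\<And>x. x \<notin> K \<Longrightarrow> \<phi> x = 0"
  shows "integrable (tot_var UNIV s) (\<phi> :: real \<Rightarrow> real)"
    and "\<bar>LINT x|tot_var UNIV s. \<phi> x\<bar> \<le> B * measure (tot_var UNIV s) K"
proof -
  note f = tot_var_finite_on_compact[OF s K]
  have Ks: "K \<in> sets (tot_var UNIV s)" using f(1) borel_compact[OF K] by simp
  have B: "0 \<le> B" using \<phi>(2)[of 0] by linarith
  show i: "integrable (tot_var UNIV s) \<phi>"
    by (rule integrableI_bounded_set[where A = K and B = B])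
      (use Ks f \<phi> measurable_cong_sets[OF f(1) refl] in auto)
  have "\<bar>LINT x|tot_var UNIV s. \<phi> x\<bar> \<le> (LINT x|tot_var UNIV s. \<bar>\<phi> x\<bar>)"
    by (rule integral_abs_bound)
  also have "\<dots> \<le> (LINT x|tot_var UNIV s. B * indicator K x)"
  proof (rule integral_mono')
    show "integrable (tot_var UNIV s) (\<lambda>x. B * indicator K x)"
      using Ks f(2) by (intro integrable_mult_right) auto
    show "\<bar>\<phi> x\<bar> \<le> B * indicator K x" for x
      using \<phi>(2,3)[of x] by (cases "x \<in> K") auto
  qed (use B in simp)
  also have "\<dots> = B * measure (tot_var UNIV s) K" using Ks by simp
  finally show "\<bar>LINT x|tot_var UNIV s. \<phi> x\<bar> \<le> B * measure (tot_var UNIV s) K" .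
qed

lemma continuous_curve_parts:
  assumes "continuous_measure_curve u" "0 \<le> t"
  shows "lebesgue_decomposition (u t) (ac_density (u t)) (sing_part (u t))"
    "signed_radon_on UNIV (sing_part (u t))"
proof -
  show d: "lebesgue_decomposition (u t) (ac_density (u t)) (sing_part (u t))"
    using assms by (intro decomposition_parts) (auto simp: continuous_measure_curve_def)
  show "signed_radon_on UNIV (sing_part (u t))" by (rule lebesgue_decompositionD(2)[OF d])
qed

lemma continuous_curve_tendsto:
  assumes "continuous_measure_curve u" "0 \<le> t0" "compact K"
  shows "((\<lambda>t. measure (tot_var UNIV (\<lambda>A. u t A - u t0 A)) K) \<longlongrightarrow> 0) (at t0 within {0..T})"
proof (rule tendsto_within_subset)
  show "((\<lambda>t. measure (tot_var UNIV (\<lambda>A. u t A - u t0 A)) K) \<longlongrightarrow> 0) (at t0 within {0..})"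
    using assms unfolding continuous_measure_curve_def by blast
qed auto

text \<open>
  The slices are continuous in total variation on compact sets, and by \<open>singular_part_distance\<close> so are
  the total variations of their singular parts.
\<close>

lemma continuous_singular_variation:
  assumes u: "continuous_measure_curve u"
    and c: "continuous_on UNIV (\<lambda>(t, x). \<psi> t x)" and K: "compact K"
    and z: "\<And>t x. t \<in> {0..T} \<Longrightarrow> x \<notin> K \<Longrightarrow> \<psi> t x = (0 :: real)"
  shows "continuous_on {0..T} (\<lambda>t. LINT x|tot_var UNIV (sing_part (u t)). \<psi> t x)"
  unfolding continuous_on_def
proof
  fix t0 assume t0: "t0 \<in> {0..T}"
  let ?F = "at t0 within {0..T}"
  let ?m = "\<lambda>t. tot_var UNIV (sing_part (u t))"
  let ?J = "\<lambda>t. LINT x|?m t0. \<psi> t x"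
  have s0: "signed_radon_on UNIV (sing_part (u t0))" using t0 continuous_curve_parts(2)[OF u] by simp
  have m: "\<psi> t \<in> borel_measurable borel" for t
    by (rule borel_measurable_continuous_onI[OF continuous_slice[OF c]])
  obtain B where "\<forall>t\<in>{0..T}. \<forall>x. \<bar>\<psi> t x\<bar> \<le> B"
    using bounded_of_compact_support[OF c K z] by blast
  then have B: "\<bar>\<psi> t x\<bar> \<le> B" if "t \<in> {0..T}" for t x using that by blast
  have i0: "integrable (?m t0) (\<psi> t)" if "t \<in> {0..T}" for t
    by (rule integrable_tot_var[OF s0 K m B[OF that] z[OF that]])
  have J: "(?J \<longlongrightarrow> ?J t0) ?F"
  proof (rule tendstoI)
    fix e :: real assume e: "0 < e"
    define M where "M = measure (?m t0) K + 1"
    have M: "0 < M" by (simp add: M_def add_nonneg_pos)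
    obtain d where d: "d > 0"
      "\<forall>s\<in>{0..T}. \<forall>t\<in>{0..T}. \<forall>x. \<bar>s - t\<bar> < d \<longrightarrow> \<bar>\<psi> s x - \<psi> t x\<bar> < e / M"
      using C0_curveI(2)[OF c K z, of T "e / M"] e M by auto
    have "\<bar>?J t - ?J t0\<bar> < e" if t: "t \<in> {0..T}" "\<bar>t - t0\<bar> < d" for t
    proof -
      have "\<bar>?J t - ?J t0\<bar> = \<bar>LINT x|?m t0. \<psi> t x - \<psi> t0 x\<bar>"
        using i0 t t0 by simp
      also have "\<dots> \<le> e / M * measure (?m t0) K"
        using d t t0 z m by (intro integrable_tot_var(2)[OF s0 K]) (auto intro!: less_imp_le)
      also have "\<dots> < e / M * M"
        using e M by (intro mult_strict_left_mono) (auto simp: M_def)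
      finally show ?thesis using M by simp
    qed
    then show "\<forall>\<^sub>F t in ?F. dist (?J t) (?J t0) < e"
      unfolding eventually_at using d(1) by (intro exI[of _ d]) (auto simp: dist_real_def)
  qed
  have "((\<lambda>t. measure (tot_var UNIV (\<lambda>A. u t A - u t0 A)) K) \<longlongrightarrow> 0) ?F"
    by (rule continuous_curve_tendsto[OF u _ K]) (use t0 in simp)
  from tendsto_mult_right_zero[OF this, of "B"]
  have D: "((\<lambda>t. B * measure (tot_var UNIV (\<lambda>A. u t A - u t0 A)) K) \<longlongrightarrow> 0) ?F" by simp
  have "((\<lambda>t. (LINT x|?m t. \<psi> t x) - ?J t) \<longlongrightarrow> 0) ?F"
  proof (rule Lim_null_comparison[OF _ D])
    have "norm ((LINT x|?m t. \<psi> t x) - ?J t) \<le> B * measure (tot_var UNIV (\<lambda>A. u t A - u t0 A)) K"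
      if "t \<in> {0..T}" for t
      using continuous_curve_parts(1)[OF u, of t] continuous_curve_parts(1)[OF u, of t0] that t0
        singular_part_distance[OF _ _ K m B[OF that] z[OF that]]
      by auto
    then show "\<forall>\<^sub>F t in ?F. norm ((LINT x|?m t. \<psi> t x) - ?J t)
        \<le> B * measure (tot_var UNIV (\<lambda>A. u t A - u t0 A)) K"
      by (auto simp: eventually_at_filter)
  qed
  from tendsto_add[OF this J]
  show "((\<lambda>t. LINT x|?m t. \<psi> t x) \<longlongrightarrow> (LINT x|?m t0. \<psi> t0 x)) ?F" by simp
qed

lemma set_integrable_lebesgue_continuous:
  fixes f :: "real \<Rightarrow> real"
  assumes "continuous_on {0..T} f"
  shows "set_integrable lebesgue {0<..<T} f"
  by (rule set_integrable_subset[OF absolutely_integrable_continuous_real[OF assms]]) auto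

text \<open>
  The right-hand side is an integral of a continuous function of time, so the bound holds whether or
  not the pairing is measurable in time.
\<close>

lemma pairing_singular_time_bound:
  assumes u: "continuous_measure_curve u"
    and c: "continuous_on UNIV (\<lambda>(t, x). \<psi> t x)" and K: "compact K"
    and z: "\<And>t x. t \<in> {0..T} \<Longrightarrow> x \<notin> K \<Longrightarrow> \<psi> t x = (0 :: real)"
    and le: "\<And>t x. t \<in> {0..T} \<Longrightarrow> \<bar>\<phi> t x\<bar> \<le> \<psi> t x"
  shows "\<bar>LINT t:{0<..<T}|lebesgue. pairing (sing_part (u t)) (\<phi> t)\<bar>
    \<le> (LINT t:{0<..<T}|lebesgue. LINT x|tot_var UNIV (sing_part (u t)). \<psi> t x)"
proof -
  have i: "set_integrable lebesgue {0<..<T} (\<lambda>t. LINT x|tot_var UNIV (sing_part (u t)). \<psi> t x)"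
    by (rule set_integrable_lebesgue_continuous[OF continuous_singular_variation[OF u c K z]])
  have b: "\<bar>pairing (sing_part (u t)) (\<phi> t)\<bar> \<le> (LINT x|tot_var UNIV (sing_part (u t)). \<psi> t x)"
    if t: "t \<in> {0<..<T}" for t
  proof -
    have t': "t \<in> {0..T}" using t by simp
    have s: "signed_radon_on UNIV (sing_part (u t))" using t continuous_curve_parts(2)[OF u] by simp
    have cs: "continuous_on UNIV (\<psi> t)" by (rule continuous_slice[OF c])
    obtain B where "\<forall>t\<in>{0..T}. \<forall>x. \<bar>\<psi> t x\<bar> \<le> B"
      using bounded_of_compact_support[OF c K z] by blast
    then have "\<bar>\<psi> t x\<bar> \<le> B" for x using t' by blast
    then show ?thesis
      by (rule abs_pairing_le[OF s borel_measurable_continuous_onI[OF cs] _ K z[OF t'] le[OF t']])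
  qed
  have "\<bar>LINT t:{0<..<T}|lebesgue. pairing (sing_part (u t)) (\<phi> t)\<bar>
      \<le> (LINT t|lebesgue. \<bar>indicator {0<..<T} t *\<^sub>R pairing (sing_part (u t)) (\<phi> t)\<bar>)"
    unfolding set_lebesgue_integral_def by (rule integral_abs_bound)
  also have "\<dots> \<le> (LINT t:{0<..<T}|lebesgue. LINT x|tot_var UNIV (sing_part (u t)). \<psi> t x)"
    unfolding set_lebesgue_integral_def
  proof (rule integral_mono'[OF i[unfolded set_integrable_def]])
    fix t
    show "\<bar>indicator {0<..<T} t *\<^sub>R pairing (sing_part (u t)) (\<phi> t)\<bar>
      \<le> indicator {0<..<T} t *\<^sub>R (LINT x|tot_var UNIV (sing_part (u t)). \<psi> t x)"
      using b[of t] by (cases "t \<in> {0<..<T}") auto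
    show "0 \<le> indicator {0<..<T} t *\<^sub>R (LINT x|tot_var UNIV (sing_part (u t)). \<psi> t x)"
      using b[of t] by (cases "t \<in> {0<..<T}") auto
  qed
  finally show ?thesis .
qed

lemma regular_part_norm_bounded:
  assumes u: "continuous_measure_curve u" and K: "compact K"
  shows "\<exists>M. \<forall>t\<in>{0..T}. (LINT x:K|lborel. \<bar>ac_density (u t) x\<bar>) \<le> M"
proof -
  let ?h = "\<lambda>t. LINT x:K|lborel. \<bar>ac_density (u t) x\<bar>"
  note D = continuous_curve_parts(1)[OF u]
  have si: "set_integrable lborel K (\<lambda>x. \<bar>ac_density (u t) x\<bar>)"
    "set_integrable lborel K (ac_density (u t))" if "0 \<le> t" for t
    using lebesgue_decompositionD(3)[OF D[OF that] K] by (auto intro: set_integrable_abs)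
  have le: "\<bar>?h t - ?h t0\<bar> \<le> measure (tot_var UNIV (\<lambda>A. u t A - u t0 A)) K"
    if t: "0 \<le> t" "0 \<le> t0" for t t0
  proof -
    have i: "set_integrable lborel K (\<lambda>x. \<bar>ac_density (u t) x - ac_density (u t0) x\<bar>)"
      using si(2)[OF t(1)] si(2)[OF t(2)] by (intro set_integrable_abs) auto
    have "?h t - ?h t0 = (LINT x:K|lborel. \<bar>ac_density (u t) x\<bar> - \<bar>ac_density (u t0) x\<bar>)"
      using si t by simp
    also have "\<bar>\<dots>\<bar> \<le> (LINT x|lborel. \<bar>indicator K x *\<^sub>R (\<bar>ac_density (u t) x\<bar> - \<bar>ac_density (u t0) x\<bar>)\<bar>)"
      unfolding set_lebesgue_integral_def by (rule integral_abs_bound)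
    also have "\<dots> \<le> (LINT x:K|lborel. \<bar>ac_density (u t) x - ac_density (u t0) x\<bar>)"
      unfolding set_lebesgue_integral_def
      by (rule integral_mono'[OF i[unfolded set_integrable_def]]) (auto simp: indicator_def)
    also have "\<dots> \<le> measure (tot_var UNIV (\<lambda>A. u t A - u t0 A)) K"
      by (rule regular_part_distance[OF D[OF t(1)] D[OF t(2)] K])
    finally show ?thesis .
  qed
  have "continuous_on {0..T} ?h"
    unfolding continuous_on_def
  proof
    fix t0 assume t0: "t0 \<in> {0..T}"
    have d: "((\<lambda>t. measure (tot_var UNIV (\<lambda>A. u t A - u t0 A)) K) \<longlongrightarrow> 0) (at t0 within {0..T})"
      by (rule continuous_curve_tendsto[OF u _ K]) (use t0 in simp)
    have "((\<lambda>t. ?h t - ?h t0) \<longlongrightarrow> 0) (at t0 within {0..T})"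
      by (rule Lim_null_comparison[OF _ d]) (use le t0 in \<open>auto simp: eventually_at_filter\<close>)
    then show "(?h \<longlongrightarrow> ?h t0) (at t0 within {0..T})" by (simp add: LIM_zero_iff)
  qed
  then have "bounded (?h ` {0..T})" by (intro compact_imp_bounded compact_continuous_image) auto
  then obtain M where "\<forall>t\<in>{0..T}. \<bar>?h t\<bar> \<le> M" by (force simp: bounded_iff)
  then have "\<forall>t\<in>{0..T}. ?h t \<le> M" by (auto simp: abs_le_iff)
  then show ?thesis by blast
qed

text \<open>
  The norm of the regular part in \<open>L\<^sup>1(K)\<close> is continuous in time, hence bounded on \<open>[0, T]\<close>; joint
  measurability and Tonelli's theorem give the rest.
\<close>

lemma regular_part_locally_integrable:
  assumes u: "continuous_measure_curve u" and r: "is_regular_part T u ur" and K: "compact K"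
  shows "set_integrable lborel (strip T) (\<lambda>(x, t). indicator K x * ur t x)"
proof -
  have m[measurable]: "(\<lambda>(x, t). ur t x) \<in> borel_measurable borel"
    using r by (simp add: is_regular_part_def)
  have Kb[measurable]: "K \<in> sets borel" by (rule borel_compact[OF K])
  have ae: "AE t in lborel. t \<in> {0<..<T} \<longrightarrow> is_ac_density (u t) (ur t)"
    using r by (simp add: is_regular_part_def AE_restrict_space_iff AE_completion_iff)
  obtain M where M: "\<forall>t\<in>{0..T}. (LINT x:K|lborel. \<bar>ac_density (u t) x\<bar>) \<le> M"
    using regular_part_norm_bounded[OF u K] by blast
  let ?f = "\<lambda>p::real \<times> real. indicat_real (strip T) p *\<^sub>R (case p of (x, t) \<Rightarrow> indicator K x * ur t x)"
  have fm: "?f \<in> borel_measurable (lborel \<Otimes>\<^sub>M lborel)"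
  proof -
    have "(\<lambda>p::real \<times> real. indicat_real K (fst p)) \<in> borel_measurable borel"
      by (intro measurable_compose[OF _ borel_measurable_indicator[OF Kb]] borel_measurable_continuous_onI
          continuous_on_fst continuous_on_id)
    moreover have "(\<lambda>p. ur (snd p) (fst p)) \<in> borel_measurable borel"
      using m by (simp add: case_prod_unfold)
    ultimately show ?thesis
      by (simp add: lborel_prod case_prod_unfold)
  qed
  have b: "(\<integral>\<^sup>+ x. ennreal (norm (?f (x, t))) \<partial>lborel) \<le> ennreal M * indicator {0..T} t"
    if a: "t \<in> {0<..<T} \<longrightarrow> is_ac_density (u t) (ur t)" for t
  proof (cases "t \<in> {0<..<T}")
    case True
    have t: "0 \<le> t" "t \<in> {0..T}" using True by auto
    have D: "lebesgue_decomposition (u t) (ur t) (sing_part (u t))"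
      using a True u t(1) by (intro decomposition_ac_density) (auto simp: continuous_measure_curve_def)
    note E = continuous_curve_parts(1)[OF u t(1)]
    have eq: "AE x in lborel. ur t x = ac_density (u t) x" by (rule regular_part_unique[OF D E])
    have i: "integrable lborel (\<lambda>x. indicator K x *\<^sub>R \<bar>ac_density (u t) x\<bar>)"
      using set_integrable_abs[OF lebesgue_decompositionD(3)[OF E K]] by (simp add: set_integrable_def)
    have "(\<integral>\<^sup>+ x. ennreal (norm (?f (x, t))) \<partial>lborel)
        = (\<integral>\<^sup>+ x. ennreal (indicator K x *\<^sub>R \<bar>ac_density (u t) x\<bar>) \<partial>lborel)"
      by (rule nn_integral_cong_AE, use eq in eventually_elim)
        (use True in \<open>auto simp: strip_def abs_mult indicator_def\<close>)
    also have "\<dots> = ennreal (LINT x:K|lborel. \<bar>ac_density (u t) x\<bar>)"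
      unfolding set_lebesgue_integral_def by (rule nn_integral_eq_integral[OF i]) simp
    also have "\<dots> \<le> ennreal M" by (rule ennreal_leI[OF bspec[OF M t(2)]])
    finally show ?thesis using t(2) by simp
  next
    case False
    then show ?thesis by (simp add: indicator_strip)
  qed
  have "(\<integral>\<^sup>+ p. ennreal (norm (?f p)) \<partial>(lborel \<Otimes>\<^sub>M lborel))
      = (\<integral>\<^sup>+ t. (\<integral>\<^sup>+ x. ennreal (norm (?f (x, t))) \<partial>lborel) \<partial>lborel)"
    by (rule lborel_pair.nn_integral_snd[symmetric]) (use fm in measurable)
  also have "\<dots> \<le> (\<integral>\<^sup>+ t. ennreal M * indicator {0..T} t \<partial>lborel)"
    by (rule nn_integral_mono_AE, use ae in eventually_elim) (rule b)
  also have "\<dots> = ennreal M * emeasure lborel {0..T}" by (rule nn_integral_cmult_indicator) simp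
  also have "\<dots> < \<infinity>"
    by (simp add: ennreal_mult_less_top emeasure_lborel_Icc_eq)
  finally have "integrable (lborel \<Otimes>\<^sub>M lborel) ?f"
    using fm by (intro integrableI_bounded)
  then show ?thesis by (simp add: set_integrable_def lborel_prod)
qed

lemma set_integrable_growth:
  fixes V :: "real \<Rightarrow> real \<Rightarrow> real" and g :: "real \<Rightarrow> real" and \<psi> :: "real \<times> real \<Rightarrow> real"
  assumes V[measurable]: "(\<lambda>p. V (snd p) (fst p)) \<in> borel_measurable borel"
    and VK: "set_integrable lborel (strip T) (\<lambda>p. indicator K (fst p) * V (snd p) (fst p))"
    and g[measurable]: "g \<in> borel_measurable borel"
    and gb: "\<And>\<xi>. \<bar>g \<xi>\<bar> \<le> \<alpha> * \<bar>\<xi>\<bar> + \<beta>"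
    and \<psi>[measurable]: "\<psi> \<in> borel_measurable borel" and K: "compact K"
    and b: "\<And>x t. t \<in> {0..T} \<Longrightarrow> \<bar>\<psi> (x, t)\<bar> \<le> D"
    and z: "\<And>x t. t \<in> {0..T} \<Longrightarrow> x \<notin> K \<Longrightarrow> \<psi> (x, t) = 0"
  shows "set_integrable lborel (strip T) (\<lambda>p. g (V (snd p) (fst p)) * \<psi> p)"
proof -
  have Kb: "K \<in> sets borel" by (rule borel_compact[OF K])
  have Km[measurable]: "(\<lambda>p::real \<times> real. indicat_real K (fst p)) \<in> borel_measurable borel"
    by (intro measurable_compose[OF _ borel_measurable_indicator[OF Kb]] borel_measurable_continuous_onI
          continuous_on_fst continuous_on_id)
  have 2: "set_integrable lborel (strip T) (\<lambda>p. indicat_real K (fst p))"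
    by (rule set_integrable_strip[OF Km K, where B = 1]) (auto simp: indicator_def)
  have "set_integrable lborel (strip T)
      (\<lambda>p. \<bar>D\<bar> * (\<alpha> * \<bar>indicator K (fst p) * V (snd p) (fst p)\<bar> + \<beta> * indicator K (fst p)))"
    using set_integrable_abs[OF VK] 2 by (intro set_integrable_mult_right set_integral_add) auto
  then show ?thesis
  proof (rule set_integrable_bound)
    show "set_borel_measurable lborel (strip T) (\<lambda>p. g (V (snd p) (fst p)) * \<psi> p)"
      unfolding set_borel_measurable_def by measurable
    show "AE q in lborel. q \<in> strip T \<longrightarrow> norm (g (V (snd q) (fst q)) * \<psi> q)
        \<le> norm (\<bar>D\<bar> * (\<alpha> * \<bar>indicator K (fst q) * V (snd q) (fst q)\<bar> + \<beta> * indicator K (fst q)))"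
    proof (intro AE_I2 impI)
      fix q assume "q \<in> strip T"
      then have t: "snd q \<in> {0..T}" by (auto simp: strip_def)
      show "norm (g (V (snd q) (fst q)) * \<psi> q)
        \<le> norm (\<bar>D\<bar> * (\<alpha> * \<bar>indicator K (fst q) * V (snd q) (fst q)\<bar> + \<beta> * indicator K (fst q)))"
      proof (cases "fst q \<in> K")
        case True
        let ?v = "V (snd q) (fst q)"
        have "\<bar>g ?v\<bar> * \<bar>\<psi> q\<bar> \<le> (\<alpha> * \<bar>?v\<bar> + \<beta>) * \<bar>D\<bar>"
          using b[OF t, of "fst q"] gb[of ?v] order_trans[OF abs_ge_zero gb[of ?v]]
          by (intro mult_mono) auto
        also have "\<dots> \<le> \<bar>(\<alpha> * \<bar>?v\<bar> + \<beta>) * \<bar>D\<bar>\<bar>" by (rule abs_ge_self)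
        finally show ?thesis using True by (simp add: abs_mult mult.commute)
      qed (use z[OF t, of "fst q"] in simp)
    qed
  qed
qed

section \<open>Integral inequalities for the regular part\<close>

text \<open>
  The bound \<open>B\<close> for the flux makes all entropy fluxes bounded, so that integrability questions concern
  the entropies alone.
\<close>

locale measure_solution =
  fixes H :: "real \<Rightarrow> real" and u0 :: "real set \<Rightarrow> real"
    and u :: "real \<Rightarrow> real set \<Rightarrow> real" and ur :: "real \<Rightarrow> real \<Rightarrow> real"
    and p :: nat and x c :: "nat \<Rightarrow> real" and B :: real
  assumes H_cont: "continuous_on UNIV H" and H_bound: "\<And>\<xi>. \<bar>H \<xi>\<bar> \<le> B"
    and u0: "signed_radon_on UNIV u0" and inj: "inj_on x {1..p}"
    and atoms: "\<And>K. compact K \<Longrightarrow> sing_part u0 K = (\<Sum>i=1..p. c i * indicator K (x i))"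
    and curve: "continuous_measure_curve u"
    and sol: "global_entropy_solution H u0 u ur"
begin

definition total_mass :: real where
  "total_mass = (\<Sum>i=1..p. \<bar>c i\<bar>)"

lemma H_borel [measurable]: "H \<in> borel_measurable borel"
  by (rule borel_measurable_continuous_onI[OF H_cont])

lemma entropy: "0 < T \<Longrightarrow> entropy_solution H u0 T u ur"
  using sol by (simp add: global_entropy_solution_def)

lemma regular: "0 < T \<Longrightarrow> is_regular_part T u ur"
  using entropy by (simp add: entropy_solution_def)

lemma ur_borel [measurable]: "(\<lambda>p. ur (snd p) (fst p)) \<in> borel_measurable borel"
  using regular[of 1] by (simp add: is_regular_part_def case_prod_unfold)

lemmas initial_parts = decomposition_parts[OF u0]

lemma ur_integrable:
  assumes "0 < T" "compact K"
  shows "set_integrable lborel (strip T) (\<lambda>p. indicator K (fst p) * ur (snd p) (fst p))"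
  using regular_part_locally_integrable[OF curve regular[OF assms(1)] assms(2)]
  by (simp add: case_prod_unfold)

lemma integrable_initial_growth:
  fixes g \<phi> :: "real \<Rightarrow> real"
  assumes g[measurable]: "g \<in> borel_measurable borel"
    and gb: "\<And>\<xi>. \<bar>g \<xi>\<bar> \<le> \<alpha> * \<bar>\<xi>\<bar> + \<beta>"
    and \<phi>[measurable]: "\<phi> \<in> borel_measurable borel" and K: "compact K"
    and b: "\<And>x. \<bar>\<phi> x\<bar> \<le> D" and z: "\<And>x. x \<notin> K \<Longrightarrow> \<phi> x = 0"
  shows "integrable lborel (\<lambda>x. g (ac_density u0 x) * \<phi> x)"
proof (rule Bochner_Integration.integrable_bound)
  let ?r = "ac_density u0"
  have [measurable]: "?r \<in> borel_measurable borel" by (rule lebesgue_decompositionD(1)[OF initial_parts])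
  have D: "0 \<le> D" using b[of 0] by linarith
  have "integrable lborel (\<lambda>x. indicat_real K x)"
    using borel_compact[OF K] emeasure_bounded_finite[OF compact_imp_bounded[OF K]] by simp
  then show "integrable lborel (\<lambda>x. D * (\<alpha> * \<bar>indicator K x *\<^sub>R ?r x\<bar> + \<beta> * indicator K x))"
    using lebesgue_decompositionD(3)[OF initial_parts K] unfolding set_integrable_def
    by (intro integrable_mult_right Bochner_Integration.integrable_add integrable_abs)
  show "(\<lambda>x. g (?r x) * \<phi> x) \<in> borel_measurable lborel" by measurable
  show "AE x in lborel. norm (g (?r x) * \<phi> x) \<le> norm (D * (\<alpha> * \<bar>indicator K x *\<^sub>R ?r x\<bar> + \<beta> * indicator K x))"
  proof (rule AE_I2)
    fix x
    show "norm (g (?r x) * \<phi> x) \<le> norm (D * (\<alpha> * \<bar>indicator K x *\<^sub>R ?r x\<bar> + \<beta> * indicator K x))"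
    proof (cases "x \<in> K")
      case True
      have "\<bar>g (?r x)\<bar> * \<bar>\<phi> x\<bar> \<le> (\<alpha> * \<bar>?r x\<bar> + \<beta>) * D"
        using b gb order_trans[OF abs_ge_zero gb[of "?r x"]] by (intro mult_mono) auto
      also have "\<dots> \<le> \<bar>(\<alpha> * \<bar>?r x\<bar> + \<beta>) * D\<bar>" by (rule abs_ge_self)
      finally show ?thesis using True by (simp add: abs_mult mult.commute)
    qed (use z in simp)
  qed
qed

text \<open>
  The entropy and weak formulations are used with entropy and flux shifted by constants that depend
  on the purpose: to make the integrands small for large \<open>k\<close>, or to combine \<open>\<bar>u - k\<bar>\<close> with \<open>\<plusminus>(u - k)\<close>.
\<close>

lemma subtract_constant:
  fixes g\<^sub>1 g\<^sub>2 :: "real \<Rightarrow> real"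
  assumes T: "0 < T" and Z: "smooth_test T Z Zt Zx"
    and g: "g\<^sub>1 \<in> borel_measurable borel" "g\<^sub>2 \<in> borel_measurable borel"
    and gb: "\<And>\<xi>. \<bar>g\<^sub>1 \<xi>\<bar> \<le> \<alpha> * \<bar>\<xi>\<bar> + \<beta>" "\<And>\<xi>. \<bar>g\<^sub>2 \<xi>\<bar> \<le> \<gamma> * \<bar>\<xi>\<bar> + \<delta>"
  shows "set_integrable lborel (strip T) (\<lambda>(x, t). (g\<^sub>1 (ur t x) - m) * Zt t x + (g\<^sub>2 (ur t x) - q) * Zx t x)"
    and "(LINT (x, t):strip T|lborel. (g\<^sub>1 (ur t x) - m) * Zt t x + (g\<^sub>2 (ur t x) - q) * Zx t x)
      = (LINT (x, t):strip T|lborel. g\<^sub>1 (ur t x) * Zt t x + g\<^sub>2 (ur t x) * Zx t x) + m * (LINT x|lborel. Z 0 x)"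
    and "integrable lborel (\<lambda>x. (g\<^sub>1 (ac_density u0 x) - m) * Z 0 x)"
    and "(LINT x|lborel. (g\<^sub>1 (ac_density u0 x) - m) * Z 0 x)
      = (LINT x|lborel. g\<^sub>1 (ac_density u0 x) * Z 0 x) - m * (LINT x|lborel. Z 0 x)"
proof -
  obtain K D where K: "compact K" "0 \<le> D"
    and B: "\<forall>t\<in>{0..T}. \<forall>x. \<bar>Z t x\<bar> \<le> D \<and> \<bar>Zt t x\<bar> \<le> D \<and> \<bar>Zx t x\<bar> \<le> D"
    and z: "\<forall>t\<in>{0..T}. \<forall>x. x \<notin> K \<longrightarrow> Z t x = 0 \<and> Zt t x = 0 \<and> Zx t x = 0"
    and m: "(\<lambda>(x, t). Z t x) \<in> borel_measurable borel" "(\<lambda>(x, t). Zt t x) \<in> borel_measurable borel"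
    "(\<lambda>(x, t). Zx t x) \<in> borel_measurable borel"
    by (rule smooth_test_bounded[OF Z])
  have I: "set_integrable lborel (strip T) (\<lambda>p. g (ur (snd p) (fst p)) * Zt (snd p) (fst p))"
    "set_integrable lborel (strip T) (\<lambda>p. g (ur (snd p) (fst p)) * Zx (snd p) (fst p))"
    if "g \<in> borel_measurable borel" "\<And>\<xi>. \<bar>g \<xi>\<bar> \<le> \<alpha> * \<bar>\<xi>\<bar> + \<beta>" for g \<alpha> \<beta>
    using set_integrable_growth[OF ur_borel ur_integrable[OF T K(1)] that m(2) K(1), of D]
      set_integrable_growth[OF ur_borel ur_integrable[OF T K(1)] that m(3) K(1), of D] B z
    by (simp_all add: case_prod_unfold)
  note I1 = I(1)[OF g(1) gb(1)] note I2 = I(2)[OF g(2) gb(2)]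
  have C: "set_integrable lborel (strip T) (\<lambda>p. a * Zt (snd p) (fst p))"
    "set_integrable lborel (strip T) (\<lambda>p. a * Zx (snd p) (fst p))" for a
    using I(1)[of "\<lambda>_. a" 0 "\<bar>a\<bar>"] I(2)[of "\<lambda>_. a" 0 "\<bar>a\<bar>"] by simp_all
  note st = smooth_test_integrals[OF Z T]
  have split: "(\<lambda>(x, t). (g\<^sub>1 (ur t x) - m) * Zt t x + (g\<^sub>2 (ur t x) - q) * Zx t x) =
    (\<lambda>p. (g\<^sub>1 (ur (snd p) (fst p)) * Zt (snd p) (fst p) + g\<^sub>2 (ur (snd p) (fst p)) * Zx (snd p) (fst p))
       - (m * Zt (snd p) (fst p) + q * Zx (snd p) (fst p)))"
    by (auto simp: fun_eq_iff algebra_simps)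
  note a = set_integral_add[OF I1 I2] note b = set_integral_add[OF C(1)[of m] C(2)[of q]]
  show "set_integrable lborel (strip T) (\<lambda>(x, t). (g\<^sub>1 (ur t x) - m) * Zt t x + (g\<^sub>2 (ur t x) - q) * Zx t x)"
    unfolding split by (rule set_integral_diff(1)[OF a(1) b(1)])
  show "(LINT (x, t):strip T|lborel. (g\<^sub>1 (ur t x) - m) * Zt t x + (g\<^sub>2 (ur t x) - q) * Zx t x)
      = (LINT (x, t):strip T|lborel. g\<^sub>1 (ur t x) * Zt t x + g\<^sub>2 (ur t x) * Zx t x) + m * (LINT x|lborel. Z 0 x)"
    unfolding split set_integral_diff(2)[OF a(1) b(1)] b(2)
    using st(1,2) by (simp add: case_prod_unfold)
  have zm: "Z 0 \<in> borel_measurable borel"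
    using borel_measurable_integrable[OF st(3)] by simp
  have J: "integrable lborel (\<lambda>x. g\<^sub>1 (ac_density u0 x) * Z 0 x)"
    by (rule integrable_initial_growth[OF g(1) gb(1) zm K(1), of D]) (use B z T in auto)
  have e: "(\<lambda>x. (g\<^sub>1 (ac_density u0 x) - m) * Z 0 x) = (\<lambda>x. g\<^sub>1 (ac_density u0 x) * Z 0 x - m * Z 0 x)"
    by (simp add: algebra_simps)
  show "integrable lborel (\<lambda>x. (g\<^sub>1 (ac_density u0 x) - m) * Z 0 x)"
    "(LINT x|lborel. (g\<^sub>1 (ac_density u0 x) - m) * Z 0 x)
      = (LINT x|lborel. g\<^sub>1 (ac_density u0 x) * Z 0 x) - m * (LINT x|lborel. Z 0 x)"
    unfolding e using J st(3) by auto
qed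

abbreviation singular_time_integral :: "real \<Rightarrow> (real \<Rightarrow> real \<Rightarrow> real) \<Rightarrow> real" where
  "singular_time_integral T \<psi> \<equiv> (LINT t:{0<..<T}|lebesgue. LINT x|tot_var UNIV (sing_part (u t)). \<psi> t x)"

lemma flux_growth:
  "\<bar>\<bar>\<xi> - k\<bar>\<bar> \<le> 1 * \<bar>\<xi>\<bar> + \<bar>k\<bar>" "\<bar>\<xi> - k\<bar> \<le> 1 * \<bar>\<xi>\<bar> + \<bar>k\<bar>"
  "\<bar>sgn (\<xi> - k) * (H \<xi> - H k)\<bar> \<le> 0 * \<bar>\<xi>\<bar> + 2 * B" "\<bar>H \<xi> - H k\<bar> \<le> 0 * \<bar>\<xi>\<bar> + 2 * B"
proof -
  show "\<bar>\<bar>\<xi> - k\<bar>\<bar> \<le> 1 * \<bar>\<xi>\<bar> + \<bar>k\<bar>" "\<bar>\<xi> - k\<bar> \<le> 1 * \<bar>\<xi>\<bar> + \<bar>k\<bar>" by auto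
  show h: "\<bar>H \<xi> - H k\<bar> \<le> 0 * \<bar>\<xi>\<bar> + 2 * B" using H_bound[of \<xi>] H_bound[of k] by auto
  then show "\<bar>sgn (\<xi> - k) * (H \<xi> - H k)\<bar> \<le> 0 * \<bar>\<xi>\<bar> + 2 * B"
    using order_trans[OF abs_ge_zero h] by (auto simp: sgn_real_def)
qed

lemma entropy_inequality:
  assumes T: "0 < T" and Z: "smooth_test T Z Zt Zx" and nn: "\<forall>t\<in>{0..T}. \<forall>x. 0 \<le> Z t x"
  shows "(LINT (x, t):strip T|lborel. (\<bar>ur t x - k\<bar> - m) * Zt t x + (sgn (ur t x - k) * (H (ur t x) - H k) - q) * Zx t x)
      + singular_time_integral T Zt
    \<ge> - (LINT x|lborel. (\<bar>ac_density u0 x - k\<bar> - m) * Z 0 x) - (\<Sum>i=1..p. \<bar>c i\<bar> * Z 0 (x i))"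
proof -
  have ZT: "\<forall>x. Z T x = 0" using Z by (simp add: smooth_test_def)
  have zm: "Z 0 \<in> borel_measurable borel"
    using borel_measurable_integrable[OF smooth_test_integrals(3)[OF Z T]] by simp
  note e = entropy[OF T, unfolded entropy_solution_def, THEN conjunct2, THEN conjunct2, THEN conjunct2,
      rule_format, of Z Zt Zx k]
  have "(LINT (x, t):strip T|lborel. \<bar>ur t x - k\<bar> * Zt t x + sgn (ur t x - k) * (H (ur t x) - H k) * Zx t x)
      + singular_time_integral T Zt
    \<ge> - (LINT x|lborel. \<bar>ac_density u0 x - k\<bar> * Z 0 x) - (\<Sum>i=1..p. \<bar>c i\<bar> * Z 0 (x i))"
    using e smooth_test_C1_C1c[OF Z] ZT nn tot_var_atoms[OF inj atoms zm] by simp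
  moreover have m: "(\<lambda>\<xi>. \<bar>\<xi> - k\<bar>) \<in> borel_measurable borel"
    "(\<lambda>\<xi>. sgn (\<xi> - k) * (H \<xi> - H k)) \<in> borel_measurable borel"
    by measurable
  note sc = subtract_constant(2,4)[OF T Z m flux_growth(1,3), where m = m]
  show ?thesis
    unfolding sc using calculation by simp
qed

lemma weak_equation:
  assumes T: "0 < T" and Z: "smooth_test T Z Zt Zx"
  shows "(LINT (x, t):strip T|lborel. (ur t x - k) * Zt t x + (H (ur t x) - H k) * Zx t x)
      + (LINT t:{0<..<T}|lebesgue. pairing (sing_part (u t)) (Zt t))
    = - (LINT x|lborel. (ac_density u0 x - k) * Z 0 x) - pairing (sing_part u0) (Z 0)"
proof -
  have ZT: "\<forall>x. Z T x = 0" using Z by (simp add: smooth_test_def)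
  obtain K D where K: "compact K" "0 \<le> D"
    and B: "\<forall>t\<in>{0..T}. \<forall>x. \<bar>Z t x\<bar> \<le> D \<and> \<bar>Zt t x\<bar> \<le> D \<and> \<bar>Zx t x\<bar> \<le> D"
    and z: "\<forall>t\<in>{0..T}. \<forall>x. x \<notin> K \<longrightarrow> Z t x = 0 \<and> Zt t x = 0 \<and> Zx t x = 0"
    and m: "(\<lambda>(x, t). Z t x) \<in> borel_measurable borel" "(\<lambda>(x, t). Zt t x) \<in> borel_measurable borel"
    "(\<lambda>(x, t). Zx t x) \<in> borel_measurable borel"
    by (rule smooth_test_bounded[OF Z])
  have zm: "Z 0 \<in> borel_measurable borel"
    using borel_measurable_integrable[OF smooth_test_integrals(3)[OF Z T]] by simp
  note e = entropy[OF T, unfolded entropy_solution_def, THEN conjunct2, THEN conjunct2, THEN conjunct1,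
      rule_format, of Z Zt Zx]
  have p: "pairing u0 (Z 0) = (LINT x|lborel. ac_density u0 x * Z 0 x) + pairing (sing_part u0) (Z 0)"
    by (rule pairing_decomposition[OF initial_parts zm _ K(1), of D]) (use B z T in auto)
  have m: "(\<lambda>\<xi>::real. \<xi>) \<in> borel_measurable borel" by simp
  have g1: "\<bar>\<xi>\<bar> \<le> 1 * \<bar>\<xi>\<bar> + 0" "\<bar>H \<xi>\<bar> \<le> 0 * \<bar>\<xi>\<bar> + B" for \<xi> using H_bound by auto
  note sc = subtract_constant(2)[OF T Z m H_borel g1, where m = k and q = "H k"]
    subtract_constant(4)[OF T Z m H_borel g1, where m = k]
  show ?thesis unfolding sc using e smooth_test_C1_C1c[OF Z] ZT p by simp
qed


text \<open>
  The sum of the entropies for \<open>k = n\<close> and \<open>k = - n\<close>, less the constant \<open>2 n\<close>, is \<open>2 (\<bar>u\<bar> - n)\<^sup>+\<close>, and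
  the corresponding flux, less a constant, vanishes for \<open>\<bar>u\<bar> < n\<close>. As \<open>n \<rightarrow> \<infinity>\<close> all terms with \<open>u\<^sub>r\<close>
  tend to \<open>0\<close> by dominated convergence, and only the singular terms remain.
\<close>

lemma singular_variation_bound:
  assumes T: "0 < T" and Z: "smooth_test T Z Zt Zx" and nn: "\<forall>t\<in>{0..T}. \<forall>x. 0 \<le> Z t x"
  shows "singular_time_integral T Zt \<ge> - (\<Sum>i=1..p. \<bar>c i\<bar> * Z 0 (x i))"
proof -
  let ?r = "ac_density u0"
  let ?A = "\<Sum>i=1..p. \<bar>c i\<bar> * Z 0 (x i)"
  let ?S = "singular_time_integral T Zt"
  obtain K D where K: "compact K" "0 \<le> D"
    and B: "\<forall>t\<in>{0..T}. \<forall>x. \<bar>Z t x\<bar> \<le> D \<and> \<bar>Zt t x\<bar> \<le> D \<and> \<bar>Zx t x\<bar> \<le> D"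
    and z: "\<forall>t\<in>{0..T}. \<forall>x. x \<notin> K \<longrightarrow> Z t x = 0 \<and> Zt t x = 0 \<and> Zx t x = 0"
    and zm: "(\<lambda>(x, t). Z t x) \<in> borel_measurable borel" "(\<lambda>(x, t). Zt t x) \<in> borel_measurable borel"
    "(\<lambda>(x, t). Zx t x) \<in> borel_measurable borel"
    by (rule smooth_test_bounded[OF Z])
  have [measurable]: "(\<lambda>p. Zt (snd p) (fst p)) \<in> borel_measurable borel"
    "(\<lambda>p. Zx (snd p) (fst p)) \<in> borel_measurable borel"
    using zm by (simp_all add: case_prod_unfold)
  have [measurable]: "?r \<in> borel_measurable borel" by (rule lebesgue_decompositionD(1)[OF initial_parts])
  have z0[measurable]: "Z 0 \<in> borel_measurable borel"
    using borel_measurable_integrable[OF smooth_test_integrals(3)[OF Z T]] by simp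
  have Km: "(\<lambda>p::real \<times> real. indicat_real K (fst p)) \<in> borel_measurable borel"
    by (intro measurable_compose[OF _ borel_measurable_indicator[OF borel_compact[OF K(1)]]]
        borel_measurable_continuous_onI continuous_on_fst continuous_on_id)
  define e where "e n \<xi> = \<bar>\<xi> - real n\<bar> + \<bar>\<xi> + real n\<bar> - 2 * real n" for n \<xi>
  define q where "q n \<xi> = sgn (\<xi> - real n) * (H \<xi> - H (real n)) + sgn (\<xi> + real n) * (H \<xi> - H (- real n))
      - (H (real n) - H (- real n))" for n \<xi>
  have e0: "e n \<xi> = 0 \<and> q n \<xi> = 0" if "\<bar>\<xi>\<bar> < real n" for n \<xi>
  proof -
    have "\<xi> - real n < 0" "0 < \<xi> + real n" using that by linarith+
    then show ?thesis by (simp add: e_def q_def)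
  qed
  have eb: "\<bar>e n \<xi>\<bar> \<le> 2 * \<bar>\<xi>\<bar>" for n \<xi> unfolding e_def by linarith
  have qb: "\<bar>q n \<xi>\<bar> \<le> 6 * B" for n \<xi>
    using flux_growth(3)[of \<xi> "real n"] flux_growth(3)[of \<xi> "- real n"]
      H_bound[of "real n"] H_bound[of "- real n"] unfolding q_def by simp
  have ev: "\<forall>\<^sub>F n in sequentially. e n \<xi> = 0 \<and> q n \<xi> = 0" for \<xi>
  proof -
    obtain N :: nat where "\<bar>\<xi>\<bar> < real N" using reals_Archimedean2 by blast
    then have "\<bar>\<xi>\<bar> < real n" if "N \<le> n" for n using that by (meson less_le_trans of_nat_le_iff)
    then show ?thesis using e0 by (auto simp: eventually_sequentially)
  qed
  have [measurable]: "e n \<in> borel_measurable borel" "q n \<in> borel_measurable borel" for n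
    unfolding e_def[abs_def] q_def[abs_def] by measurable
  let ?f = "\<lambda>n p. e n (ur (snd p) (fst p)) * Zt (snd p) (fst p) + q n (ur (snd p) (fst p)) * Zx (snd p) (fst p)"
  let ?a = "\<lambda>n. LINT p:strip T|lborel. ?f n p"
  let ?b = "\<lambda>n. LINT x|lborel. e n (?r x) * Z 0 x"
  have main: "?a n + 2 * ?S \<ge> - ?b n - 2 * ?A" for n
  proof -
    have m: "(\<lambda>\<xi>. \<bar>\<xi> - k\<bar>) \<in> borel_measurable borel"
      "(\<lambda>\<xi>. sgn (\<xi> - k) * (H \<xi> - H k)) \<in> borel_measurable borel" for k
      by measurable
    note E = entropy_inequality[OF T Z nn, where m = "real n"]
    note sc = subtract_constant(1,3)[OF T Z m flux_growth(1,3), where m = "real n"]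
    let ?g = "\<lambda>k c p. (\<bar>ur (snd p) (fst p) - k\<bar> - real n) * Zt (snd p) (fst p)
      + (sgn (ur (snd p) (fst p) - k) * (H (ur (snd p) (fst p)) - H k) - c) * Zx (snd p) (fst p)"
    have i: "set_integrable lborel (strip T) (?g (real n) (H (real n)))"
      "set_integrable lborel (strip T) (?g (- real n) (- H (- real n)))"
      using sc(1) by (simp_all only: case_prod_unfold)
    have f: "?f n = (\<lambda>p. ?g (real n) (H (real n)) p + ?g (- real n) (- H (- real n)) p)"
      by (auto simp: fun_eq_iff e_def q_def algebra_simps)
    have "?a n = (LINT p:strip T|lborel. ?g (real n) (H (real n)) p) + (LINT p:strip T|lborel. ?g (- real n) (- H (- real n)) p)"
      unfolding f by (rule set_integral_add(2)[OF i])
    moreover have "?b n = (LINT x|lborel. (\<bar>?r x - real n\<bar> - real n) * Z 0 x)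
        + (LINT x|lborel. (\<bar>?r x - (- real n)\<bar> - real n) * Z 0 x)"
      unfolding Bochner_Integration.integral_add[OF sc(2) sc(2), symmetric]
      by (auto simp: e_def algebra_simps)
    ultimately show ?thesis
      using E[of "real n" "H (real n)"] E[of "- real n" "- H (- real n)"]
      by (simp only: case_prod_unfold)
  qed
  have "?a \<longlonglongrightarrow> (LINT p|(lborel :: (real \<times> real) measure). 0)"
    unfolding set_lebesgue_integral_def
  proof (rule integral_dominated_convergence)
    let ?w = "\<lambda>p. indicator (strip T) p *\<^sub>R (D * (2 * \<bar>indicator K (fst p) * ur (snd p) (fst p)\<bar> + 6 * B * indicator K (fst p)))"
    have "set_integrable lborel (strip T) (\<lambda>p. indicator K (fst p) * ur (snd p) (fst p))"
      by (rule ur_integrable[OF T K(1)])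
    moreover have "set_integrable lborel (strip T) (\<lambda>p. indicat_real K (fst p))"
      by (rule set_integrable_strip[OF Km K(1), where B = 1]) (auto simp: indicator_def)
    ultimately show "integrable lborel ?w"
      unfolding set_integrable_def[symmetric]
      by (intro set_integrable_mult_right set_integral_add set_integrable_abs)
    show "(\<lambda>p. indicator (strip T) p *\<^sub>R ?f n p) \<in> borel_measurable lborel" for n by measurable
    show "AE p in lborel. (\<lambda>n. indicator (strip T) p *\<^sub>R ?f n p) \<longlonglongrightarrow> 0"
    proof (rule AE_I2)
      fix p :: "real \<times> real"
      show "(\<lambda>n. indicator (strip T) p *\<^sub>R ?f n p) \<longlonglongrightarrow> 0"
        by (rule tendsto_eventually, use ev[of "ur (snd p) (fst p)"] in eventually_elim) simp
    qed
    show "AE p in lborel. norm (indicator (strip T) p *\<^sub>R ?f n p) \<le> ?w p" for n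
    proof (rule AE_I2)
      fix p :: "real \<times> real"
      show "norm (indicator (strip T) p *\<^sub>R ?f n p) \<le> ?w p"
      proof (cases "p \<in> strip T")
        case True
        then have t: "snd p \<in> {0..T}" by (auto simp: strip_def)
        show ?thesis
        proof (cases "fst p \<in> K")
          case True
          let ?v = "ur (snd p) (fst p)"
          have zb: "\<bar>Zt (snd p) (fst p)\<bar> \<le> D" "\<bar>Zx (snd p) (fst p)\<bar> \<le> D" using B t by auto
          have "\<bar>?f n p\<bar> \<le> \<bar>e n ?v\<bar> * \<bar>Zt (snd p) (fst p)\<bar> + \<bar>q n ?v\<bar> * \<bar>Zx (snd p) (fst p)\<bar>"
            by (rule order_trans[OF abs_triangle_ineq]) (simp add: abs_mult)
          also have "\<dots> \<le> (2 * \<bar>?v\<bar>) * D + (6 * B) * D"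
            using eb qb zb order_trans[OF abs_ge_zero qb] by (intro add_mono mult_mono) auto
          finally show ?thesis using True \<open>p \<in> strip T\<close> by (simp add: algebra_simps)
        qed (use z t in simp)
      qed simp
    qed
  qed simp
  then have a: "?a \<longlonglongrightarrow> 0" by simp
  have "?b \<longlonglongrightarrow> (LINT x|(lborel :: real measure). 0)"
  proof (rule integral_dominated_convergence)
    have "integrable lborel (\<lambda>x. (2 * \<bar>?r x\<bar>) * Z 0 x)"
      by (rule integrable_initial_growth[OF _ _ z0 K(1), of "\<lambda>\<xi>. 2 * \<bar>\<xi>\<bar>" 2 0 D]) (use B z T in auto)
    from integrable_abs[OF this] show "integrable lborel (\<lambda>x. \<bar>2 * \<bar>?r x\<bar> * Z 0 x\<bar>)" .
    show "AE x in lborel. (\<lambda>n. e n (?r x) * Z 0 x) \<longlonglongrightarrow> 0"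
    proof (rule AE_I2)
      fix x
      show "(\<lambda>n. e n (?r x) * Z 0 x) \<longlonglongrightarrow> 0"
        by (rule tendsto_eventually, use ev[of "?r x"] in eventually_elim) simp
    qed
    show "AE x in lborel. norm (e n (?r x) * Z 0 x) \<le> \<bar>2 * \<bar>?r x\<bar> * Z 0 x\<bar>" for n
      using eb by (intro AE_I2) (auto simp: abs_mult intro!: mult_right_mono)
  qed measurable
  then have b: "?b \<longlonglongrightarrow> 0" by simp
  have "0 + 2 * ?S \<ge> - 0 - 2 * ?A"
    by (rule LIMSEQ_le[OF tendsto_diff[OF tendsto_minus[OF b] tendsto_const] tendsto_add[OF a tendsto_const]])
      (use main in auto)
  then show ?thesis by simp
qed

text \<open>
  In the weak equation the singular term is at most the time integral of the total variation of
  \<open>u\<^sub>s(t)\<close>, tested with the bump and \<open>- b'\<close>. With the nonincreasing majorant \<open>b\<close> as the time factor of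
  the test function, \<open>singular_variation_bound\<close> estimates it by the initial mass. The bound does not
  depend on \<open>\<epsilon>\<close>, so no point mass of \<open>u\<^sub>s(t)\<close> has to be identified.
\<close>

lemma flux_through_bump:
  assumes T: "0 < T" and e: "0 < \<epsilon>"
    and \<beta>: "\<And>t. (\<beta> has_real_derivative \<beta>' t) (at t)" "continuous_on UNIV \<beta>'" "\<beta> 0 = 0" "\<beta> T = 0"
    and b: "\<And>t. (b has_real_derivative b' t) (at t)" "continuous_on UNIV b'" "b T = 0"
    and le: "\<And>t. t \<in> {0..T} \<Longrightarrow> \<bar>\<beta>' t\<bar> \<le> - b' t" and nn: "\<And>t. t \<in> {0..T} \<Longrightarrow> 0 \<le> b t"
  shows "\<bar>LINT (x, t):strip T|lborel. ur t x * (bump a \<epsilon> x * \<beta>' t)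
      + (H (ur t x) - q) * ((kern \<epsilon> (a - x) - kern \<epsilon> (x - a)) * \<beta> t)\<bar> \<le> total_mass * b 0"
proof -
  let ?Z = "\<lambda>t x. bump a \<epsilon> x * \<beta> t" and ?Zt = "\<lambda>t x. bump a \<epsilon> x * \<beta>' t"
  let ?Zx = "\<lambda>t x. (kern \<epsilon> (a - x) - kern \<epsilon> (x - a)) * \<beta> t"
  note Z = smooth_test_product[OF e \<beta>(1,2,4), of a]
  note Y = smooth_test_product[OF e b, of a]
  let ?P = "LINT t:{0<..<T}|lebesgue. pairing (sing_part (u t)) (?Zt t)"
  have "(LINT (x, t):strip T|lborel. (ur t x - 0) * ?Zt t x + (H (ur t x) - H 0) * ?Zx t x) + ?P
      = - (LINT x|lborel. (ac_density u0 x - 0) * ?Z 0 x) - pairing (sing_part u0) (?Z 0)"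
    by (rule weak_equation[OF T Z])
  moreover have "pairing (sing_part u0) (\<lambda>x. 0) = 0"
    by (simp add: pairing_def split: prod.split)
  ultimately have 1: "(LINT (x, t):strip T|lborel. (ur t x - 0) * ?Zt t x + (H (ur t x) - H 0) * ?Zx t x) = - ?P"
    using \<beta>(3) by simp
  have m: "(\<lambda>\<xi>::real. \<xi>) \<in> borel_measurable borel" by simp
  have g1: "\<bar>\<xi>\<bar> \<le> 1 * \<bar>\<xi>\<bar> + 0" "\<bar>H \<xi>\<bar> \<le> 0 * \<bar>\<xi>\<bar> + B" for \<xi> using H_bound by auto
  note sc = subtract_constant(2)[OF T Z m H_borel g1, where m = 0]
  have 2: "(LINT (x, t):strip T|lborel. ur t x * ?Zt t x + (H (ur t x) - q) * ?Zx t x) = - ?P"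
    using 1 sc[of q] sc[of "H 0"] by simp
  have c: "continuous_on UNIV (\<lambda>(t, x). bump a \<epsilon> x * (- b' t))"
  proof -
    have "continuous_on UNIV (\<lambda>(t, x). bump a \<epsilon> x * b' t)"
      using Y unfolding smooth_test_def by blast
    from continuous_on_minus[OF this] show ?thesis by (simp add: case_prod_unfold)
  qed
  have "\<bar>?P\<bar> \<le> singular_time_integral T (\<lambda>t x. bump a \<epsilon> x * (- b' t))"
  proof (rule pairing_singular_time_bound[OF curve c, of "{a - \<epsilon>..a + \<epsilon>}"])
    show "bump a \<epsilon> x * - b' t = 0" if "x \<notin> {a - \<epsilon>..a + \<epsilon>}" for t x
      using that e bump_eq_0[OF e, of x a] by auto
    show "\<bar>bump a \<epsilon> x * \<beta>' t\<bar> \<le> bump a \<epsilon> x * - b' t" if "t \<in> {0..T}" for t x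
      using mult_left_mono[OF le[OF that] bump_bounds(1)[OF e, of a x]] bump_bounds(1)[OF e, of a x]
      by (simp add: abs_mult)
  qed simp
  also have "\<dots> = - singular_time_integral T (\<lambda>t x. bump a \<epsilon> x * b' t)"
    by (simp add: set_lebesgue_integral_def)
  also have "\<dots> \<le> (\<Sum>i=1..p. \<bar>c i\<bar> * (bump a \<epsilon> (x i) * b 0))"
    using singular_variation_bound[OF T Y] nn bump_bounds[OF e] by simp
  also have "\<dots> \<le> (\<Sum>i=1..p. \<bar>c i\<bar> * (1 * b 0))"
    using nn[of 0] T bump_bounds[OF e] by (intro sum_mono mult_left_mono mult_right_mono) auto
  finally have "\<bar>?P\<bar> \<le> total_mass * b 0"
    by (simp add: total_mass_def sum_distrib_right)
  then show ?thesis unfolding 2 by simp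
qed

text \<open>
  Half the sum of the entropy inequality for \<open>\<bar>u - k\<bar>\<close> and \<open>\<sigma>\<close> times the weak equation. The singular terms
  are \<open>\<bar>u\<^sub>s\<bar> + \<sigma> u\<^sub>s \<ge> 0\<close>, tested with \<open>\<zeta>\<^sub>t \<le> 0\<close>, and may be dropped.
\<close>

lemma truncated_entropy_inequality:
  assumes T: "0 < T" and Z: "smooth_test T Z Zt Zx" and nn: "\<forall>t\<in>{0..T}. \<forall>x. 0 \<le> Z t x"
    and np: "\<forall>t\<in>{0..T}. \<forall>x. Zt t x \<le> 0" and \<sigma>: "\<sigma> = 1 \<or> \<sigma> = -1"
  shows "(LINT (x, t):strip T|lborel. max 0 (\<sigma> * (ur t x - k)) * Zt t x
      + (if 0 < \<sigma> * (ur t x - k) then \<sigma> * (H (ur t x) - H k) else 0) * Zx t x)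
    \<ge> - (LINT x|lborel. max 0 (\<sigma> * (ac_density u0 x - k)) * Z 0 x) - (\<Sum>i=1..p. \<bar>c i\<bar> * Z 0 (x i))"
proof -
  let ?r = "ac_density u0"
  let ?A = "\<Sum>i=1..p. \<bar>c i\<bar> * Z 0 (x i)"
  let ?S = "singular_time_integral T Zt"
  let ?P = "LINT t:{0<..<T}|lebesgue. pairing (sing_part (u t)) (Zt t)"
  obtain K D where K: "compact K" "0 \<le> D"
    and B: "\<forall>t\<in>{0..T}. \<forall>x. \<bar>Z t x\<bar> \<le> D \<and> \<bar>Zt t x\<bar> \<le> D \<and> \<bar>Zx t x\<bar> \<le> D"
    and z: "\<forall>t\<in>{0..T}. \<forall>x. x \<notin> K \<longrightarrow> Z t x = 0 \<and> Zt t x = 0 \<and> Zx t x = 0"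
    and zm: "(\<lambda>(x, t). Z t x) \<in> borel_measurable borel" "(\<lambda>(x, t). Zt t x) \<in> borel_measurable borel"
    "(\<lambda>(x, t). Zx t x) \<in> borel_measurable borel"
    by (rule smooth_test_bounded[OF Z])
  have z0: "Z 0 \<in> borel_measurable borel"
    using borel_measurable_integrable[OF smooth_test_integrals(3)[OF Z T]] by simp
  have c: "continuous_on UNIV (\<lambda>(t, x). - Zt t x)"
  proof -
    have "continuous_on UNIV (\<lambda>(t, x). Zt t x)" using Z unfolding smooth_test_def by blast
    from continuous_on_minus[OF this] show ?thesis by (simp add: case_prod_unfold)
  qed
  have "\<bar>?P\<bar> \<le> singular_time_integral T (\<lambda>t x. - Zt t x)"
    by (rule pairing_singular_time_bound[OF curve c K(1)]) (use z np in auto)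
  also have "\<dots> = - ?S" by (simp add: set_lebesgue_integral_def)
  finally have PS: "?S + \<sigma> * ?P \<le> 0" using \<sigma> by auto
  have "\<bar>pairing (sing_part u0) (Z 0)\<bar> \<le> (LINT x|tot_var UNIV (sing_part u0). Z 0 x)"
    by (rule abs_pairing_le[OF lebesgue_decompositionD(2)[OF initial_parts] z0 _ K(1), of D])
      (use B z nn T in auto)
  then have PA: "\<sigma> * pairing (sing_part u0) (Z 0) \<le> ?A"
    using \<sigma> tot_var_atoms[OF inj atoms z0] by auto
  have m: "(\<lambda>\<xi>. \<bar>\<xi> - k\<bar>) \<in> borel_measurable borel"
      "(\<lambda>\<xi>. sgn (\<xi> - k) * (H \<xi> - H k)) \<in> borel_measurable borel"
      "(\<lambda>\<xi>. \<xi> - k) \<in> borel_measurable borel" "(\<lambda>\<xi>. H \<xi> - H k) \<in> borel_measurable borel"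
    by measurable
  note s1 = subtract_constant(1)[OF T Z m(1,2) flux_growth(1,3), where m = 0 and q = 0]
    subtract_constant(1)[OF T Z m(3,4) flux_growth(2,4), where m = 0 and q = 0]
  note s3 = subtract_constant(3)[OF T Z m(1,2) flux_growth(1,3), where m = 0]
    subtract_constant(3)[OF T Z m(3,4) flux_growth(2,4), where m = 0]
  let ?g = "\<lambda>p. (\<bar>ur (snd p) (fst p) - k\<bar> - 0) * Zt (snd p) (fst p)
      + (sgn (ur (snd p) (fst p) - k) * (H (ur (snd p) (fst p)) - H k) - 0) * Zx (snd p) (fst p)"
  let ?h = "\<lambda>p. (ur (snd p) (fst p) - k - 0) * Zt (snd p) (fst p)
      + (H (ur (snd p) (fst p)) - H k - 0) * Zx (snd p) (fst p)"
  have i: "set_integrable lborel (strip T) ?g" "set_integrable lborel (strip T) (\<lambda>p. \<sigma> * ?h p)"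
    using s1 by (simp_all only: case_prod_unfold set_integrable_mult_right)
  have j: "integrable lborel (\<lambda>x. (\<bar>?r x - k\<bar> - 0) * Z 0 x)" "integrable lborel (\<lambda>x. \<sigma> * ((?r x - k - 0) * Z 0 x))"
    using s3 by (simp_all only: integrable_mult_right)
  have mx: "2 * max 0 (\<sigma> * y) = \<bar>y\<bar> + \<sigma> * y" for y :: real using \<sigma> by auto
  have fx: "2 * (if 0 < \<sigma> * (y - k) then \<sigma> * (H y - H k) else 0)
      = sgn (y - k) * (H y - H k) + \<sigma> * (H y - H k)" for y
    using \<sigma> by (auto simp: sgn_real_def)
  have "2 * (LINT (x, t):strip T|lborel. max 0 (\<sigma> * (ur t x - k)) * Zt t x
      + (if 0 < \<sigma> * (ur t x - k) then \<sigma> * (H (ur t x) - H k) else 0) * Zx t x)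
    = (LINT (x, t):strip T|lborel. (2 * max 0 (\<sigma> * (ur t x - k))) * Zt t x
      + (2 * (if 0 < \<sigma> * (ur t x - k) then \<sigma> * (H (ur t x) - H k) else 0)) * Zx t x)"
    unfolding set_integral_mult_right[symmetric] case_prod_unfold by (simp only: distrib_left mult.assoc)
  also have "\<dots> = (LINT p:strip T|lborel. ?g p + \<sigma> * ?h p)"
    unfolding mx fx case_prod_unfold by (simp add: algebra_simps)
  also have "\<dots> = (LINT p:strip T|lborel. ?g p) + \<sigma> * (LINT p:strip T|lborel. ?h p)"
    unfolding set_integral_add(2)[OF i] set_integral_mult_right ..
  finally have L: "2 * (LINT (x, t):strip T|lborel. max 0 (\<sigma> * (ur t x - k)) * Zt t x
      + (if 0 < \<sigma> * (ur t x - k) then \<sigma> * (H (ur t x) - H k) else 0) * Zx t x)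
    = (LINT p:strip T|lborel. ?g p) + \<sigma> * (LINT p:strip T|lborel. ?h p)" .
  have "2 * (LINT x|lborel. max 0 (\<sigma> * (?r x - k)) * Z 0 x)
      = (LINT x|lborel. (2 * max 0 (\<sigma> * (?r x - k))) * Z 0 x)"
    by (simp add: mult.assoc)
  also have "\<dots> = (LINT x|lborel. (\<bar>?r x - k\<bar> - 0) * Z 0 x + \<sigma> * ((?r x - k - 0) * Z 0 x))"
    unfolding mx by (simp add: algebra_simps)
  also have "\<dots> = (LINT x|lborel. (\<bar>?r x - k\<bar> - 0) * Z 0 x) + \<sigma> * (LINT x|lborel. (?r x - k - 0) * Z 0 x)"
    unfolding Bochner_Integration.integral_add[OF j] by simp
  finally have R: "2 * (LINT x|lborel. max 0 (\<sigma> * (?r x - k)) * Z 0 x)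
    = (LINT x|lborel. (\<bar>?r x - k\<bar> - 0) * Z 0 x) + \<sigma> * (LINT x|lborel. (?r x - k - 0) * Z 0 x)" .
  have E: "(LINT p:strip T|lborel. ?g p) + ?S \<ge> - (LINT x|lborel. (\<bar>?r x - k\<bar> - 0) * Z 0 x) - ?A"
    using entropy_inequality[OF T Z nn, of k 0 0] by (simp only: case_prod_unfold)
  have "(LINT p:strip T|lborel. ?h p) + ?P = - (LINT x|lborel. (?r x - k - 0) * Z 0 x) - pairing (sing_part u0) (Z 0)"
    using weak_equation[OF T Z, of k] by (simp only: case_prod_unfold diff_zero)
  then have W: "\<sigma> * (LINT p:strip T|lborel. ?h p) + \<sigma> * ?P
      = - (\<sigma> * (LINT x|lborel. (?r x - k - 0) * Z 0 x)) - \<sigma> * pairing (sing_part u0) (Z 0)"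
    by (metis (no_types, lifting) distrib_left minus_mult_right right_diff_distrib)
  show ?thesis using L R E W PS PA by linarith
qed

end

section \<open>The waiting time estimate\<close>

lemma kern_bounded:
  assumes "0 < \<epsilon>" shows "\<exists>D. \<forall>y. \<bar>kern \<epsilon> y\<bar> \<le> D"
proof -
  have "bounded (kern \<epsilon> ` {0..\<epsilon>})"
    using assms by (intro compact_imp_bounded compact_continuous_image continuous_kern continuous_on_id) auto
  then obtain D where D: "\<forall>y\<in>{0..\<epsilon>}. \<bar>kern \<epsilon> y\<bar> \<le> D" by (auto simp: bounded_iff)
  have "\<bar>kern \<epsilon> y\<bar> \<le> max 0 D" for y
    using D kern_eq_0[OF assms, of y] by (cases "y \<in> {0..\<epsilon>}") (auto simp: le_max_iff_disj)
  then show ?thesis by blast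
qed

lemma integral_kern_reflected:
  assumes "0 < \<epsilon>"
  shows "integrable lborel (\<lambda>y. kern \<epsilon> (- y))" "(LINT y|lborel. kern \<epsilon> (- y)) = 1"
proof -
  have "integrable lborel (\<lambda>y. kern \<epsilon> (0 + (-1) * y))"
    by (rule lborel_integrable_real_affine[OF integral_kern(1)[OF assms]]) simp
  then show "integrable lborel (\<lambda>y. kern \<epsilon> (- y))" by simp
  show "(LINT y|lborel. kern \<epsilon> (- y)) = 1"
    using lborel_integral_real_affine[of "-1" "kern \<epsilon>" 0] integral_kern(2)[OF assms] by simp
qed

lemma strip_borel_fst: "\<phi> \<in> borel_measurable borel \<Longrightarrow> (\<lambda>p::real \<times> real. \<phi> (fst p) :: real) \<in> borel_measurable borel"
  by (rule measurable_compose[of fst borel borel]) (auto intro!: borel_measurable_continuous_onI continuous_intros)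

lemma strip_borel_snd: "\<phi> \<in> borel_measurable borel \<Longrightarrow> (\<lambda>p::real \<times> real. \<phi> (snd p) :: real) \<in> borel_measurable borel"
  by (rule measurable_compose[of snd borel borel]) (auto intro!: borel_measurable_continuous_onI continuous_intros)

text \<open>
  Integrating a bound for the trace at almost every \<open>y\<close> against a probability density.
\<close>

lemma trace_average:
  fixes f :: "real \<times> real \<Rightarrow> real"
  assumes f[measurable]: "f \<in> borel_measurable borel" and fb: "\<And>p. \<bar>f p\<bar> \<le> A"
    and \<beta>: "\<beta> \<in> borel_measurable borel" "\<And>t. \<bar>\<beta> t\<bar> \<le> 1" "\<And>t. t \<notin> {0<..<T} \<Longrightarrow> \<beta> t = 0"
    and \<phi>: "\<phi> \<in> borel_measurable borel" "\<And>y. 0 \<le> \<phi> y" "\<And>y. \<phi> y \<le> D" "integrable lborel \<phi>" "(LINT y|lborel. \<phi> y) = 1"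
    and K: "compact K" "\<And>y. y \<notin> K \<Longrightarrow> \<phi> y = 0"
    and ae: "AE y in lborel. \<phi> y \<noteq> 0 \<longrightarrow> (LINT t:{0<..}|lborel. f (y, t) * \<beta> t) \<le> \<eta>" and \<eta>: "0 \<le> \<eta>"
  shows "(LINT p:strip T|lborel. f p * (\<beta> (snd p) * \<phi> (fst p))) \<le> \<eta>"
proof -
  have [measurable]: "(\<lambda>p::real \<times> real. \<beta> (snd p)) \<in> borel_measurable borel"
    "(\<lambda>p::real \<times> real. \<phi> (fst p)) \<in> borel_measurable borel"
    using \<beta>(1) \<phi>(1) by (auto intro: strip_borel_fst strip_borel_snd)
  have A: "0 \<le> A" using fb[of 0] by linarith
  have D: "0 \<le> D" using \<phi>(2,3) order_trans by blast
  have i: "set_integrable lborel (strip T) (\<lambda>p. f p * (\<beta> (snd p) * \<phi> (fst p)))"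
  proof (rule set_integrable_strip[OF _ K(1), where B = "A * (1 * D)"])
    show "\<bar>f (y, t) * (\<beta> (snd (y, t)) * \<phi> (fst (y, t)))\<bar> \<le> A * (1 * D)" for y t
      unfolding abs_mult using fb \<beta>(2) \<phi>(2,3) A by (intro mult_mono) auto
  qed (use K(2) in simp_all)
  have in_eq: "(LINT t:{0<..<T}|lborel. f (y, t) * (\<beta> t * \<phi> y)) = \<phi> y * (LINT t:{0<..}|lborel. f (y, t) * \<beta> t)" for y
  proof -
    have "(LINT t:{0<..<T}|lborel. f (y, t) * (\<beta> t * \<phi> y)) = (LINT t:{0<..}|lborel. \<phi> y * (f (y, t) * \<beta> t))"
      unfolding set_lebesgue_integral_def
      by (intro Bochner_Integration.integral_cong refl) (use \<beta>(3) in \<open>auto simp: indicator_def\<close>)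
    then show ?thesis by simp
  qed
  have "(LINT p:strip T|lborel. f p * (\<beta> (snd p) * \<phi> (fst p)))
      = (LINT y|lborel. \<phi> y * (LINT t:{0<..}|lborel. f (y, t) * \<beta> t))"
    unfolding strip_Fubini(1)[OF i] by (simp add: in_eq)
  also have "\<dots> \<le> (LINT y|lborel. \<phi> y * \<eta>)"
  proof (rule integral_mono_AE')
    show "integrable lborel (\<lambda>y. \<phi> y * \<eta>)" using \<phi>(4) by simp
    show "AE y in lborel. \<phi> y * (LINT t:{0<..}|lborel. f (y, t) * \<beta> t) \<le> \<phi> y * \<eta>"
      using ae
    proof eventually_elim
      case (elim y)
      then show ?case using \<phi>(2)[of y] by (cases "\<phi> y = 0") (auto intro: mult_left_mono)
    qed
    show "AE y in lborel. 0 \<le> \<phi> y * \<eta>" using \<phi>(2) \<eta> by simp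
  qed
  also have "\<dots> = \<eta>" using \<phi>(5) by simp
  finally show ?thesis .
qed

lemma strip_product_integral:
  assumes \<beta>: "\<beta> \<in> borel_measurable borel" "\<And>t. t \<in> {0<..<T} \<Longrightarrow> \<bar>\<beta> t\<bar> \<le> A"
    and \<phi>: "\<phi> \<in> borel_measurable borel" "\<And>y. 0 \<le> \<phi> y" "\<And>y. \<phi> y \<le> D" "(LINT y|lborel. \<phi> y) = 1"
    and K: "compact K" "\<And>y. y \<notin> K \<Longrightarrow> \<phi> y = (0 :: real)"
  shows "set_integrable lborel (strip T) (\<lambda>p. \<beta> (snd p) * \<phi> (fst p))"
    and "(LINT p:strip T|lborel. \<beta> (snd p) * \<phi> (fst p)) = (LINT t:{0<..<T}|lborel. \<beta> t)"
proof -
  have [measurable]: "(\<lambda>p::real \<times> real. \<beta> (snd p)) \<in> borel_measurable borel"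
    "(\<lambda>p::real \<times> real. \<phi> (fst p)) \<in> borel_measurable borel"
    using \<beta>(1) \<phi>(1) by (auto intro: strip_borel_fst strip_borel_snd)
  show i: "set_integrable lborel (strip T) (\<lambda>p. \<beta> (snd p) * \<phi> (fst p))"
  proof (rule set_integrable_strip[OF _ K(1), where B = "A * D"])
    show "\<bar>\<beta> (snd (y, t)) * \<phi> (fst (y, t))\<bar> \<le> A * D" if "0 < t" "t < T" for y t
      unfolding abs_mult using \<beta>(2)[of t] that \<phi>(2,3) by (intro mult_mono) auto
  qed (use K(2) in simp_all)
  show "(LINT p:strip T|lborel. \<beta> (snd p) * \<phi> (fst p)) = (LINT t:{0<..<T}|lborel. \<beta> t)"
    unfolding strip_Fubini(2)[OF i] using \<phi>(4) by simp
qed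

text \<open>
  The situation at \<open>y = 0\<close> after the substitution. The assumption \<open>flux\<close> is the bounded outflow,
  \<open>kato\<close> the entropy inequality for \<open>(V - k)\<^sup>+\<close> in a triangle to the right of the origin, and \<open>trace\<close>
  the compatibility condition on both sides of it. \<open>V0\<close> is the regular part of the initial value.
\<close>

locale one_sided_problem =
  fixes V :: "real \<Rightarrow> real \<Rightarrow> real" and G V0 :: "real \<Rightarrow> real" and Gp C B :: real
  assumes V_borel [measurable]: "(\<lambda>p. V (snd p) (fst p)) \<in> borel_measurable borel"
    and V_integrable: "\<And>T K. 0 < T \<Longrightarrow> compact K \<Longrightarrow>
      set_integrable lborel (strip T) (\<lambda>p. indicator K (fst p) * V (snd p) (fst p))"
    and G_borel [measurable]: "G \<in> borel_measurable borel"
    and G_bound: "\<And>\<xi>. \<bar>G \<xi>\<bar> \<le> B" and G_lim: "(G \<longlongrightarrow> Gp) at_top"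
    and flux: "\<And>T \<epsilon> \<beta> \<beta>' b b'. \<lbrakk>0 < T; 0 < \<epsilon>;
        \<And>t. (\<beta> has_real_derivative \<beta>' t) (at t); continuous_on UNIV \<beta>'; \<beta> 0 = 0; \<beta> T = 0;
        \<And>t. (b has_real_derivative b' t) (at t); continuous_on UNIV b'; b T = 0;
        \<And>t. t \<in> {0..T} \<Longrightarrow> \<bar>\<beta>' t\<bar> \<le> - b' t; \<And>t. t \<in> {0..T} \<Longrightarrow> 0 \<le> b t\<rbrakk> \<Longrightarrow>
      \<bar>LINT p:strip T|lborel. V (snd p) (fst p) * (bump 0 \<epsilon> (fst p) * \<beta>' (snd p))
        + (G (V (snd p) (fst p)) - Gp) * ((kern \<epsilon> (- fst p) - kern \<epsilon> (fst p)) * \<beta> (snd p))\<bar> \<le> C * b 0"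
    and kato: "\<And>\<epsilon> X s k. \<lbrakk>0 < \<epsilon>; 0 < X; 0 < s\<rbrakk> \<Longrightarrow>
      (LINT p:strip (X / s)|lborel. max 0 (V (snd p) (fst p) - k) * wave_t \<epsilon> X s (snd p) (fst p)
        + (if k < V (snd p) (fst p) then G (V (snd p) (fst p)) - G k else 0) * wave_x \<epsilon> X s (snd p) (fst p))
      \<ge> - (LINT y:{0<..<X}|lborel. max 0 (V0 y - k)) - C"
    and trace: "\<And>k \<beta> \<beta>' \<eta>. \<lbrakk>C1c {0<..} \<beta> \<beta>'; \<And>t. 0 \<le> \<beta> t; 0 < \<eta>\<rbrakk> \<Longrightarrow>
      \<exists>\<delta>>0. AE y in lborel.
        (0 < y \<and> y < \<delta> \<longrightarrow> (LINT t:{0<..}|lborel. sgn_minus (V t y - k) * (G (V t y) - G k) * \<beta> t) \<le> \<eta>) \<and>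
        (- \<delta> < y \<and> y < 0 \<longrightarrow> - \<eta> \<le> (LINT t:{0<..}|lborel. sgn_minus (V t y - k) * (G (V t y) - G k) * \<beta> t))"
begin

lemma B_nonneg: "0 \<le> B"
  using G_bound[of 0] by linarith

lemma Gp_bound: "\<bar>Gp\<bar> \<le> B"
  by (rule tendsto_upperbound[OF tendsto_rabs[OF G_lim]]) (simp_all add: G_bound)

text \<open>
  The bumps tend to \<open>0\<close> off the null line \<open>y = 0\<close>, and \<open>V\<close> is locally integrable.
\<close>

lemma bump_term_vanishes:
  assumes T: "0 < T" and \<beta>': "\<beta>' \<in> borel_measurable borel" "\<And>t. t \<in> {0..T} \<Longrightarrow> \<bar>\<beta>' t\<bar> \<le> A"
  shows "(\<lambda>n. LINT p:strip T|lborel. V (snd p) (fst p) * (bump 0 (1 / Suc n) (fst p) * \<beta>' (snd p))) \<longlonglongrightarrow> 0"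
proof -
  have A: "0 \<le> A" using \<beta>'(2)[of 0] T by auto
  have [measurable]: "(\<lambda>p::real \<times> real. \<beta>' (snd p)) \<in> borel_measurable borel"
    "(\<lambda>p::real \<times> real. bump 0 \<epsilon> (fst p)) \<in> borel_measurable borel" for \<epsilon>
    using \<beta>'(1) by (auto intro: strip_borel_fst strip_borel_snd)
  have "(\<lambda>n. LINT p:strip T|lborel. V (snd p) (fst p) * (bump 0 (1 / Suc n) (fst p) * \<beta>' (snd p)))
      \<longlonglongrightarrow> (LINT p|(lborel :: (real \<times> real) measure). 0)"
    unfolding set_lebesgue_integral_def
  proof (rule integral_dominated_convergence)
    let ?w = "\<lambda>p. indicator (strip T) p *\<^sub>R (A * \<bar>indicator {-1..1} (fst p) * V (snd p) (fst p)\<bar>)"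
    show "integrable lborel ?w"
      unfolding set_integrable_def[symmetric]
      by (intro set_integrable_mult_right set_integrable_abs V_integrable T) auto
    have "AE y in (lborel :: real measure). y \<noteq> 0" by (rule AE_lborel_singleton)
    then have "AE p in (lborel :: real measure) \<Otimes>\<^sub>M (lborel :: real measure). fst p \<noteq> 0"
      by (intro lborel_pair.AE_pair_measure) (measurable, auto)
    then have "AE p in (lborel :: (real \<times> real) measure). fst p \<noteq> 0" by (simp only: lborel_prod)
    then show "AE p in lborel. (\<lambda>n. indicator (strip T) p *\<^sub>R
        (V (snd p) (fst p) * (bump 0 (1 / Suc n) (fst p) * \<beta>' (snd p)))) \<longlonglongrightarrow> 0"
    proof eventually_elim
      case (elim p)
      then obtain N where N: "1 / Suc N < \<bar>fst p\<bar>"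
        using reals_Archimedean[of "\<bar>fst p\<bar>"] by (auto simp: inverse_eq_divide)
      have "bump 0 (1 / Suc n) (fst p) = 0" if "N \<le> n" for n
      proof -
        have "1 / Suc n \<le> 1 / Suc N" using that by (intro divide_left_mono) auto
        then show ?thesis using N by (intro bump_eq_0) auto
      qed
      then show ?case
        by (intro tendsto_eventually eventually_sequentiallyI[of N]) simp
    qed
    show "AE p in lborel. norm (indicator (strip T) p *\<^sub>R
        (V (snd p) (fst p) * (bump 0 (1 / Suc n) (fst p) * \<beta>' (snd p)))) \<le> ?w p" for n
    proof (rule AE_I2)
      fix p :: "real \<times> real"
      let ?e = "1 / real (Suc n)"
      have e: "0 < ?e" "?e \<le> 1" by auto
      show "norm (indicator (strip T) p *\<^sub>R (V (snd p) (fst p) * (bump 0 ?e (fst p) * \<beta>' (snd p)))) \<le> ?w p"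
      proof (cases "p \<in> strip T")
        case True
        then have t: "snd p \<in> {0..T}" by (auto simp: strip_def)
        show ?thesis
        proof (cases "fst p \<in> {-1..1}")
          case in1: True
          have "\<bar>bump 0 ?e (fst p)\<bar> * \<bar>\<beta>' (snd p)\<bar> \<le> 1 * A"
            using bump_bounds[OF e(1), of 0 "fst p"] \<beta>'(2)[OF t] by (intro mult_mono) auto
          from mult_left_mono[OF this, of "\<bar>V (snd p) (fst p)\<bar>"]
          show ?thesis using True in1 by (simp add: abs_mult mult_ac)
        next
          case False
          then have "1 < \<bar>fst p\<bar>" by auto
          then have "?e \<le> \<bar>fst p - 0\<bar>" using e(2) by linarith
          then have "bump 0 ?e (fst p) = 0" by (rule bump_eq_0[OF e(1)])
          then show ?thesis using False by simp
        qed
      qed simp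
    qed
  qed measurable
  then show ?thesis by simp
qed


text \<open>
  The flux through the origin is computed in two ways. The additive \<open>1\<close> absorbs all errors: \<open>\<eta>\<close> from the
  traces, \<open>\<tau>\<close> from cutting the time factor off near \<open>t = 0\<close>, and \<open>\<epsilon>\<close> from the width of the bump. All
  estimates are between integrals over the strip, so that limits as \<open>\<epsilon> \<rightarrow> 0\<close> need not exist.
\<close>

lemma flux_budget:
  assumes X: "0 < X" and s: "0 < s"
    and \<mu>: "\<And>\<xi>. k \<le> \<xi> \<Longrightarrow> \<mu> \<le> G \<xi> - Gp + s * (\<xi> - k)"
  shows "\<mu> * (X / (4 * s)) \<le> 3 * C + (LINT y:{0<..<X}|lborel. max 0 (V0 y - k)) + 1"
proof -
  define T where "T = X / s"
  define W where "W = X / (4 * s)"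
  define I0 where "I0 = (LINT y:{0<..<X}|lborel. max 0 (V0 y - k))"
  \<comment> \<open>Chosen so that \<open>2 \<eta> + \<eta> T\<close>, \<open>8 B \<tau>\<close> and \<open>6 B \<epsilon> T / X\<close> are at most \<open>1/8\<close> each.\<close>
  define \<eta> where "\<eta> = 1 / (8 * (2 + T))"
  define \<tau> where "\<tau> = min (T / 4) (1 / (64 * (B + 1)))"
  have T: "0 < T" using X s by (simp add: T_def)
  have "\<eta> * (8 * (2 + T)) = 1" using T by (simp add: \<eta>_def)
  then have \<eta>2: "2 * \<eta> + \<eta> * T = 1 / 8" by (simp add: algebra_simps)
  have "0 < \<eta>" using T by (simp add: \<eta>_def)
  note \<eta> = this \<eta>2
  have \<tau>: "0 < \<tau>" "2 * \<tau> < T" using T B_nonneg by (auto simp: \<tau>_def min_def)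
  have "\<tau> \<le> 1 / (64 * (B + 1))" by (simp add: \<tau>_def)
  then have \<tau>B: "8 * B * \<tau> \<le> 1 / 8"
    using B_nonneg \<tau>(1) by (simp add: field_simps)
  have sT: "s * T = X" using s by (simp add: T_def)
  define \<alpha> where "\<alpha> t = step ((t - \<tau>) / \<tau>)" for t
  define w where "w t = weight X (s * t)" for t
  define w' where "w' t = s * weight_deriv X (s * t)" for t
  \<comment> \<open>The weight at the origin, cut off near \<open>t = 0\<close> because the compatibility condition requires
     compact support in \<open>(0, \<infinity>)\<close>.\<close>
  define \<beta> where "\<beta> t = \<alpha> t * w t" for t
  define \<beta>' where "\<beta>' t = kern \<tau> (t - \<tau>) * w t + \<alpha> t * w' t" for t
  \<comment> \<open>The total variation of \<open>\<beta> = \<alpha> w\<close> is at most the sum of those of \<open>\<alpha>\<close> and \<open>w\<close>, because both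
     functions have values in \<open>[0, 1]\<close> on \<open>[0, T]\<close>.\<close>
  define b where "b t = 1 - \<alpha> t + w t" for t
  define b' where "b' t = - kern \<tau> (t - \<tau>) + w' t" for t
  have d\<alpha>: "(\<alpha> has_real_derivative kern \<tau> (t - \<tau>)) (at t)" for t
    unfolding \<alpha>_def[abs_def] kern_def using \<tau>(1) by (auto intro!: derivative_eq_intros)
  have dw: "(w has_real_derivative w' t) (at t)" for t
  proof -
    have X0: "X \<noteq> 0" using X by simp
    have l: "((\<lambda>t. s * t) has_real_derivative s) (at t)" by (auto intro!: derivative_eq_intros)
    show ?thesis
      unfolding w_def[abs_def] w'_def using DERIV_chain2[OF DERIV_weight(1)[OF X0] l] by (simp add: mult.commute)
  qed
  have d\<beta>: "(\<beta> has_real_derivative \<beta>' t) (at t)" for t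
    unfolding \<beta>_def[abs_def] \<beta>'_def by (rule DERIV_cong[OF DERIV_mult[OF d\<alpha> dw]]) simp
  have db: "(b has_real_derivative b' t) (at t)" for t
    unfolding b_def[abs_def] b'_def
    by (rule DERIV_cong[OF DERIV_add[OF DERIV_diff[OF DERIV_const d\<alpha>] dw]]) simp
  have c\<alpha>: "continuous_on UNIV \<alpha>" and cw: "continuous_on UNIV w"
    using d\<alpha> dw by (auto intro!: DERIV_continuous_on)
  have cw': "continuous_on UNIV w'" unfolding w'_def[abs_def] by (intro continuous_intros)
  have ck: "continuous_on UNIV (\<lambda>t. kern \<tau> (t - \<tau>))" using \<tau>(1) by (intro continuous_intros) auto
  have c\<beta>': "continuous_on UNIV \<beta>'" unfolding \<beta>'_def[abs_def] by (intro continuous_intros ck cw c\<alpha> cw')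
  have cb': "continuous_on UNIV b'" unfolding b'_def[abs_def] by (intro continuous_intros ck cw')
  have \<alpha>01: "0 \<le> \<alpha> t" "\<alpha> t \<le> 1" for t by (simp_all add: \<alpha>_def step_bounds)
  have \<alpha>0: "\<alpha> t = 0" if "t \<le> \<tau>" for t
    using that \<tau>(1) by (simp add: \<alpha>_def step_eq_0 divide_nonpos_pos)
  have \<alpha>1: "\<alpha> t = 1" if "2 * \<tau> \<le> t" for t
    using that \<tau>(1) by (simp add: \<alpha>_def step_eq_1)
  have w0: "0 \<le> w t" for t by (simp add: w_def weight_nonneg)
  have w1: "w t \<le> 1" if "0 \<le> t" for t using X s that by (simp add: w_def weight_le_1)
  have w'0: "w' t \<le> 0" for t
    using weight_deriv_nonpos[OF X] s by (simp add: w'_def mult_nonneg_nonpos)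
  have wT: "w t = 0" if "T \<le> t" for t
  proof -
    have "X \<le> s * t" using mult_left_mono[OF that, of s] s sT by simp
    then show ?thesis using X by (simp add: w_def weight_eq_0)
  qed
  have \<beta>0: "0 \<le> \<beta> t" for t using \<alpha>01 w0 by (simp add: \<beta>_def)
  have \<beta>1: "\<bar>\<beta> t\<bar> \<le> 1" for t
  proof (cases "0 \<le> t")
    case True
    then show ?thesis using \<alpha>01[of t] w0[of t] w1[of t] mult_mono[of "\<alpha> t" 1 "w t" 1] by (simp add: \<beta>_def)
  next
    case False
    then show ?thesis using \<alpha>0[of t] \<tau>(1) by (simp add: \<beta>_def)
  qed
  have \<beta>z: "\<beta> t = 0" if "t \<notin> {\<tau>..T}" for t
    using that \<alpha>0[of t] wT[of t] by (cases "t < \<tau>") (auto simp: \<beta>_def)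
  have \<beta>z': "\<beta> t = 0" if "t \<notin> {0<..<T}" for t
    using that \<beta>z[of t] wT[of t] \<tau> by (cases "t = T") (auto simp: \<beta>_def)
  have C1\<beta>: "C1c {0<..} \<beta> \<beta>'"
    unfolding C1c_def using d\<beta> c\<beta>' \<beta>z \<tau> by (auto intro!: exI[of _ "{\<tau>..T}"])
  have \<beta>b: "\<bar>\<beta>' t\<bar> \<le> - b' t" if t: "t \<in> {0..T}" for t
  proof -
    have k0: "0 \<le> kern \<tau> (t - \<tau>)" using \<tau>(1) by (rule kern_nonneg)
    have "kern \<tau> (t - \<tau>) * w t \<le> kern \<tau> (t - \<tau>) * 1"
      using w1 t k0 by (intro mult_left_mono) auto
    moreover have "\<alpha> t * - w' t \<le> 1 * - w' t"
      using \<alpha>01 w'0 by (intro mult_right_mono) auto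
    moreover have "0 \<le> kern \<tau> (t - \<tau>) * w t" using k0 w0 by simp
    moreover have "0 \<le> \<alpha> t * - w' t" using \<alpha>01 w'0 by (intro mult_nonneg_nonneg) auto
    ultimately show ?thesis unfolding \<beta>'_def b'_def by (simp add: abs_le_iff) 
  qed
  have bb: "b T = 0" "b 0 = 2" "\<beta> 0 = 0" "\<beta> T = 0" "\<And>t. 0 \<le> b t"
    using \<alpha>1[of T] \<alpha>0[of 0] \<tau> wT[of T] \<alpha>01 w0 \<beta>z'[of 0] \<beta>z'[of T]
    by (auto simp: b_def w_def weight_def add_nonneg_nonneg)
  have "bounded (\<beta>' ` {0..T})"
    by (intro compact_imp_bounded compact_continuous_image continuous_on_subset[OF c\<beta>']) auto
  then obtain A where "\<forall>t\<in>{0..T}. \<bar>\<beta>' t\<bar> \<le> A" by (auto simp: bounded_iff)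
  then have A: "\<bar>\<beta>' t\<bar> \<le> A" if "t \<in> {0..T}" for t using that by blast
  have \<beta>m: "\<beta> \<in> borel_measurable borel" "\<beta>' \<in> borel_measurable borel" "w \<in> borel_measurable borel"
    using d\<beta> c\<beta>' cw by (auto intro!: borel_measurable_continuous_onI DERIV_continuous_on)
  obtain k1 where k1: "\<And>\<xi>. k1 \<le> \<xi> \<Longrightarrow> \<bar>G \<xi> - Gp\<bar> \<le> \<eta>"
  proof -
    have "\<forall>\<^sub>F \<xi> in at_top. \<bar>G \<xi> - Gp\<bar> < \<eta>"
      using tendstoD[OF G_lim \<eta>(1)] by (simp add: dist_real_def)
    then show ?thesis using that by (auto simp: eventually_at_top_linorder intro: less_imp_le)
  qed
  define Q where "Q m \<xi> = sgn_minus (\<xi> - m) * (G \<xi> - G m)" for m \<xi>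
  define \<Psi> where "\<Psi> \<xi> = (if k < \<xi> then G \<xi> - G k else 0)" for \<xi>
  obtain \<delta>1 where \<delta>1: "0 < \<delta>1" "AE y in lborel. - \<delta>1 < y \<and> y < 0 \<longrightarrow> - \<eta> \<le> (LINT t:{0<..}|lborel. Q k1 (V t y) * \<beta> t)"
    using trace[OF C1\<beta> \<beta>0 \<eta>(1), of k1] unfolding Q_def by (auto elim: eventually_mono)
  obtain \<delta>2 where \<delta>2: "0 < \<delta>2" "AE y in lborel. 0 < y \<and> y < \<delta>2 \<longrightarrow> (LINT t:{0<..}|lborel. Q k (V t y) * \<beta> t) \<le> \<eta>"
    using trace[OF C1\<beta> \<beta>0 \<eta>(1), of k] unfolding Q_def by (auto elim: eventually_mono)
  define e0 where "e0 = min (min \<delta>1 \<delta>2) (X / (48 * (B + 1) * (T + 1)))"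
  have e0: "0 < e0" using \<delta>1 \<delta>2 X T B_nonneg by (simp add: e0_def)
  obtain n where n: "1 / real (Suc n) < e0"
    "\<bar>LINT p:strip T|lborel. V (snd p) (fst p) * (bump 0 (1 / Suc n) (fst p) * \<beta>' (snd p))\<bar> < 1 / 8"
  proof -
    have "(\<lambda>n. 1 / real (Suc n)) \<longlonglongrightarrow> 0"
      using LIMSEQ_inverse_real_of_nat by (simp add: inverse_eq_divide)
    note e = order_tendstoD(2)[OF this e0]
    have "(\<lambda>n. LINT p:strip T|lborel. V (snd p) (fst p) * (bump 0 (1 / Suc n) (fst p) * \<beta>' (snd p))) \<longlonglongrightarrow> 0"
      by (rule bump_term_vanishes[OF T \<beta>m(2)]) (rule A)
    from tendstoD[OF this, of "1 / 8"]
    have "\<forall>\<^sub>F n in sequentially. dist (LINT p:strip T|lborel. V (snd p) (fst p) * (bump 0 (1 / Suc n) (fst p) * \<beta>' (snd p))) 0 < 1 / 8"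
      by simp
    with e
    have "\<forall>\<^sub>F n in sequentially. 1 / real (Suc n) < e0 \<and>
      \<bar>LINT p:strip T|lborel. V (snd p) (fst p) * (bump 0 (1 / Suc n) (fst p) * \<beta>' (snd p))\<bar> < 1 / 8"
      by eventually_elim (simp add: dist_real_def)
    then show ?thesis using that by (auto simp: eventually_sequentially)
  qed
  define \<epsilon> where "\<epsilon> = 1 / real (Suc n)"
  have \<epsilon>: "0 < \<epsilon>" "\<epsilon> < \<delta>1" "\<epsilon> < \<delta>2" "\<epsilon> < X / (48 * (B + 1) * (T + 1))"
    using n(1) by (auto simp: \<epsilon>_def e0_def)
  have \<epsilon>B: "6 * B * (\<epsilon> * T / X) \<le> 1 / 8"
  proof -
    have "6 * B * (\<epsilon> * T) \<le> 6 * (B + 1) * (\<epsilon> * (T + 1))"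
      using B_nonneg T \<epsilon>(1) by (intro mult_mono) auto
    also have "\<dots> \<le> X / 8"
    proof -
      have "0 < 48 * (B + 1) * (T + 1)" using B_nonneg T by simp
      from \<epsilon>(4)[unfolded pos_less_divide_eq[OF this]] show ?thesis by (simp add: algebra_simps)
    qed
    finally show ?thesis using X by (simp add: field_simps)
  qed
  let ?v = "\<lambda>p. V (snd p) (fst p)"
  let ?I = "\<lambda>f. LINT p:strip T|lborel. f p"
  define \<psi>1 where "\<psi>1 p = \<beta> (snd p) * kern \<epsilon> (fst p)" for p :: "real \<times> real"
  define \<psi>2 where "\<psi>2 p = \<beta> (snd p) * kern \<epsilon> (- fst p)" for p :: "real \<times> real"
  define \<psi>3 where "\<psi>3 p = weight X (fst p + s * snd p) * kern \<epsilon> (fst p)" for p :: "real \<times> real"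
  let ?K = "{- \<epsilon>..\<epsilon>}"
  have K: "compact ?K" by simp
  obtain D where D: "\<And>y. \<bar>kern \<epsilon> y\<bar> \<le> D" using kern_bounded[OF \<epsilon>(1)] by blast
  have D': "kern \<epsilon> y \<le> D" for y using D[of y] by linarith
  have kz: "kern \<epsilon> y = 0" "kern \<epsilon> (- y) = 0" if "y \<notin> ?K" for y
    using that \<epsilon>(1) by (auto intro!: kern_eq_0)
  note k0 = kern_nonneg[OF \<epsilon>(1)]
  have km: "(\<lambda>y. kern \<epsilon> (- y)) \<in> borel_measurable borel" by measurable
  have [measurable]: "(\<lambda>p::real \<times> real. \<beta> (snd p)) \<in> borel_measurable borel"
    "(\<lambda>p::real \<times> real. \<beta>' (snd p)) \<in> borel_measurable borel"
    "(\<lambda>p::real \<times> real. kern \<epsilon> (fst p)) \<in> borel_measurable borel"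
    "(\<lambda>p::real \<times> real. kern \<epsilon> (- fst p)) \<in> borel_measurable borel"
    "(\<lambda>p::real \<times> real. bump 0 \<epsilon> (fst p)) \<in> borel_measurable borel"
    using \<beta>m km by (auto intro: strip_borel_snd strip_borel_fst)
  have [measurable]: "(\<lambda>p::real \<times> real. weight X (fst p + s * snd p)) \<in> borel_measurable borel"
    by (intro borel_measurable_continuous_onI continuous_intros)
  have \<psi>m: "\<psi>1 \<in> borel_measurable borel" "\<psi>2 \<in> borel_measurable borel" "\<psi>3 \<in> borel_measurable borel"
    unfolding \<psi>1_def[abs_def] \<psi>2_def[abs_def] \<psi>3_def[abs_def] by measurable
  have Qm: "Q m \<in> borel_measurable borel" for m
    unfolding Q_def[abs_def] sgn_minus_def by measurable
  have \<Psi>m: "\<Psi> \<in> borel_measurable borel" unfolding \<Psi>_def[abs_def] by measurable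
  have gm: "(\<lambda>\<xi>. G \<xi> - Gp) \<in> borel_measurable borel" by measurable
  have Gd: "\<bar>G \<xi> - G m\<bar> \<le> 2 * B" "\<bar>G \<xi> - Gp\<bar> \<le> 2 * B" for \<xi> m
    using G_bound[of \<xi>] G_bound[of m] Gp_bound by linarith+
  have Qb: "\<bar>Q m \<xi>\<bar> \<le> 0 * \<bar>\<xi>\<bar> + 2 * B" for m \<xi>
    using Gd(1)[of \<xi> m] B_nonneg by (auto simp: Q_def sgn_minus_def indicator_def)
  have \<Psi>b: "\<bar>\<Psi> \<xi>\<bar> \<le> 0 * \<bar>\<xi>\<bar> + 2 * B" for \<xi>
    using Gd(1)[of \<xi> k] B_nonneg by (auto simp: \<Psi>_def)
  have gb: "\<bar>G \<xi> - Gp\<bar> \<le> 0 * \<bar>\<xi>\<bar> + 2 * B" for \<xi> using Gd(2) by simp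
  have \<psi>b: "\<bar>\<psi>1 (y, t)\<bar> \<le> D" "\<bar>\<psi>2 (y, t)\<bar> \<le> D" "t \<in> {0..T} \<Longrightarrow> \<bar>\<psi>3 (y, t)\<bar> \<le> D" for y t
  proof -
    have D0: "0 \<le> D" using D[of 0] by linarith
    show "\<bar>\<psi>1 (y, t)\<bar> \<le> D" "\<bar>\<psi>2 (y, t)\<bar> \<le> D"
      using mult_mono[OF \<beta>1[of t] D[of y]] mult_mono[OF \<beta>1[of t] D[of "- y"]]
      by (auto simp: \<psi>1_def \<psi>2_def abs_mult)
    show "\<bar>\<psi>3 (y, t)\<bar> \<le> D" if t: "t \<in> {0..T}"
    proof (cases "0 \<le> y")
      case True
      then have "\<bar>weight X (y + s * t)\<bar> \<le> 1"
        using weight_nonneg[of X] weight_le_1[OF X, of "y + s * t"] t s by simp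
      from mult_mono[OF this D[of y]] show ?thesis by (simp add: \<psi>3_def abs_mult)
    next
      case False
      then show ?thesis using D0 by (simp add: \<psi>3_def kern_eq_0[OF \<epsilon>(1)])
    qed
  qed
  have \<psi>z: "\<psi>1 (y, t) = 0" "\<psi>2 (y, t) = 0" "\<psi>3 (y, t) = 0" if "y \<notin> ?K" for y t
    using kz[OF that] by (simp_all add: \<psi>1_def \<psi>2_def \<psi>3_def)
  have SI: "set_integrable lborel (strip T) (\<lambda>p. g (?v p) * \<psi>1 p)"
    "set_integrable lborel (strip T) (\<lambda>p. g (?v p) * \<psi>2 p)"
    "set_integrable lborel (strip T) (\<lambda>p. g (?v p) * \<psi>3 p)"
    if "g \<in> borel_measurable borel" "\<And>\<xi>. \<bar>g \<xi>\<bar> \<le> 0 * \<bar>\<xi>\<bar> + 2 * B" for g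
    by (rule set_integrable_growth[OF V_borel V_integrable[OF T K] that \<psi>m(1) K, of D], rule \<psi>b(1), rule \<psi>z(1), assumption)
      (rule set_integrable_growth[OF V_borel V_integrable[OF T K] that \<psi>m(2) K, of D], rule \<psi>b(2), rule \<psi>z(2), assumption,
       rule set_integrable_growth[OF V_borel V_integrable[OF T K] that \<psi>m(3) K, of D], erule \<psi>b(3), rule \<psi>z(3), assumption)
  have \<beta>A: "\<bar>\<beta> t\<bar> \<le> 1" if "t \<in> {0<..<T}" for t by (rule \<beta>1)
  note P1 = strip_product_integral[OF \<beta>m(1) \<beta>A kern_measurable k0 D' integral_kern(2)[OF \<epsilon>(1)] K kz(1), folded \<psi>1_def]
  note P2 = strip_product_integral[OF \<beta>m(1) \<beta>A km k0 D' integral_kern_reflected(2)[OF \<epsilon>(1)] K kz(2), folded \<psi>2_def]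
  define \<beta>i where "\<beta>i = (LINT t:{0<..<T}|lborel. \<beta> t)"
  \<comment> \<open>Bounded outflow: the weak equation gives \<open>2 C\<close>, as \<open>b 0 = 2\<close>, and \<open>\<psi>1\<close>, \<open>\<psi>2\<close> come from the two
     flanks of the bump.\<close>
  have step1: "?I (\<lambda>p. (G (?v p) - Gp) * \<psi>1 p) \<le> 2 * C + 1 / 8 + ?I (\<lambda>p. (G (?v p) - Gp) * \<psi>2 p)"
  proof -
    have i0: "set_integrable lborel (strip T) (\<lambda>p. ?v p * (bump 0 \<epsilon> (fst p) * \<beta>' (snd p)))"
    proof (rule set_integrable_growth[OF V_borel V_integrable[OF T K] _ _ _ K, where \<alpha> = 1 and \<beta> = 0])
      show "\<bar>bump 0 \<epsilon> (fst (y, t)) * \<beta>' (snd (y, t))\<bar> \<le> 1 * A" if "t \<in> {0..T}" for y t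
        unfolding abs_mult using bump_bounds[OF \<epsilon>(1)] A[OF that] by (intro mult_mono) auto
      show "bump 0 \<epsilon> (fst (y, t)) * \<beta>' (snd (y, t)) = 0" if "y \<notin> ?K" for y t
        using that bump_eq_0[OF \<epsilon>(1), of y 0] by auto
    qed auto
    note i1 = SI(1)[OF gm gb] note i2 = SI(2)[OF gm gb]
    have "(\<lambda>p. ?v p * (bump 0 \<epsilon> (fst p) * \<beta>' (snd p))
        + (G (?v p) - Gp) * ((kern \<epsilon> (- fst p) - kern \<epsilon> (fst p)) * \<beta> (snd p)))
      = (\<lambda>p. ?v p * (bump 0 \<epsilon> (fst p) * \<beta>' (snd p)) + ((G (?v p) - Gp) * \<psi>2 p - (G (?v p) - Gp) * \<psi>1 p))"
      by (simp add: fun_eq_iff \<psi>1_def \<psi>2_def algebra_simps)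
    then have "?I (\<lambda>p. ?v p * (bump 0 \<epsilon> (fst p) * \<beta>' (snd p))
        + (G (?v p) - Gp) * ((kern \<epsilon> (- fst p) - kern \<epsilon> (fst p)) * \<beta> (snd p)))
      = ?I (\<lambda>p. ?v p * (bump 0 \<epsilon> (fst p) * \<beta>' (snd p)))
        + (?I (\<lambda>p. (G (?v p) - Gp) * \<psi>2 p) - ?I (\<lambda>p. (G (?v p) - Gp) * \<psi>1 p))"
      using set_integral_add(2)[OF i0 set_integral_diff(1)[OF i2 i1]] set_integral_diff(2)[OF i2 i1]
      by simp
    moreover have "\<bar>?I (\<lambda>p. ?v p * (bump 0 \<epsilon> (fst p) * \<beta>' (snd p))
        + (G (?v p) - Gp) * ((kern \<epsilon> (- fst p) - kern \<epsilon> (fst p)) * \<beta> (snd p)))\<bar> \<le> C * b 0"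
      by (rule flux[OF T \<epsilon>(1) d\<beta> c\<beta>' bb(3,4) db cb' bb(1) \<beta>b bb(5)])
    ultimately show ?thesis using n(2) unfolding \<epsilon>_def[symmetric] bb(2) by linarith
  qed
  define \<zeta> where "\<zeta> t = indicat_real {0<..<2 * \<tau>} t" for t
  have \<zeta>: "set_integrable lborel {0<..<T} \<zeta>" "(LINT t:{0<..<T}|lborel. \<zeta> t) = 2 * \<tau>"
  proof -
    have e: "(\<lambda>t. indicator {0<..<T} t *\<^sub>R \<zeta> t) = indicat_real {0<..<2 * \<tau>}"
      using \<tau> by (auto simp: \<zeta>_def indicator_def fun_eq_iff)
    show "set_integrable lborel {0<..<T} \<zeta>" "(LINT t:{0<..<T}|lborel. \<zeta> t) = 2 * \<tau>"
      unfolding set_integrable_def set_lebesgue_integral_def e using \<tau> by auto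
  qed
  have \<alpha>\<zeta>: "1 - \<alpha> t \<le> \<zeta> t" if "0 < t" for t
    using \<alpha>01[of t] \<alpha>1[of t] that by (cases "t < 2 * \<tau>") (auto simp: \<zeta>_def)
  have wi: "set_integrable lborel {0<..<T} w" "(LINT t:{0<..<T}|lborel. w t) = W"
  proof -
    have ae: "AE t in lborel. indicator {0<..<T} t *\<^sub>R w t = weight X (s * t) * indicator {0..X / s} t"
      using AE_lborel_singleton[of 0] AE_lborel_singleton[of T]
      by eventually_elim (auto simp: indicator_def w_def T_def)
    have m: "(\<lambda>t. weight X (s * t) * indicator {0..X / s} t) \<in> borel_measurable borel" by measurable
    note h = integral_weight[OF X s, unfolded has_bochner_integral_iff]
    show "set_integrable lborel {0<..<T} w" unfolding set_integrable_def
      using h integrable_cong_AE[OF _ _ ae] \<beta>m(3) m by simp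
    show "(LINT t:{0<..<T}|lborel. w t) = W" unfolding set_lebesgue_integral_def
      using h integral_cong_AE[OF _ _ ae] \<beta>m(3) m by (simp add: W_def)
  qed
  have \<beta>w: "\<beta> t \<le> w t" for t using mult_right_mono[OF \<alpha>01(2)[of t] w0[of t]] by (simp add: \<beta>_def)
  have \<beta>si: "set_integrable lborel {0<..<T} \<beta>"
  proof (rule set_integrable_bound[OF wi(1)])
    show "set_borel_measurable lborel {0<..<T} \<beta>"
      unfolding set_borel_measurable_def using \<beta>m(1) by measurable
    show "AE t in lborel. t \<in> {0<..<T} \<longrightarrow> norm (\<beta> t) \<le> norm (w t)"
      using \<beta>w \<beta>0 w0 by (intro AE_I2) simp
  qed
  have \<beta>i_le: "\<beta>i \<le> W"
    unfolding \<beta>i_def wi(2)[symmetric] by (rule set_integral_mono[OF \<beta>si wi(1) \<beta>w])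
  have "W \<le> T" using X s by (simp add: W_def T_def field_simps)
  moreover have "W - \<beta>i \<le> 2 * \<tau>"
  proof -
    have "W - \<beta>i = (LINT t:{0<..<T}|lborel. w t - \<beta> t)"
      using set_integral_diff(2)[OF wi(1) \<beta>si] wi(2) by (simp add: \<beta>i_def)
    also have "\<dots> \<le> (LINT t:{0<..<T}|lborel. \<zeta> t)"
    proof (rule set_integral_mono[OF set_integral_diff(1)[OF wi(1) \<beta>si] \<zeta>(1)])
      fix t assume t: "t \<in> {0<..<T}"
      have "(1 - \<alpha> t) * w t \<le> (1 - \<alpha> t) * 1" using \<alpha>01[of t] w1[of t] t by (intro mult_left_mono) auto
      then show "w t - \<beta> t \<le> \<zeta> t" using \<alpha>\<zeta>[of t] t by (simp add: \<beta>_def algebra_simps)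
    qed
    finally show ?thesis using \<zeta>(2) by simp
  qed
  ultimately have \<beta>i_bounds: "\<bar>\<beta>i - W\<bar> \<le> 2 * \<tau>" "\<beta>i \<le> T"
    using \<beta>i_le \<tau>(1) by auto
  \<comment> \<open>On the left the flux exceeds its limit by at most a small amount: apply the trace condition
     at a level \<open>k1\<close> beyond which \<open>G\<close> is within \<open>\<eta>\<close> of \<open>Gp\<close>.\<close>
  have step2: "?I (\<lambda>p. (G (?v p) - Gp) * \<psi>2 p) \<le> \<eta> + \<eta> * T"
  proof -
    have "?I (\<lambda>p. (G (?v p) - Gp) * \<psi>2 p) \<le> ?I (\<lambda>p. - Q k1 (?v p) * \<psi>2 p + \<eta> * \<psi>2 p)"
    proof (rule set_integral_mono[OF SI(2)[OF gm gb]])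
      have i: "set_integrable lborel (strip T) (\<lambda>p. - Q k1 (?v p) * \<psi>2 p)"
        using SI(2)[of "\<lambda>\<xi>. - Q k1 \<xi>"] Qm Qb by simp
      show "set_integrable lborel (strip T) (\<lambda>p. - Q k1 (?v p) * \<psi>2 p + \<eta> * \<psi>2 p)"
        by (intro set_integral_add(1)[OF i] set_integrable_mult_right P2(1))
      fix p
      have "G \<xi> - Gp \<le> - Q k1 \<xi> + \<eta>" for \<xi>
        using k1[of \<xi>] k1[of k1] by (cases "\<xi> < k1") (auto simp: Q_def sgn_minus_def)
      from mult_right_mono[OF this, of "\<psi>2 p" "?v p"]
      show "(G (?v p) - Gp) * \<psi>2 p \<le> - Q k1 (?v p) * \<psi>2 p + \<eta> * \<psi>2 p"
        using \<beta>0 k0 by (simp add: \<psi>2_def algebra_simps)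
    qed
    also have "\<dots> = ?I (\<lambda>p. - Q k1 (?v p) * \<psi>2 p) + \<eta> * \<beta>i"
      using set_integral_add(2)[OF SI(2)[of "\<lambda>\<xi>. - Q k1 \<xi>"] set_integrable_mult_right[OF P2(1)], of \<eta>] Qm Qb P2(2)
      by (simp add: \<beta>i_def)
    also have "\<dots> \<le> \<eta> + \<eta> * T"
    proof (intro add_mono mult_left_mono \<beta>i_bounds(2))
      show "?I (\<lambda>p. - Q k1 (?v p) * \<psi>2 p) \<le> \<eta>"
        unfolding \<psi>2_def
      proof (rule trace_average[where f = "\<lambda>p. - Q k1 (?v p)" and A = "2 * B" and \<phi> = "\<lambda>y. kern \<epsilon> (- y)" and K = ?K and D = D])
        show "(\<lambda>p. - Q k1 (?v p)) \<in> borel_measurable borel" using Qm by measurable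
        show "\<bar>- Q k1 (?v p)\<bar> \<le> 2 * B" for p using Qb[of k1 "?v p"] by simp
        show "AE y in lborel. kern \<epsilon> (- y) \<noteq> 0 \<longrightarrow>
            (LINT t:{0<..}|lborel. - Q k1 (V (snd (y, t)) (fst (y, t))) * \<beta> t) \<le> \<eta>"
          using \<delta>1(2)
        proof eventually_elim
          case (elim y)
          show ?case
          proof
            assume "kern \<epsilon> (- y) \<noteq> 0"
            then have "- \<delta>1 < y \<and> y < 0" using kern_eq_0[OF \<epsilon>(1), of "- y"] \<epsilon>(2) by force
            then have "- \<eta> \<le> (LINT t:{0<..}|lborel. Q k1 (V t y) * \<beta> t)" using elim by blast
            then show "(LINT t:{0<..}|lborel. - Q k1 (V (snd (y, t)) (fst (y, t))) * \<beta> t) \<le> \<eta>"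
              by (simp add: set_lebesgue_integral_def)
          qed
        qed
      qed (use \<beta>m \<beta>1 \<beta>z' km k0 D' integral_kern_reflected[OF \<epsilon>(1)] kz \<eta>(1) in auto)
    qed (use \<eta>(1) in simp)
    finally show ?thesis .
  qed
  \<comment> \<open>On the right the trace condition at the level \<open>k\<close> replaces the values below \<open>k\<close> by \<open>G k\<close>.\<close>
  have step3: "?I (\<lambda>p. (G (?v p) - Gp) * \<psi>1 p) \<ge> - \<eta> + ?I (\<lambda>p. \<Psi> (?v p) * \<psi>1 p) + (G k - Gp) * \<beta>i"
  proof -
    note i1 = SI(1)[OF Qm Qb, of k] note i2 = SI(1)[OF \<Psi>m \<Psi>b]
    have i3: "set_integrable lborel (strip T) (\<lambda>p. (G k - Gp) * \<psi>1 p)"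
      by (intro set_integrable_mult_right P1(1))
    have e: "G \<xi> - Gp = \<Psi> \<xi> + (G k - Gp) - Q k \<xi>" for \<xi>
      by (cases "\<xi> < k"; cases "\<xi> = k") (auto simp: Q_def \<Psi>_def sgn_minus_def)
    have "?I (\<lambda>p. (G (?v p) - Gp) * \<psi>1 p) = ?I (\<lambda>p. (\<Psi> (?v p) * \<psi>1 p + (G k - Gp) * \<psi>1 p) - Q k (?v p) * \<psi>1 p)"
    proof -
      have "(G (?v p) - Gp) * \<psi>1 p = (\<Psi> (?v p) * \<psi>1 p + (G k - Gp) * \<psi>1 p) - Q k (?v p) * \<psi>1 p" for p
        unfolding e[of "?v p"] by (simp add: ring_distribs)
      then show ?thesis by (simp only:)
    qed
    also have "\<dots> = ?I (\<lambda>p. \<Psi> (?v p) * \<psi>1 p) + (G k - Gp) * \<beta>i - ?I (\<lambda>p. Q k (?v p) * \<psi>1 p)"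
      using set_integral_diff(2)[OF set_integral_add(1)[OF i2 i3] i1] set_integral_add(2)[OF i2 i3] P1(2)
      by (simp add: \<beta>i_def)
    finally have "?I (\<lambda>p. (G (?v p) - Gp) * \<psi>1 p)
      = ?I (\<lambda>p. \<Psi> (?v p) * \<psi>1 p) + (G k - Gp) * \<beta>i - ?I (\<lambda>p. Q k (?v p) * \<psi>1 p)" .
    moreover have "?I (\<lambda>p. Q k (?v p) * \<psi>1 p) \<le> \<eta>"
      unfolding \<psi>1_def
    proof (rule trace_average[where f = "\<lambda>p. Q k (?v p)" and A = "2 * B" and \<phi> = "kern \<epsilon>" and K = ?K and D = D])
      show "(\<lambda>p. Q k (?v p)) \<in> borel_measurable borel" using Qm by measurable
      show "\<bar>Q k (?v p)\<bar> \<le> 2 * B" for p using Qb[of k "?v p"] by simp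
      show "AE y in lborel. kern \<epsilon> y \<noteq> 0 \<longrightarrow>
          (LINT t:{0<..}|lborel. Q k (V (snd (y, t)) (fst (y, t))) * \<beta> t) \<le> \<eta>"
        using \<delta>2(2)
      proof eventually_elim
        case (elim y)
        show ?case
        proof
          assume "kern \<epsilon> y \<noteq> 0"
          then have "0 < y \<and> y < \<delta>2" using kern_eq_0[OF \<epsilon>(1), of y] \<epsilon>(3) by force
          then show "(LINT t:{0<..}|lborel. Q k (V (snd (y, t)) (fst (y, t))) * \<beta> t) \<le> \<eta>"
            using elim by simp
        qed
      qed
    qed (use \<beta>m \<beta>1 \<beta>z' k0 D' integral_kern[OF \<epsilon>(1)] kz \<eta>(1) in auto)
    ultimately show ?thesis by linarith
  qed
  \<comment> \<open>The time factor \<open>\<beta>\<close> differs from the travelling weight only for \<open>t < 2 \<tau>\<close> and by the variation of the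
     weight over the width \<open>\<epsilon>\<close>.\<close>
  have step4: "?I (\<lambda>p. \<Psi> (?v p) * \<psi>1 p) \<ge> ?I (\<lambda>p. \<Psi> (?v p) * \<psi>3 p) - 2 * B * (2 * \<tau> + 3 / X * \<epsilon> * T)"
  proof -
    define \<zeta>3 where "\<zeta>3 t = \<zeta> t + 3 / X * \<epsilon>" for t
    have q0: "0 \<le> 3 / X * \<epsilon>" using X \<epsilon>(1) by simp
    have m: "\<zeta>3 \<in> borel_measurable borel" unfolding \<zeta>3_def[abs_def] \<zeta>_def[abs_def] by measurable
    have b3: "\<bar>\<zeta>3 t\<bar> \<le> 1 + 3 / X * \<epsilon>" for t using q0 by (auto simp: \<zeta>3_def \<zeta>_def indicator_def)
    note P3 = strip_product_integral[OF m b3 kern_measurable k0 D' integral_kern(2)[OF \<epsilon>(1)] K kz(1), where T = T]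
    have c3: "set_integrable lborel {0<..<T} (\<lambda>t. 3 / X * \<epsilon>)" "(LINT t:{0<..<T}|lborel. 3 / X * \<epsilon>) = 3 / X * \<epsilon> * T"
      using T by (simp_all add: set_integrable_def set_lebesgue_integral_def)
    have i3: "(LINT t:{0<..<T}|lborel. \<zeta>3 t) = 2 * \<tau> + 3 / X * \<epsilon> * T"
      unfolding \<zeta>3_def set_integral_add(2)[OF \<zeta>(1) c3(1)] \<zeta>(2) c3(2) ..
    note i = SI(3)[OF \<Psi>m \<Psi>b]
    have j: "set_integrable lborel (strip T) (\<lambda>p. 2 * B * (\<zeta>3 (snd p) * kern \<epsilon> (fst p)))"
      by (intro set_integrable_mult_right P3(1))
    have I3: "?I (\<lambda>p. \<zeta>3 (snd p) * kern \<epsilon> (fst p)) = 2 * \<tau> + 3 / X * \<epsilon> * T"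
      using P3(2) i3 by simp
    have "?I (\<lambda>p. \<Psi> (?v p) * \<psi>3 p) - 2 * B * (2 * \<tau> + 3 / X * \<epsilon> * T)
        = ?I (\<lambda>p. \<Psi> (?v p) * \<psi>3 p - 2 * B * (\<zeta>3 (snd p) * kern \<epsilon> (fst p)))"
      unfolding set_integral_diff(2)[OF i j] set_integral_mult_right I3 ..
    also have "\<dots> \<le> ?I (\<lambda>p. \<Psi> (?v p) * \<psi>1 p)"
    proof (rule set_integral_mono[OF set_integral_diff(1)[OF i j] SI(1)[OF \<Psi>m \<Psi>b]])
      fix p :: "real \<times> real" assume "p \<in> strip T"
      then have t: "0 < snd p" by (auto simp: strip_def)
      let ?y = "fst p" and ?t = "snd p"
      show "\<Psi> (?v p) * \<psi>3 p - 2 * B * (\<zeta>3 ?t * kern \<epsilon> ?y) \<le> \<Psi> (?v p) * \<psi>1 p"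
      proof (cases "0 < ?y \<and> ?y < \<epsilon>")
        case False
        then have "kern \<epsilon> ?y = 0" using kern_eq_0[OF \<epsilon>(1), of ?y] by force
        then show ?thesis by (simp add: \<psi>1_def \<psi>3_def)
      next
        case True
        have st: "0 \<le> s * ?t" using s t by simp
        have "\<bar>weight X (?y + s * ?t) - w ?t\<bar> \<le> 3 / X * ?y"
          unfolding w_def using True st by (intro weight_lipschitz[OF X]) auto
        also have "\<dots> \<le> 3 / X * \<epsilon>" using True X by (intro mult_left_mono) auto
        finally have l1: "\<bar>weight X (?y + s * ?t) - w ?t\<bar> \<le> 3 / X * \<epsilon>" .
        have "\<bar>1 - \<alpha> ?t\<bar> * \<bar>w ?t\<bar> \<le> \<zeta> ?t * 1"
          using \<alpha>01[of ?t] w1[of ?t] w0[of ?t] \<alpha>\<zeta>[of ?t] t by (intro mult_mono) auto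
        then have "\<bar>w ?t - \<beta> ?t\<bar> \<le> \<zeta> ?t"
          by (simp add: \<beta>_def abs_mult[symmetric] algebra_simps)
        with l1 have l: "\<bar>weight X (?y + s * ?t) - \<beta> ?t\<bar> \<le> \<zeta>3 ?t" by (simp add: \<zeta>3_def)
        have "\<bar>\<Psi> (?v p)\<bar> * \<bar>weight X (?y + s * ?t) - \<beta> ?t\<bar> \<le> 2 * B * \<zeta>3 ?t"
          using \<Psi>b[of "?v p"] l B_nonneg by (intro mult_mono) auto
        then have "\<Psi> (?v p) * (weight X (?y + s * ?t) - \<beta> ?t) \<le> 2 * B * \<zeta>3 ?t"
          by (simp add: abs_mult[symmetric] abs_le_iff)
        from mult_right_mono[OF this k0[of ?y]]
        show ?thesis by (simp add: \<psi>1_def \<psi>3_def algebra_simps)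
      qed
    qed
    finally show ?thesis .
  qed
  \<comment> \<open>In the inequality \<open>kato\<close> the derivative of the weight, a nonpositive function whose integral is known,
     is multiplied by \<open>s (V - k)\<^sup>+ + \<Psi> V\<close>, which is at least \<open>\<mu> - (G k - Gp)\<close>.\<close>
  have step5: "- I0 - C \<le> ?I (\<lambda>p. \<Psi> (?v p) * \<psi>3 p) + (G k - Gp - \<mu>) * W"
  proof -
    have \<mu>k: "\<mu> \<le> G k - Gp" using \<mu>[of k] by simp
    let ?wt = "\<lambda>p::real \<times> real. wave_t \<epsilon> X s (snd p) (fst p)"
    let ?wx = "\<lambda>p::real \<times> real. wave_x \<epsilon> X s (snd p) (fst p)"
    have st: "smooth_test T (wave \<epsilon> X s) (wave_t \<epsilon> X s) (wave_x \<epsilon> X s)"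
      using smooth_test_wave[OF \<epsilon>(1) X s, of 1 0] by (simp add: T_def)
    obtain K' E where K': "compact K'" "0 \<le> E"
      and E: "\<forall>t\<in>{0..T}. \<forall>x. \<bar>wave \<epsilon> X s t x\<bar> \<le> E \<and> \<bar>wave_t \<epsilon> X s t x\<bar> \<le> E \<and> \<bar>wave_x \<epsilon> X s t x\<bar> \<le> E"
      and z: "\<forall>t\<in>{0..T}. \<forall>x. x \<notin> K' \<longrightarrow> wave \<epsilon> X s t x = 0 \<and> wave_t \<epsilon> X s t x = 0 \<and> wave_x \<epsilon> X s t x = 0"
      and m: "(\<lambda>(x, t). wave \<epsilon> X s t x) \<in> borel_measurable borel" "(\<lambda>(x, t). wave_t \<epsilon> X s t x) \<in> borel_measurable borel"
        "(\<lambda>(x, t). wave_x \<epsilon> X s t x) \<in> borel_measurable borel"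
      by (rule smooth_test_bounded[OF st])
    have wm: "?wt \<in> borel_measurable borel" "?wx \<in> borel_measurable borel"
      using m by (simp_all add: case_prod_unfold)
    have gt: "set_integrable lborel (strip T) (\<lambda>p. g (?v p) * ?wt p)"
      "set_integrable lborel (strip T) (\<lambda>p. g (?v p) * ?wx p)"
      if "g \<in> borel_measurable borel" "\<And>\<xi>. \<bar>g \<xi>\<bar> \<le> a * \<bar>\<xi>\<bar> + c" for g a c
      using set_integrable_growth[OF V_borel V_integrable[OF T K'(1)] that wm(1) K'(1), of E]
        set_integrable_growth[OF V_borel V_integrable[OF T K'(1)] that wm(2) K'(1), of E] E z by auto
    have i1: "set_integrable lborel (strip T) (\<lambda>p. max 0 (?v p - k) * ?wt p)"
      by (rule gt(1)[of "\<lambda>\<xi>. max 0 (\<xi> - k)" 1 "\<bar>k\<bar>"]) auto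
    note i2 = gt(2)[OF \<Psi>m \<Psi>b] note i3 = SI(3)[OF \<Psi>m \<Psi>b]
    have i4: "set_integrable lborel (strip T) ?wt"
      using gt(1)[of "\<lambda>_. 1" 0 1] by simp
    define P where "P = (LINT y|lborel. wave \<epsilon> X s 0 y)"
    have iP: "?I ?wt = - P"
      using smooth_test_integrals(1)[OF st T] by (simp add: P_def case_prod_unfold)
    have P: "P \<le> X / 4"
    proof -
      have h: "integrable lborel (\<lambda>y. weight X (1 * y) * indicator {0..X / 1} y)"
        "(LINT y|lborel. weight X (1 * y) * indicator {0..X / 1} y) = X / 4"
        using integral_weight[OF X, of 1] by (simp_all add: has_bochner_integral_iff)
      have "P \<le> (LINT y|lborel. weight X (1 * y) * indicator {0..X / 1} y)"
        unfolding P_def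
      proof (rule integral_mono'[OF h(1)])
        fix y
        have "step (y / \<epsilon>) * weight X y \<le> 1 * weight X y"
          by (intro mult_right_mono step_bounds weight_nonneg)
        then show "wave \<epsilon> X s 0 y \<le> weight X (1 * y) * indicator {0..X / 1} y"
          using step_eq_0[of "y / \<epsilon>"] \<epsilon>(1) weight_eq_0(1)[OF X, of y]
          by (cases "y \<in> {0..X}") (auto simp: wave_def divide_nonpos_pos not_le)
        show "0 \<le> weight X (1 * y) * indicator {0..X / 1} y" by (simp add: weight_nonneg)
      qed
      then show ?thesis using h(2) by simp
    qed
    have "- I0 - C \<le> ?I (\<lambda>p. max 0 (?v p - k) * ?wt p + \<Psi> (?v p) * ?wx p)"
      using kato[OF \<epsilon>(1) X s, of k] by (simp add: I0_def T_def \<Psi>_def)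
    also have "\<dots> \<le> ?I (\<lambda>p. \<Psi> (?v p) * \<psi>3 p + (\<mu> - (G k - Gp)) / s * ?wt p)"
    proof (rule set_integral_mono[OF set_integral_add(1)[OF i1 i2] set_integral_add(1)[OF i3 set_integrable_mult_right[OF i4]]])
      fix p :: "real \<times> real"
      let ?d = "step (fst p / \<epsilon>) * weight_deriv X (fst p + s * snd p)"
      have d: "?d \<le> 0" using step_bounds weight_deriv_nonpos[OF X] by (simp add: mult_nonneg_nonpos)
      have "\<mu> - (G k - Gp) \<le> s * max 0 (?v p - k) + \<Psi> (?v p)"
        using \<mu>[of "?v p"] \<mu>k by (cases "k < ?v p") (auto simp: \<Psi>_def)
      from mult_right_mono_neg[OF this d]
      have "s * max 0 (?v p - k) * ?d + \<Psi> (?v p) * ?d \<le> (\<mu> - (G k - Gp)) * ?d"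
        by (simp add: algebra_simps)
      moreover have "max 0 (?v p - k) * ?wt p + \<Psi> (?v p) * ?wx p
          = s * max 0 (?v p - k) * ?d + \<Psi> (?v p) * ?d + \<Psi> (?v p) * \<psi>3 p"
        by (simp add: wave_t_def wave_x_def \<psi>3_def algebra_simps)
      moreover have "(\<mu> - (G k - Gp)) / s * ?wt p = (\<mu> - (G k - Gp)) * ?d"
        using s by (simp add: wave_t_def)
      ultimately show "max 0 (?v p - k) * ?wt p + \<Psi> (?v p) * ?wx p
          \<le> \<Psi> (?v p) * \<psi>3 p + (\<mu> - (G k - Gp)) / s * ?wt p" by linarith
    qed
    also have "\<dots> = ?I (\<lambda>p. \<Psi> (?v p) * \<psi>3 p) + (G k - Gp - \<mu>) / s * P"
      unfolding set_integral_add(2)[OF i3 set_integrable_mult_right[OF i4]] set_integral_mult_right iP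
      by (simp add: field_simps)
    also have "(G k - Gp - \<mu>) / s * P \<le> (G k - Gp - \<mu>) / s * (X / 4)"
      using \<mu>k s P by (intro mult_left_mono) auto
    also have "(G k - Gp - \<mu>) / s * (X / 4) = (G k - Gp - \<mu>) * W"
      using s by (simp add: W_def field_simps)
    finally show ?thesis by simp
  qed
  have gW: "(G k - Gp) * \<beta>i \<ge> (G k - Gp) * W - 2 * B * (2 * \<tau>)"
  proof -
    have "\<bar>(G k - Gp) * (\<beta>i - W)\<bar> \<le> 2 * B * (2 * \<tau>)"
      unfolding abs_mult using Gd(2)[of k] \<beta>i_bounds(1) B_nonneg by (intro mult_mono) auto
    then show ?thesis by (simp add: algebra_simps abs_le_iff)
  qed
  have "(G k - Gp - \<mu>) * W = (G k - Gp) * W - \<mu> * W" by (simp add: left_diff_distrib)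
  moreover have "2 * B * (2 * \<tau> + 3 / X * \<epsilon> * T) + 2 * B * (2 * \<tau>) = 8 * B * \<tau> + 6 * B * (\<epsilon> * T / X)"
    by (simp add: algebra_simps)
  ultimately have "\<mu> * W \<le> 3 * C + I0 + 1"
    using step1 step2 step3 step4 step5 gW \<tau>B \<epsilon>B \<eta>(2) by linarith
  then show ?thesis by (simp add: W_def I0_def)
qed

end

lemma truncated_initial_integrable:
  fixes V0 :: "real \<Rightarrow> real"
  assumes V0: "set_integrable lborel {0<..<X} V0"
  shows "set_integrable lborel {0<..<X} (\<lambda>y. max 0 (V0 y - k))"
proof -
  have c: "set_integrable lborel {0<..<X} (\<lambda>y. k)"
    by (cases "0 \<le> X") (simp_all add: set_integrable_def)
  have "set_integrable lborel {0<..<X} (\<lambda>y. (\<bar>V0 y - k\<bar> + (V0 y - k)) / 2)"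
    by (intro set_integrable_divide set_integral_add(1) set_integrable_abs set_integral_diff(1) V0 c)
  moreover have "(\<bar>V0 y - k\<bar> + (V0 y - k)) / 2 = max 0 (V0 y - k)" for y
    by (cases "V0 y \<le> k") auto
  ultimately show ?thesis by simp
qed

context one_sided_problem
begin

text \<open>
  With \<open>m\<close> the minimum of \<open>G - Gp\<close> on \<open>[k, k + n]\<close> and \<open>s = m / n\<close>, one has
  \<open>G \<xi> - Gp + s (\<xi> - k) \<ge> s n\<close> on \<open>[k, k + n]\<close> because of the first summand, and beyond because of the
  second. So \<open>flux_budget\<close> with \<open>X = 1\<close> bounds \<open>n / 4\<close> by a constant.
\<close>

lemma flux_not_eventually_above_limit:
  assumes V0: "\<And>X. set_integrable lborel {0<..<X} V0" and G: "continuous_on UNIV G"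
  shows "\<not> (\<exists>k. \<forall>\<xi>\<ge>k. Gp < G \<xi>)"
proof
  assume "\<exists>k. \<forall>\<xi>\<ge>k. Gp < G \<xi>"
  then obtain k where k: "\<And>\<xi>. k \<le> \<xi> \<Longrightarrow> Gp < G \<xi>" by blast
  define R where "R = 3 * C + (LINT y:{0<..<1}|lborel. max 0 (V0 y - k)) + 1"
  obtain n :: nat where n: "4 * R < real n" "0 < n"
    using reals_Archimedean2[of "max 0 (4 * R)"] by (metis max_less_iff_conj of_nat_0_less_iff)
  have "\<exists>x\<in>{k..k + n}. \<forall>y\<in>{k..k + n}. G x \<le> G y"
    by (intro continuous_attains_inf continuous_on_subset[OF G]) auto
  then obtain x where x: "x \<in> {k..k + n}" "\<forall>y\<in>{k..k + n}. G x \<le> G y" by blast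
  define s where "s = (G x - Gp) / n"
  have s: "0 < s" using k[of x] x(1) n(2) by (simp add: s_def)
  have "s * n * (1 / (4 * s)) \<le> R"
    unfolding R_def
  proof (rule flux_budget[OF _ s])
    fix \<xi> assume \<xi>: "k \<le> \<xi>"
    show "s * n \<le> G \<xi> - Gp + s * (\<xi> - k)"
    proof (cases "\<xi> \<le> k + n")
      case True
      have "s * n = G x - Gp" using n(2) by (simp add: s_def)
      moreover have "0 \<le> s * (\<xi> - k)" using s \<xi> by simp
      moreover have "G x \<le> G \<xi>" using x(2) \<xi> True by simp
      ultimately show ?thesis by linarith
    next
      case False
      then have "s * n \<le> s * (\<xi> - k)" using s by (intro mult_left_mono) auto
      then show ?thesis using k[OF \<xi>] by linarith
    qed
  qed simp
  moreover have "s * n * (1 / (4 * s)) = n / 4" using s by simp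
  ultimately show False using n(1) by simp
qed

lemma truncated_initial_vanishes:
  assumes V0: "set_integrable lborel {0<..<X} V0"
  obtains k0 where "\<forall>k\<ge>k0. (LINT y:{0<..<X}|lborel. max 0 (V0 y - k)) \<le> 1"
proof -
  have i: "integrable lborel (\<lambda>y. indicator {0<..<X} y *\<^sub>R \<bar>V0 y\<bar>)"
    using set_integrable_abs[OF V0] by (simp add: set_integrable_def)
  have "(\<lambda>n. LINT y:{0<..<X}|lborel. max 0 (V0 y - real n)) \<longlonglongrightarrow> (LINT y|(lborel :: real measure). 0)"
    unfolding set_lebesgue_integral_def
  proof (rule integral_dominated_convergence[OF _ _ i])
    show "(\<lambda>y. indicator {0<..<X} y *\<^sub>R max 0 (V0 y - real n)) \<in> borel_measurable lborel" for n
      using truncated_initial_integrable[OF V0, of "real n"] unfolding set_integrable_def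
      by (rule borel_measurable_integrable)
    show "AE y in lborel. (\<lambda>n. indicator {0<..<X} y *\<^sub>R max 0 (V0 y - real n)) \<longlonglongrightarrow> 0"
    proof (rule AE_I2)
      fix y
      obtain N :: nat where N: "V0 y < real N" using reals_Archimedean2 by blast
      have "indicator {0<..<X} y *\<^sub>R max 0 (V0 y - real n) = 0" if "N \<le> n" for n
      proof -
        have "real N \<le> real n" using that by simp
        then show ?thesis using N by simp
      qed
      then show "(\<lambda>n. indicator {0<..<X} y *\<^sub>R max 0 (V0 y - real n)) \<longlonglongrightarrow> 0"
        by (intro tendsto_eventually eventually_sequentiallyI[of N])
    qed
    show "AE y in lborel. norm (indicator {0<..<X} y *\<^sub>R max 0 (V0 y - real n)) \<le> indicator {0<..<X} y *\<^sub>R \<bar>V0 y\<bar>" for n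
      by (intro AE_I2) (auto simp: indicator_def)
  qed simp
  then have "(\<lambda>n. LINT y:{0<..<X}|lborel. max 0 (V0 y - real n)) \<longlonglongrightarrow> 0" by simp
  from order_tendstoD(2)[OF this zero_less_one]
  obtain n where n: "(LINT y:{0<..<X}|lborel. max 0 (V0 y - real n)) < 1"
    by (auto simp: eventually_sequentially)
  have "(LINT y:{0<..<X}|lborel. max 0 (V0 y - k)) \<le> 1" if "real n \<le> k" for k
  proof -
    have "(LINT y:{0<..<X}|lborel. max 0 (V0 y - k)) \<le> (LINT y:{0<..<X}|lborel. max 0 (V0 y - real n))"
      by (rule set_integral_mono[OF truncated_initial_integrable[OF V0] truncated_initial_integrable[OF V0]])
        (use that in auto)
    then show ?thesis using n by simp
  qed
  then show ?thesis using that by blast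
qed

text \<open>
  The bound \<open>M\<close> for the slopes of chords starting at \<open>k\<close> serves as the speed \<open>s\<close>, with \<open>\<mu> = G k - Gp\<close>. For an
  interval of length \<open>X = 4 R / C1\<close> the left-hand side of \<open>flux_budget\<close> would be at least \<open>R\<close>.
\<close>

lemma flux_not_frequently_steep:
  assumes V0: "\<And>X. set_integrable lborel {0<..<X} V0" and C1: "0 < C1"
  shows "\<exists>k0. \<forall>k\<ge>k0. \<forall>M>0. (\<forall>\<xi>\<ge>k. \<bar>G \<xi> - G k\<bar> \<le> M * (\<xi> - k)) \<longrightarrow> G k - Gp < C1 * M"
proof -
  define R where "R = \<bar>3 * C\<bar> + 3"
  define X where "X = 4 * R / C1"
  have X: "0 < X" using C1 by (simp add: X_def R_def)
  obtain k0 where k0: "\<forall>k\<ge>k0. (LINT y:{0<..<X}|lborel. max 0 (V0 y - k)) \<le> 1"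
    by (rule truncated_initial_vanishes[OF V0])
  have "G k - Gp < C1 * M"
    if k: "k0 \<le> k" and M: "0 < M" and lip: "\<forall>\<xi>\<ge>k. \<bar>G \<xi> - G k\<bar> \<le> M * (\<xi> - k)" for k M
  proof (rule ccontr)
    assume "\<not> G k - Gp < C1 * M"
    then have "C1 * M * (X / (4 * M)) \<le> (G k - Gp) * (X / (4 * M))"
      using M X by (intro mult_right_mono) auto
    also have "\<dots> \<le> 3 * C + (LINT y:{0<..<X}|lborel. max 0 (V0 y - k)) + 1"
    proof (rule flux_budget[OF X M])
      fix \<xi> assume "k \<le> \<xi>"
      then have "\<bar>G \<xi> - G k\<bar> \<le> M * (\<xi> - k)" using lip by blast
      then show "G k - Gp \<le> G \<xi> - Gp + M * (\<xi> - k)" by linarith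
    qed
    also have "\<dots> \<le> 3 * C + 2" using k0 k by auto
    finally have "C1 * X / 4 \<le> 3 * C + 2" using M by simp
    moreover have "C1 * X / 4 = R" using C1 by (simp add: X_def)
    ultimately show False by (simp add: R_def)
  qed
  then show ?thesis by blast
qed

end

section \<open>The flux function\<close>

text \<open>
  For a continuous function an essential bound is a bound, because nonempty open sets are not null.
\<close>

lemma W1inf_bounded:
  assumes "W1inf H"
  obtains B where "\<forall>\<xi>. \<bar>H \<xi>\<bar> \<le> B"
proof -
  have c: "continuous_on UNIV H" and n: "Linf_norm UNIV H < \<infinity>" using assms by (auto simp: W1inf_def)
  have ae: "AE x in lborel. ereal \<bar>H x\<bar> \<le> Linf_norm UNIV H"
    using esssup_AE[of "\<lambda>x. ereal \<bar>H x\<bar>" "restrict_space lborel UNIV"]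
    unfolding Linf_norm_def by (subst (asm) AE_restrict_space_iff) auto
  define B where "B = real_of_ereal (Linf_norm UNIV H)"
  have ae': "AE x in lborel. \<bar>H x\<bar> \<le> B"
    using ae
  proof eventually_elim
    case (elim x)
    then show ?case using n unfolding B_def by (cases "Linf_norm UNIV H") auto
  qed
  have o: "open {x. B < \<bar>H x\<bar>}"
    by (intro open_Collect_less continuous_intros c)
  have n: "{x. B < \<bar>H x\<bar>} \<in> null_sets lborel"
    using ae' o by (subst AE_iff_null_sets) (auto simp: not_less borel_open elim: eventually_mono)
  have "{x. B < \<bar>H x\<bar>} = {}"
  proof (rule ccontr)
    assume "{x. B < \<bar>H x\<bar>} \<noteq> {}"
    then obtain x where "x \<in> {x. B < \<bar>H x\<bar>}" by blast
    with o obtain e where e: "0 < e" "ball x e \<subseteq> {x. B < \<bar>H x\<bar>}" by (meson open_contains_ball)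
    have "ball x e \<in> null_sets lborel" by (rule null_sets_subset[OF n _ e(2)]) simp
    then show False using e(1) by (simp add: ball_eq_greaterThanLessThan null_sets_def)
  qed
  then have "\<forall>\<xi>. \<bar>H \<xi>\<bar> \<le> B" by (auto simp: not_less[symmetric])
  then show ?thesis by (rule that)
qed

lemma kern_average:
  assumes H: "continuous_on UNIV H" and Hb: "\<forall>\<xi>. \<bar>H \<xi>\<bar> \<le> B" and e: "0 < \<epsilon>"
    and near: "\<forall>x. a < x \<and> x < a + \<epsilon> \<longrightarrow> \<bar>H x - h\<bar> \<le> \<eta>"
  shows "integrable lborel (\<lambda>x. H x * kern \<epsilon> (x - a))"
    and "\<bar>(LINT x|lborel. H x * kern \<epsilon> (x - a)) - h\<bar> \<le> \<eta>"
proof -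
  have [measurable]: "H \<in> borel_measurable borel" by (rule borel_measurable_continuous_onI[OF H])
  have k: "integrable lborel (\<lambda>x. kern \<epsilon> (x - a))" "(LINT x|lborel. kern \<epsilon> (x - a)) = 1"
    using lborel_integrable_real_affine[OF integral_kern(1)[OF e], of 1 "- a"]
      lborel_integral_real_affine[of 1 "kern \<epsilon>" "- a"] integral_kern(2)[OF e] by auto
  have i: "integrable lborel (\<lambda>x. g x * kern \<epsilon> (x - a))"
    if [measurable]: "g \<in> borel_measurable borel" and gb: "\<And>x. \<bar>g x\<bar> \<le> D" for g D
  proof (rule Bochner_Integration.integrable_bound)
    show "integrable lborel (\<lambda>x. D * kern \<epsilon> (x - a))" using k(1) by simp
    have "0 \<le> D" using gb[of 0] by linarith
    then show "AE x in lborel. norm (g x * kern \<epsilon> (x - a)) \<le> norm (D * kern \<epsilon> (x - a))"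
      using gb kern_nonneg[OF e] by (intro AE_I2) (auto simp: abs_mult intro!: mult_right_mono)
  qed measurable
  show iH: "integrable lborel (\<lambda>x. H x * kern \<epsilon> (x - a))" by (rule i) (use Hb in auto)
  have ih: "integrable lborel (\<lambda>x. h * kern \<epsilon> (x - a))" using k(1) by simp
  have "(LINT x|lborel. H x * kern \<epsilon> (x - a)) - h
      = (LINT x|lborel. H x * kern \<epsilon> (x - a) - h * kern \<epsilon> (x - a))"
    using Bochner_Integration.integral_diff[OF iH ih] k(2) by simp
  also have "\<bar>\<dots>\<bar> \<le> (LINT x|lborel. \<bar>H x * kern \<epsilon> (x - a) - h * kern \<epsilon> (x - a)\<bar>)"
    by (rule integral_abs_bound)
  also have "\<dots> \<le> (LINT x|lborel. \<eta> * kern \<epsilon> (x - a))"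
  proof (rule integral_mono)
    show "integrable lborel (\<lambda>x. \<bar>H x * kern \<epsilon> (x - a) - h * kern \<epsilon> (x - a)\<bar>)"
      using iH ih by simp
    show "integrable lborel (\<lambda>x. \<eta> * kern \<epsilon> (x - a))" using k(1) by simp
    fix x
    show "\<bar>H x * kern \<epsilon> (x - a) - h * kern \<epsilon> (x - a)\<bar> \<le> \<eta> * kern \<epsilon> (x - a)"
    proof (cases "a < x \<and> x < a + \<epsilon>")
      case True
      then have "\<bar>H x - h\<bar> \<le> \<eta>" using near by blast
      from mult_right_mono[OF this, of "kern \<epsilon> (x - a)"]
      show ?thesis using kern_nonneg[OF e, of "x - a"]
        by (simp add: abs_mult left_diff_distrib[symmetric])
    next
      case False
      then have "kern \<epsilon> (x - a) = 0" by (intro kern_eq_0[OF e]) auto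
      then show ?thesis by simp
    qed
  qed
  also have "\<dots> = \<eta>" using k(2) by simp
  finally show "\<bar>(LINT x|lborel. H x * kern \<epsilon> (x - a)) - h\<bar> \<le> \<eta>" .
qed

text \<open>
  The weak derivative is tested with \<open>C\<^sup>1\<close> approximations of the indicator of \<open>[a, b]\<close> supported in
  \<open>[a, b]\<close>; the derivatives of these are approximate identities at \<open>a\<close> and at \<open>b\<close>.
\<close>

lemma weak_derivative_lipschitz:
  assumes H: "continuous_on UNIV H" and Hb: "\<forall>\<xi>. \<bar>H \<xi>\<bar> \<le> B"
    and D: "is_weak_derivative H D" "D \<in> borel_measurable borel"
    and ab: "a < b" and M: "AE x in lborel. a < x \<and> x < b \<longrightarrow> \<bar>D x\<bar> \<le> M"
  shows "\<bar>H b - H a\<bar> \<le> M * (b - a)"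
proof (rule field_le_epsilon)
  fix \<eta> :: real assume \<eta>: "0 < \<eta>"
  have M0: "0 \<le> M"
  proof (rule ccontr)
    assume "\<not> 0 \<le> M"
    then have "AE x in lborel. x \<notin> {a<..<b}"
      using M by (auto elim!: eventually_mono)
    then have "{a<..<b} \<in> null_sets lborel" by (subst AE_iff_null_sets) auto
    then show False using ab by (auto simp: null_sets_def)
  qed
  have "isCont H a" "isCont H b" using H by (auto simp: continuous_on_eq_continuous_at)
  then obtain d1 d2 where d: "0 < d1" "\<And>x. \<bar>x - a\<bar> < d1 \<Longrightarrow> \<bar>H x - H a\<bar> < \<eta> / 2"
    "0 < d2" "\<And>x. \<bar>x - b\<bar> < d2 \<Longrightarrow> \<bar>H x - H b\<bar> < \<eta> / 2"
    using \<eta> unfolding continuous_at_eps_delta dist_real_def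
    by (metis half_gt_zero)
  define \<epsilon> where "\<epsilon> = min (min d1 d2) (b - a)"
  have e: "0 < \<epsilon>" "\<epsilon> \<le> d1" "\<epsilon> \<le> d2" "\<epsilon> \<le> b - a" using d ab by (auto simp: \<epsilon>_def)
  define \<phi> where "\<phi> x = step ((x - a) / \<epsilon>) - step ((x - (b - \<epsilon>)) / \<epsilon>)" for x
  define \<phi>' where "\<phi>' x = kern \<epsilon> (x - a) - kern \<epsilon> (x - (b - \<epsilon>))" for x
  have z: "\<phi> x = 0" if "x \<notin> {a..b}" for x
  proof (cases "x < a")
    case True
    then show ?thesis using e by (simp add: \<phi>_def step_eq_0 divide_nonpos_pos)
  next
    case False
    then have "b < x" using that by simp
    then show ?thesis using e by (simp add: \<phi>_def step_eq_1)
  qed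
  have \<phi>1: "\<bar>\<phi> x\<bar> \<le> 1" for x
    using step_bounds[of "(x - a) / \<epsilon>"] step_bounds[of "(x - (b - \<epsilon>)) / \<epsilon>"] unfolding \<phi>_def by linarith
  have "C1c UNIV \<phi> \<phi>'"
    unfolding C1c_def
  proof (intro conjI allI exI[of _ "{a..b}"])
    show "(\<phi> has_real_derivative \<phi>' x) (at x)" for x
      unfolding \<phi>_def[abs_def] \<phi>'_def kern_def using e(1)
      by (auto intro!: derivative_eq_intros simp: diff_divide_distrib)
    show "continuous_on UNIV \<phi>'"
      unfolding \<phi>'_def[abs_def] using e(1) by (intro continuous_intros) auto
  qed (use z in auto)
  then have w: "(LINT x|lborel. H x * \<phi>' x) = - (LINT x|lborel. D x * \<phi> x)"
    using D(1) by (auto simp: is_weak_derivative_def)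
  have "\<forall>x. a < x \<and> x < a + \<epsilon> \<longrightarrow> \<bar>H x - H a\<bar> \<le> \<eta> / 2"
    using d(2) e(2) by (auto intro!: less_imp_le)
  note ia = kern_average[OF H Hb e(1) this]
  have "\<forall>x. b - \<epsilon> < x \<and> x < b - \<epsilon> + \<epsilon> \<longrightarrow> \<bar>H x - H b\<bar> \<le> \<eta> / 2"
    using d(4) e(3) by (auto intro!: less_imp_le)
  note ib = kern_average[OF H Hb e(1) this]
  have "(LINT x|lborel. H x * \<phi>' x) = (LINT x|lborel. H x * kern \<epsilon> (x - a)) - (LINT x|lborel. H x * kern \<epsilon> (x - (b - \<epsilon>)))"
    unfolding \<phi>'_def right_diff_distrib by (rule Bochner_Integration.integral_diff[OF ia(1) ib(1)])
  moreover have "\<bar>LINT x|lborel. D x * \<phi> x\<bar> \<le> M * (b - a)"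
  proof -
    have "\<bar>LINT x|lborel. D x * \<phi> x\<bar> \<le> (LINT x|lborel. \<bar>D x * \<phi> x\<bar>)" by (rule integral_abs_bound)
    also have "\<dots> \<le> (LINT x|lborel. M * indicator {a..b} x)"
    proof (rule integral_mono_AE')
      show "integrable lborel (\<lambda>x. M * indicator {a..b} x)" using ab by simp
      show "AE x in lborel. \<bar>D x * \<phi> x\<bar> \<le> M * indicator {a..b} x"
        using M AE_lborel_singleton[of a] AE_lborel_singleton[of b]
      proof eventually_elim
        case (elim x)
        show ?case
        proof (cases "x \<in> {a..b}")
          case True
          then have "\<bar>D x\<bar> \<le> M" using elim by auto
          from mult_mono[OF this \<phi>1[of x] M0] True show ?thesis by (simp add: abs_mult)
        qed (simp add: z)
      qed
    qed (use M0 in simp)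
    also have "\<dots> = M * (b - a)" using ab by simp
    finally show ?thesis .
  qed
  ultimately show "\<bar>H b - H a\<bar> \<le> M * (b - a) + \<eta>"
    using w ia(2) ib(2) by linarith
qed

lemma Linf_norm_AE:
  assumes D: "is_bounded_weak_derivative H D" and S: "S \<in> sets borel"
  shows "AE x in lborel. x \<in> S \<longrightarrow> \<bar>D x\<bar> \<le> real_of_ereal (Linf_norm S D)"
proof -
  have Dm[measurable]: "D \<in> borel_measurable borel" and fin: "Linf_norm UNIV D < \<infinity>"
    using D by (auto simp: is_bounded_weak_derivative_def)
  have ae: "AE x in lborel. x \<in> A \<longrightarrow> ereal \<bar>D x\<bar> \<le> Linf_norm A D" if "A \<in> sets borel" for A
    using esssup_AE[of "\<lambda>x. ereal \<bar>D x\<bar>" "restrict_space lborel A"] that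
    unfolding Linf_norm_def by (subst (asm) AE_restrict_space_iff) auto
  have "Linf_norm S D \<le> Linf_norm UNIV D"
    unfolding Linf_norm_def[of S]
  proof (rule esssup_I)
    show "(\<lambda>x. ereal \<bar>D x\<bar>) \<in> borel_measurable (restrict_space lborel S)"
      by (intro measurable_restrict_space1) measurable
    show "AE x in restrict_space lborel S. ereal \<bar>D x\<bar> \<le> Linf_norm UNIV D"
      using ae[of UNIV] S by (subst AE_restrict_space_iff) (auto elim: eventually_mono)
  qed
  then have "Linf_norm S D < \<infinity>" using fin by (rule le_less_trans)
  with ae[OF S] show ?thesis
    by (cases "Linf_norm S D") (auto elim!: eventually_mono)
qed

section \<open>Reflections and the compatibility condition\<close>

lemma lborel_reflect:
  assumes "\<theta> = 1 \<or> \<theta> = (-1 :: real)"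
  shows "distr lborel borel (\<lambda>y. a + \<theta> * y) = (lborel :: real measure)"
proof -
  have "\<theta> \<noteq> 0" "ennreal \<bar>\<theta>\<bar> = 1" using assms by auto
  then show ?thesis using lborel_real_affine[of \<theta> a] by (simp add: density_1)
qed

lemma lborel_reflect_plane:
  assumes \<theta>: "\<theta> = 1 \<or> \<theta> = (-1 :: real)"
  shows "(\<lambda>p::real \<times> real. (a + \<theta> * fst p, snd p :: real)) \<in> borel_measurable borel"
    and "distr lborel borel (\<lambda>p. (a + \<theta> * fst p, snd p)) = (lborel :: (real \<times> real) measure)"
proof -
  show m: "(\<lambda>p::real \<times> real. (a + \<theta> * fst p, snd p :: real)) \<in> borel_measurable borel"
    by (intro borel_measurable_continuous_onI continuous_intros)
  have i: "distr lborel borel (\<lambda>t. t) = (lborel :: real measure)"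
    using distr_cong[of lborel lborel borel lborel "\<lambda>t. t" "\<lambda>t. t"] by (simp add: distr_id)
  have "sigma_finite_measure (distr lborel borel (\<lambda>t::real. t))"
    unfolding i by (rule lborel.sigma_finite_measure_axioms)
  note pd = pair_measure_distr[OF _ _ this, of "\<lambda>y. a + \<theta> * y" lborel borel,
      unfolded lborel_reflect[OF \<theta>] i]
  have e: "lborel \<Otimes>\<^sub>M lborel = distr (lborel \<Otimes>\<^sub>M lborel) (borel \<Otimes>\<^sub>M borel) (\<lambda>(y, t). (a + \<theta> * y, t :: real))"
    by (rule pd) measurable
  have "distr lborel borel (\<lambda>p. (a + \<theta> * fst p, snd p))
      = distr (lborel \<Otimes>\<^sub>M lborel) (borel \<Otimes>\<^sub>M borel) (\<lambda>(y, t). (a + \<theta> * y, t :: real))"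
    by (simp only: lborel_prod borel_prod case_prod_unfold)
  also have "\<dots> = lborel \<Otimes>\<^sub>M lborel" by (rule e[symmetric])
  also have "\<dots> = lborel" by (rule lborel_prod)
  finally show "distr lborel borel (\<lambda>p. (a + \<theta> * fst p, snd p)) = (lborel :: (real \<times> real) measure)" .
qed

lemma strip_reflect:
  fixes f :: "real \<times> real \<Rightarrow> real"
  assumes \<theta>: "\<theta> = 1 \<or> \<theta> = (-1 :: real)" and f: "set_integrable lborel (strip T) f"
  shows "set_integrable lborel (strip T) (\<lambda>p. f (a + \<theta> * fst p, snd p))"
    and "(LINT p:strip T|lborel. f (a + \<theta> * fst p, snd p)) = (LINT p:strip T|lborel. f p)"
proof -
  let ?R = "\<lambda>p::real \<times> real. (a + \<theta> * fst p, snd p)"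
  let ?g = "\<lambda>p. indicator (strip T) p *\<^sub>R f p"
  have R: "?R \<in> measurable lborel borel" using lborel_reflect_plane(1)[OF \<theta>] by simp
  have g: "?g \<in> borel_measurable borel"
    using borel_measurable_integrable[OF f[unfolded set_integrable_def]] by simp
  have e: "?g (?R p) = indicator (strip T) p *\<^sub>R f (?R p)" for p
    by (cases p) (simp add: indicator_strip)
  show "set_integrable lborel (strip T) (\<lambda>p. f (?R p))"
    using f integrable_distr_eq[OF R g] unfolding lborel_reflect_plane(2)[OF \<theta>] e
    by (simp add: set_integrable_def)
  show "(LINT p:strip T|lborel. f (?R p)) = (LINT p:strip T|lborel. f p)"
    using integral_distr[OF R g] unfolding lborel_reflect_plane(2)[OF \<theta>] e
    by (simp add: set_lebesgue_integral_def)
qed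

lemma ess_at_rightD:
  assumes "eventually P (ess_at_right a)"
  shows "\<exists>\<delta>>0. AE x in lborel. a < x \<and> x < a + \<delta> \<longrightarrow> P x"
proof -
  obtain Q R where Q: "eventually Q (at_right a)" and R: "AE x in lborel. R x"
    and P: "\<And>x. Q x \<Longrightarrow> R x \<Longrightarrow> P x"
    using assms unfolding ess_at_right_def eventually_inf by blast
  obtain b where "a < b" "\<And>x. a < x \<Longrightarrow> x < b \<Longrightarrow> Q x"
    using Q unfolding eventually_at_right_field by blast
  then show ?thesis
    using R P by (intro exI[of _ "b - a"]) (auto elim!: eventually_mono)
qed

lemma ess_at_leftD:
  assumes "eventually P (ess_at_left a)"
  shows "\<exists>\<delta>>0. AE x in lborel. a - \<delta> < x \<and> x < a \<longrightarrow> P x"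
proof -
  obtain Q R where Q: "eventually Q (at_left a)" and R: "AE x in lborel. R x"
    and P: "\<And>x. Q x \<Longrightarrow> R x \<Longrightarrow> P x"
    using assms unfolding ess_at_left_def eventually_inf by blast
  obtain b where "b < a" "\<And>x. b < x \<Longrightarrow> x < a \<Longrightarrow> Q x"
    using Q unfolding eventually_at_left_field by blast
  then show ?thesis
    using R P by (intro exI[of _ "a - b"]) (auto elim!: eventually_mono)
qed

text \<open>
  An infinite waiting time means that the compatibility condition admits all test functions with
  compact support in \<open>(0, \<infinity>)\<close>.
\<close>

lemma compatibility_two_sided:
  fixes k :: real
  assumes cc: "compatibility_condition H u ur a c" and inf: "waiting_time u a = top"
    and \<beta>: "C1c {0<..} \<beta> \<beta>'" "\<And>t. 0 \<le> \<beta> t" and \<eta>: "0 < \<eta>"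
  defines "F \<equiv> entropy_flux_integral (if c > 0 then sgn_minus else sgn_plus) H ur {0<..} k \<beta>"
  shows "\<exists>\<delta>>0. AE x in lborel. (a < x \<and> x < a + \<delta> \<longrightarrow> F x \<le> \<eta>) \<and> (a - \<delta> < x \<and> x < a \<longrightarrow> - \<eta> \<le> F x)"
proof -
  have I: "{t. 0 < t \<and> ennreal t < waiting_time u a} = {0<..}"
    using inf by auto
  obtain L1 L2 where L: "L1 \<le> 0" "(F \<longlongrightarrow> L1) (ess_at_right a)" "0 \<le> L2" "(F \<longlongrightarrow> L2) (ess_at_left a)"
    using cc \<beta> unfolding compatibility_condition_def Let_def I F_def by blast
  obtain d1 where d1: "0 < d1" "AE x in lborel. a < x \<and> x < a + d1 \<longrightarrow> F x < \<eta>"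
    using ess_at_rightD[OF order_tendstoD(2)[OF L(2), of \<eta>]] L(1) \<eta> by auto
  obtain d2 where d2: "0 < d2" "AE x in lborel. a - d2 < x \<and> x < a \<longrightarrow> - \<eta> < F x"
    using ess_at_leftD[OF order_tendstoD(1)[OF L(4), of "- \<eta>"]] L(3) \<eta> by auto
  have "AE x in lborel. (a < x \<and> x < a + min d1 d2 \<longrightarrow> F x \<le> \<eta>) \<and> (a - min d1 d2 < x \<and> x < a \<longrightarrow> - \<eta> \<le> F x)"
    using d1(2) d2(2) by eventually_elim auto
  then show ?thesis using d1(1) d2(1) by (intro exI[of _ "min d1 d2"]) auto
qed

text \<open>
  The common form of the hypotheses on the flux at \<open>+\<infinity>\<close> and, after the substitution \<open>u \<mapsto> - u\<close>, at
  \<open>-\<infinity>\<close>. It is symmetric in the sign of \<open>h - hp\<close>, which decides between the two sides of the atom.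
\<close>

definition nondegenerate_at_infinity :: "(real \<Rightarrow> real) \<Rightarrow> real \<Rightarrow> bool" where
  "nondegenerate_at_infinity h hp \<longleftrightarrow>
     (\<exists>k. (\<forall>\<xi>\<ge>k. hp < h \<xi>) \<or> (\<forall>\<xi>\<ge>k. h \<xi> < hp)) \<or>
     (\<exists>C1>0. \<forall>k0. \<exists>k\<ge>k0. \<exists>M>0. C1 * M \<le> \<bar>h k - hp\<bar> \<and> (\<forall>\<xi>\<ge>k. \<bar>h \<xi> - h k\<bar> \<le> M * (\<xi> - k)))"

context measure_solution
begin

lemma initial_reflected_integrable:
  assumes \<theta>: "\<theta> = 1 \<or> \<theta> = (-1 :: real)"
  shows "set_integrable lborel {0<..<X} (\<lambda>y. \<sigma> * ac_density u0 (a + \<theta> * y))"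
proof -
  let ?K = "{a - \<bar>X\<bar>..a + \<bar>X\<bar>}"
  have "integrable lborel (\<lambda>x. indicator ?K x *\<^sub>R ac_density u0 x)"
    using lebesgue_decompositionD(3)[OF initial_parts, of ?K] by (simp add: set_integrable_def)
  from lborel_integrable_real_affine[OF this, of \<theta> a]
  have "integrable lborel (\<lambda>y. indicator ?K (a + \<theta> * y) *\<^sub>R ac_density u0 (a + \<theta> * y))"
    using \<theta> by auto
  moreover have "indicat_real ?K (a + \<theta> * y) = indicator {- \<bar>X\<bar>..\<bar>X\<bar>} y" for y
    using \<theta> by (auto simp: indicator_def)
  ultimately have "set_integrable lborel {- \<bar>X\<bar>..\<bar>X\<bar>} (\<lambda>y. ac_density u0 (a + \<theta> * y))"
    by (simp add: set_integrable_def)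
  then have "set_integrable lborel {0<..<X} (\<lambda>y. ac_density u0 (a + \<theta> * y))"
    by (rule set_integrable_subset) auto
  then show ?thesis by (intro set_integrable_mult_right)
qed

text \<open>
  The substitution preserves the equation: \<open>\<sigma>\<close> reflects values and \<open>\<theta>\<close> reflects space, each reversing the
  sign of the flux. It maps the compatibility condition for negative masses, stated with \<open>sgn_plus\<close>, to
  the one for positive masses, and \<open>\<theta> = -1\<close> exchanges the two one-sided limits.
\<close>

lemma one_sided:
  assumes cc: "compatibility_condition H u ur a c0" and inf: "waiting_time u a = top"
    and \<sigma>: "(\<sigma> = 1 \<and> 0 < c0) \<or> (\<sigma> = -1 \<and> c0 < 0)" and \<theta>: "\<theta> = 1 \<or> \<theta> = (-1 :: real)"
    and lim: "((\<lambda>\<xi>. \<sigma> * H (\<sigma> * \<xi>)) \<longlongrightarrow> hp) at_top"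
  shows "one_sided_problem (\<lambda>t y. \<sigma> * ur t (a + \<theta> * y)) (\<lambda>\<xi>. \<theta> * (\<sigma> * H (\<sigma> * \<xi>)))
      (\<lambda>y. \<sigma> * ac_density u0 (a + \<theta> * y)) (\<theta> * hp) total_mass B"
proof
  have \<sigma>1: "\<sigma> = 1 \<or> \<sigma> = -1" using \<sigma> by auto
  have \<sigma>2: "\<sigma> * (\<sigma> * z) = z" "\<sigma> * \<sigma> = 1" for z using \<sigma>1 by auto
  have \<theta>2: "\<theta> * (\<theta> * z) = z" "\<theta> * \<theta> = 1" for z using \<theta> by auto
  note R = lborel_reflect_plane(1)[OF \<theta>, of a]
  have Rm: "(\<lambda>p. f (a + \<theta> * fst p, snd p)) \<in> borel_measurable borel" if "f \<in> borel_measurable borel"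
    for f :: "real \<times> real \<Rightarrow> real"
    by (rule measurable_compose[OF R that])
  show "(\<lambda>p. \<sigma> * ur (snd p) (a + \<theta> * fst p)) \<in> borel_measurable borel"
    using Rm[OF ur_borel] by simp
  show "set_integrable lborel (strip T) (\<lambda>p. indicator K (fst p) * (\<sigma> * ur (snd p) (a + \<theta> * fst p)))"
    if T: "0 < T" and K: "compact K" for T K
  proof -
    let ?K = "(\<lambda>y. a + \<theta> * y) ` K"
    have K': "compact ?K" by (intro compact_continuous_image K continuous_intros)
    have e: "indicat_real ?K (a + \<theta> * y) = indicator K y" for y
      using \<theta> by (auto simp: indicator_def)
    have "set_integrable lborel (strip T) (\<lambda>p. \<sigma> * (indicator ?K (a + \<theta> * fst p) * ur (snd p) (a + \<theta> * fst p)))"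
      using strip_reflect(1)[OF \<theta> ur_integrable[OF T K']] by (intro set_integrable_mult_right) simp
    then show ?thesis by (simp add: e mult.left_commute)
  qed
  show "(\<lambda>\<xi>. \<theta> * (\<sigma> * H (\<sigma> * \<xi>))) \<in> borel_measurable borel" by measurable
  show "\<bar>\<theta> * (\<sigma> * H (\<sigma> * \<xi>))\<bar> \<le> B" for \<xi> using \<theta> \<sigma>1 H_bound[of "\<sigma> * \<xi>"] by (auto simp: abs_mult)
  show "((\<lambda>\<xi>. \<theta> * (\<sigma> * H (\<sigma> * \<xi>))) \<longlongrightarrow> \<theta> * hp) at_top" by (rule tendsto_mult_left[OF lim])
  show "\<bar>LINT p:strip T|lborel. \<sigma> * ur (snd p) (a + \<theta> * fst p) * (bump 0 \<epsilon> (fst p) * \<beta>' (snd p))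
        + (\<theta> * (\<sigma> * H (\<sigma> * (\<sigma> * ur (snd p) (a + \<theta> * fst p)))) - \<theta> * hp)
          * ((kern \<epsilon> (- fst p) - kern \<epsilon> (fst p)) * \<beta> (snd p))\<bar> \<le> total_mass * b 0"
    if T: "0 < T" and e: "0 < \<epsilon>"
      and \<beta>: "\<And>t. (\<beta> has_real_derivative \<beta>' t) (at t)" "continuous_on UNIV \<beta>'" "\<beta> 0 = 0" "\<beta> T = 0"
      and b: "\<And>t. (b has_real_derivative b' t) (at t)" "continuous_on UNIV b'" "b T = 0"
      and le: "\<And>t. t \<in> {0..T} \<Longrightarrow> \<bar>\<beta>' t\<bar> \<le> - b' t" and nn: "\<And>t. t \<in> {0..T} \<Longrightarrow> 0 \<le> b t"
    for T \<epsilon> \<beta> \<beta>' b b'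
  proof -
    let ?f = "\<lambda>p. ur (snd p) (fst p) * (bump a \<epsilon> (fst p) * \<beta>' (snd p))
      + (H (ur (snd p) (fst p)) - \<sigma> * hp) * ((kern \<epsilon> (a - fst p) - kern \<epsilon> (fst p - a)) * \<beta> (snd p))"
    note Z = smooth_test_product[OF e \<beta>(1,2,4), of a]
    have m: "(\<lambda>\<xi>::real. \<xi>) \<in> borel_measurable borel" by simp
    have g1: "\<bar>\<xi>\<bar> \<le> 1 * \<bar>\<xi>\<bar> + 0" "\<bar>H \<xi>\<bar> \<le> 0 * \<bar>\<xi>\<bar> + B" for \<xi> using H_bound by auto
    have i: "set_integrable lborel (strip T) ?f"
      using subtract_constant(1)[OF T Z m H_borel g1, where m = 0 and q = "\<sigma> * hp"]
      by (simp add: case_prod_unfold)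
    have bu: "bump a \<epsilon> (a + \<theta> * y) = bump 0 \<epsilon> y" for y using \<theta> by (auto simp: bump_def)
    have kn: "kern \<epsilon> (a - (a + \<theta> * y)) - kern \<epsilon> (a + \<theta> * y - a) = \<theta> * (kern \<epsilon> (- y) - kern \<epsilon> y)" for y
      using \<theta> by auto
    have eq: "\<sigma> * ur (snd p) (a + \<theta> * fst p) * (bump 0 \<epsilon> (fst p) * \<beta>' (snd p))
        + (\<theta> * (\<sigma> * H (\<sigma> * (\<sigma> * ur (snd p) (a + \<theta> * fst p)))) - \<theta> * hp)
          * ((kern \<epsilon> (- fst p) - kern \<epsilon> (fst p)) * \<beta> (snd p)) = \<sigma> * ?f (a + \<theta> * fst p, snd p)" for p
      unfolding fst_conv snd_conv bu kn \<sigma>2(1) by (rule disjE[OF \<sigma>1]) (simp_all add: algebra_simps)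
    have "\<bar>LINT p:strip T|lborel. ?f p\<bar> \<le> total_mass * b 0"
      using flux_through_bump[OF T e \<beta> b le nn, of a "\<sigma> * hp"] by (simp add: case_prod_unfold)
    then show ?thesis
      unfolding eq set_integral_mult_right strip_reflect(2)[OF \<theta> i] using \<sigma>1 by (auto simp: abs_mult)
  qed
  show "- (LINT y:{0<..<X}|lborel. max 0 (\<sigma> * ac_density u0 (a + \<theta> * y) - k)) - total_mass
    \<le> (LINT p:strip (X / s)|lborel. max 0 (\<sigma> * ur (snd p) (a + \<theta> * fst p) - k) * wave_t \<epsilon> X s (snd p) (fst p)
        + (if k < \<sigma> * ur (snd p) (a + \<theta> * fst p) then \<theta> * (\<sigma> * H (\<sigma> * (\<sigma> * ur (snd p) (a + \<theta> * fst p)))) - \<theta> * (\<sigma> * H (\<sigma> * k)) else 0)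
          * wave_x \<epsilon> X s (snd p) (fst p))"
    if e: "0 < \<epsilon>" and X: "0 < X" and s: "0 < s" for \<epsilon> X s k
  proof -
    have T: "0 < X / s" using X s by simp
    have eps: "step (y / \<epsilon>) = 0" if "y \<le> 0" for y using that e by (simp add: step_eq_0 divide_nonpos_pos)
    note st = smooth_test_wave[OF e X s \<theta>, of a]
    have nn: "\<forall>t\<in>{0..X / s}. \<forall>x. 0 \<le> wave \<epsilon> X s t (\<theta> * (x - a))"
      by (simp add: wave_def step_bounds weight_nonneg)
    have np: "\<forall>t\<in>{0..X / s}. \<forall>x. wave_t \<epsilon> X s t (\<theta> * (x - a)) \<le> 0"
      using weight_deriv_nonpos[OF X] s by (simp add: wave_t_def step_bounds mult_nonneg_nonpos)
    have wb: "wave \<epsilon> X s 0 y \<le> indicator {0<..<X} y" for y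
    proof (cases "y \<in> {0<..<X}")
      case True
      then show ?thesis
        using mult_mono[of "step (y / \<epsilon>)" 1 "weight X y" 1] step_bounds weight_le_1[OF X, of y] weight_nonneg
        by (simp add: wave_def)
    next
      case False
      then show ?thesis
        using eps[of y] weight_eq_0(1)[OF X, of y] by (cases "y \<le> 0") (auto simp: wave_def)
    qed
    let ?r = "ac_density u0"
    let ?g1 = "\<lambda>\<xi>. max 0 (\<sigma> * (\<xi> - \<sigma> * k))"
    let ?g2 = "\<lambda>\<xi>. if 0 < \<sigma> * (\<xi> - \<sigma> * k) then \<sigma> * (H \<xi> - H (\<sigma> * k)) else 0"
    let ?f = "\<lambda>p. ?g1 (ur (snd p) (fst p)) * wave_t \<epsilon> X s (snd p) (\<theta> * (fst p - a))
      + ?g2 (ur (snd p) (fst p)) * (\<theta> * wave_x \<epsilon> X s (snd p) (\<theta> * (fst p - a)))"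
    have i: "set_integrable lborel (strip (X / s)) ?f"
    proof -
      have gm: "?g1 \<in> borel_measurable borel" "?g2 \<in> borel_measurable borel" by measurable
      have gb: "\<bar>?g1 \<xi>\<bar> \<le> 1 * \<bar>\<xi>\<bar> + \<bar>k\<bar>" "\<bar>?g2 \<xi>\<bar> \<le> 0 * \<bar>\<xi>\<bar> + 2 * B" for \<xi>
        using \<sigma>1 H_bound[of \<xi>] H_bound[of "\<sigma> * k"] by auto
      show ?thesis
        using subtract_constant(1)[OF T st gm gb, where m = 0 and q = 0] by (simp only: case_prod_unfold diff_zero)
    qed
    have E: "- (LINT x|lborel. ?g1 (?r x) * wave \<epsilon> X s 0 (\<theta> * (x - a))) - (\<Sum>i=1..p. \<bar>c i\<bar> * wave \<epsilon> X s 0 (\<theta> * (x i - a)))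
        \<le> (LINT p:strip (X / s)|lborel. ?f p)"
      using truncated_entropy_inequality[OF T st nn np \<sigma>1, of "\<sigma> * k"] by (simp only: case_prod_unfold)
    have g1: "?g1 \<xi> = max 0 (\<sigma> * \<xi> - k)" for \<xi> using \<sigma>1 by auto
    have "(LINT x|lborel. ?g1 (?r x) * wave \<epsilon> X s 0 (\<theta> * (x - a)))
        = (LINT y|lborel. ?g1 (?r (a + \<theta> * y)) * wave \<epsilon> X s 0 (\<theta> * (a + \<theta> * y - a)))"
      using lborel_integral_real_affine[of \<theta> "\<lambda>x. ?g1 (?r x) * wave \<epsilon> X s 0 (\<theta> * (x - a))" a] \<theta> by auto
    also have "\<dots> = (LINT y|lborel. max 0 (\<sigma> * ?r (a + \<theta> * y) - k) * wave \<epsilon> X s 0 y)"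
      unfolding g1 by (simp add: \<theta>2)
    also have "\<dots> \<le> (LINT y:{0<..<X}|lborel. max 0 (\<sigma> * ?r (a + \<theta> * y) - k))"
      unfolding set_lebesgue_integral_def
    proof (rule integral_mono')
      show "integrable lborel (\<lambda>y. indicator {0<..<X} y *\<^sub>R max 0 (\<sigma> * ?r (a + \<theta> * y) - k))"
        using truncated_initial_integrable[OF initial_reflected_integrable[OF \<theta>]]
        by (simp add: set_integrable_def)
      fix y
      show "max 0 (\<sigma> * ?r (a + \<theta> * y) - k) * wave \<epsilon> X s 0 y \<le> indicator {0<..<X} y *\<^sub>R max 0 (\<sigma> * ?r (a + \<theta> * y) - k)"
        using mult_left_mono[OF wb[of y], of "max 0 (\<sigma> * ?r (a + \<theta> * y) - k)"] by (simp add: mult.commute)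
    qed simp
    finally have I0: "(LINT x|lborel. ?g1 (?r x) * wave \<epsilon> X s 0 (\<theta> * (x - a)))
        \<le> (LINT y:{0<..<X}|lborel. max 0 (\<sigma> * ?r (a + \<theta> * y) - k))" .
    have A: "(\<Sum>i=1..p. \<bar>c i\<bar> * wave \<epsilon> X s 0 (\<theta> * (x i - a))) \<le> total_mass"
      unfolding total_mass_def
    proof (rule sum_mono)
      fix i
      have "wave \<epsilon> X s 0 (\<theta> * (x i - a)) \<le> 1"
        by (rule order_trans[OF wb]) (simp add: indicator_def)
      from mult_left_mono[OF this, of "\<bar>c i\<bar>"]
      show "\<bar>c i\<bar> * wave \<epsilon> X s 0 (\<theta> * (x i - a)) \<le> \<bar>c i\<bar>" by simp
    qed
    have eq: "max 0 (\<sigma> * ur (snd p) (a + \<theta> * fst p) - k) * wave_t \<epsilon> X s (snd p) (fst p)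
        + (if k < \<sigma> * ur (snd p) (a + \<theta> * fst p) then \<theta> * (\<sigma> * H (\<sigma> * (\<sigma> * ur (snd p) (a + \<theta> * fst p)))) - \<theta> * (\<sigma> * H (\<sigma> * k)) else 0)
          * wave_x \<epsilon> X s (snd p) (fst p) = ?f (a + \<theta> * fst p, snd p)" for p
    proof -
      have y: "\<theta> * (a + \<theta> * fst p - a) = fst p" by (simp add: \<theta>2)
      have k: "0 < \<sigma> * (v - \<sigma> * k) \<longleftrightarrow> k < \<sigma> * v" for v using \<sigma>1 by auto
      show ?thesis
        unfolding fst_conv snd_conv y k g1 \<sigma>2(1) by (simp add: algebra_simps)
    qed
    show ?thesis
      unfolding eq strip_reflect(2)[OF \<theta> i] using E I0 A by linarith
  qed
  show "\<exists>\<delta>>0. AE y in lborel.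
      (0 < y \<and> y < \<delta> \<longrightarrow> (LINT t:{0<..}|lborel. sgn_minus (\<sigma> * ur t (a + \<theta> * y) - k)
          * (\<theta> * (\<sigma> * H (\<sigma> * (\<sigma> * ur t (a + \<theta> * y)))) - \<theta> * (\<sigma> * H (\<sigma> * k))) * \<beta> t) \<le> \<eta>) \<and>
      (- \<delta> < y \<and> y < 0 \<longrightarrow> - \<eta> \<le> (LINT t:{0<..}|lborel. sgn_minus (\<sigma> * ur t (a + \<theta> * y) - k)
          * (\<theta> * (\<sigma> * H (\<sigma> * (\<sigma> * ur t (a + \<theta> * y)))) - \<theta> * (\<sigma> * H (\<sigma> * k))) * \<beta> t))"
    if \<beta>: "C1c {0<..} \<beta> \<beta>'" "\<And>t. 0 \<le> \<beta> t" and \<eta>: "0 < \<eta>" for k \<beta> \<beta>' \<eta>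
  proof -
    define F where "F = entropy_flux_integral (if c0 > 0 then sgn_minus else sgn_plus) H ur {0<..} (\<sigma> * k) \<beta>"
    have sg: "sgn_minus (\<sigma> * v - k) * (\<theta> * (\<sigma> * H (\<sigma> * (\<sigma> * v))) - \<theta> * (\<sigma> * H (\<sigma> * k)))
      = \<theta> * ((if c0 > 0 then sgn_minus else sgn_plus) (v - \<sigma> * k) * (H v - H (\<sigma> * k)))" for v
      using \<sigma> by (auto simp: sgn_minus_def sgn_plus_def indicator_def algebra_simps)
    have eq: "(LINT t:{0<..}|lborel. sgn_minus (\<sigma> * ur t (a + \<theta> * y) - k)
          * (\<theta> * (\<sigma> * H (\<sigma> * (\<sigma> * ur t (a + \<theta> * y)))) - \<theta> * (\<sigma> * H (\<sigma> * k))) * \<beta> t) = \<theta> * F (a + \<theta> * y)" for y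
      unfolding sg F_def entropy_flux_integral_def by (simp only: mult.assoc set_integral_mult_right)
    obtain \<delta> where \<delta>: "0 < \<delta>" and ae: "AE x in lborel. (a < x \<and> x < a + \<delta> \<longrightarrow> F x \<le> \<eta>) \<and> (a - \<delta> < x \<and> x < a \<longrightarrow> - \<eta> \<le> F x)"
      using compatibility_two_sided[OF cc inf \<beta> \<eta>, of "\<sigma> * k"] unfolding F_def by blast
    have m: "(\<lambda>y. a + \<theta> * y) \<in> measurable lborel borel" by measurable
    have "AE y in lborel. (a < a + \<theta> * y \<and> a + \<theta> * y < a + \<delta> \<longrightarrow> F (a + \<theta> * y) \<le> \<eta>)
        \<and> (a - \<delta> < a + \<theta> * y \<and> a + \<theta> * y < a \<longrightarrow> - \<eta> \<le> F (a + \<theta> * y))"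
      by (rule AE_distrD[OF m]) (unfold lborel_reflect[OF \<theta>], rule ae)
    then have "AE y in lborel. (0 < y \<and> y < \<delta> \<longrightarrow> \<theta> * F (a + \<theta> * y) \<le> \<eta>) \<and> (- \<delta> < y \<and> y < 0 \<longrightarrow> - \<eta> \<le> \<theta> * F (a + \<theta> * y))"
      by eventually_elim (use \<theta> in auto)
    then show ?thesis unfolding eq using \<delta> by blast
  qed
qed


text \<open>
  The estimates on the right of the atom (\<open>\<theta> = 1\<close>) exclude that the flux is above its limit in the
  sense of nondegeneracy, those on the left (\<open>\<theta> = -1\<close>) that it is below.
\<close>

lemma waiting_time_finite:
  assumes cc: "compatibility_condition H u ur a c0"
    and \<sigma>: "(\<sigma> = 1 \<and> 0 < c0) \<or> (\<sigma> = -1 \<and> c0 < 0)"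
    and lim: "((\<lambda>\<xi>. \<sigma> * H (\<sigma> * \<xi>)) \<longlongrightarrow> hp) at_top"
    and nd: "nondegenerate_at_infinity (\<lambda>\<xi>. \<sigma> * H (\<sigma> * \<xi>)) hp"
  shows "waiting_time u a < \<infinity>"
proof (rule ccontr)
  assume "\<not> waiting_time u a < \<infinity>"
  then have inf: "waiting_time u a = top" using top.not_eq_extremum[of "waiting_time u a"] by auto
  let ?h = "\<lambda>\<xi>. \<sigma> * H (\<sigma> * \<xi>)"
  have c: "continuous_on UNIV (\<lambda>\<xi>. \<theta> * ?h \<xi>)" for \<theta>
    by (intro continuous_on_mult continuous_on_const continuous_on_compose2[OF H_cont] continuous_on_id) auto
  have p1: "one_sided_problem (\<lambda>t y. \<sigma> * ur t (a + 1 * y)) (\<lambda>\<xi>. 1 * ?h \<xi>)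
      (\<lambda>y. \<sigma> * ac_density u0 (a + 1 * y)) (1 * hp) total_mass B"
    by (rule one_sided[OF cc inf \<sigma> _ lim]) simp
  have p2: "one_sided_problem (\<lambda>t y. \<sigma> * ur t (a + -1 * y)) (\<lambda>\<xi>. -1 * ?h \<xi>)
      (\<lambda>y. \<sigma> * ac_density u0 (a + -1 * y)) (-1 * hp) total_mass B"
    by (rule one_sided[OF cc inf \<sigma> _ lim]) simp
  have i1: "set_integrable lborel {0<..<X} (\<lambda>y. \<sigma> * ac_density u0 (a + 1 * y))" for X
    by (rule initial_reflected_integrable) simp
  have i2: "set_integrable lborel {0<..<X} (\<lambda>y. \<sigma> * ac_density u0 (a + -1 * y))" for X
    by (rule initial_reflected_integrable) simp
  show False
    using nd unfolding nondegenerate_at_infinity_def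
  proof (elim disjE exE conjE)
    fix k assume "\<forall>\<xi>\<ge>k. hp < ?h \<xi>"
    then show False using one_sided_problem.flux_not_eventually_above_limit[OF p1 i1 c] by auto
  next
    fix k assume "\<forall>\<xi>\<ge>k. ?h \<xi> < hp"
    then show False using one_sided_problem.flux_not_eventually_above_limit[OF p2 i2 c] by auto
  next
    fix C1 :: real assume C1: "0 < C1"
      and steep: "\<forall>k0. \<exists>k\<ge>k0. \<exists>M>0. C1 * M \<le> \<bar>?h k - hp\<bar> \<and> (\<forall>\<xi>\<ge>k. \<bar>?h \<xi> - ?h k\<bar> \<le> M * (\<xi> - k))"
    obtain k1 where k1: "\<forall>k\<ge>k1. \<forall>M>0. (\<forall>\<xi>\<ge>k. \<bar>1 * ?h \<xi> - 1 * ?h k\<bar> \<le> M * (\<xi> - k)) \<longrightarrow> 1 * ?h k - 1 * hp < C1 * M"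
      using one_sided_problem.flux_not_frequently_steep[OF p1 i1 C1] by blast
    obtain k2 where k2: "\<forall>k\<ge>k2. \<forall>M>0. (\<forall>\<xi>\<ge>k. \<bar>-1 * ?h \<xi> - -1 * ?h k\<bar> \<le> M * (\<xi> - k)) \<longrightarrow> -1 * ?h k - -1 * hp < C1 * M"
      using one_sided_problem.flux_not_frequently_steep[OF p2 i2 C1] by blast
    obtain k M where k: "max k1 k2 \<le> k" and M: "0 < M" and st: "C1 * M \<le> \<bar>?h k - hp\<bar>"
      and lip: "\<forall>\<xi>\<ge>k. \<bar>?h \<xi> - ?h k\<bar> \<le> M * (\<xi> - k)"
      using steep by blast
    have "?h k - hp < C1 * M" using k1[rule_format, of k M] k M lip by simp
    moreover have "-1 * ?h \<xi> - -1 * ?h k = - (?h \<xi> - ?h k)" for \<xi> by simp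
    then have "\<bar>-1 * ?h \<xi> - -1 * ?h k\<bar> = \<bar>?h \<xi> - ?h k\<bar>" for \<xi> by (metis abs_minus_cancel)
    then have "- (?h k - hp) < C1 * M" using k2[rule_format, of k M] k M lip by simp
    ultimately show False using st by linarith
  qed
qed

end

section \<open>Behaviour of the flux at infinity\<close>

lemma weak_deriv_bounded:
  assumes "W1inf H"
  shows "is_bounded_weak_derivative H (weak_deriv H)"
proof -
  have "\<exists>G. is_bounded_weak_derivative H G" using assms by (simp add: W1inf_def)
  from someI_ex[OF this] show ?thesis by (simp add: weak_deriv_def)
qed

lemma H_lipschitz_tail:
  assumes H: "W1inf H"
  shows M_plus_lipschitz: "k \<le> \<xi> \<Longrightarrow> \<bar>H \<xi> - H k\<bar> \<le> M_plus H k * (\<xi> - k)"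
    and M_minus_lipschitz: "\<xi> \<le> k \<Longrightarrow> \<bar>H \<xi> - H k\<bar> \<le> M_minus H k * (k - \<xi>)"
proof -
  note D = weak_deriv_bounded[OF H]
  have c: "continuous_on UNIV H" using H by (simp add: W1inf_def)
  obtain B where B: "\<forall>\<xi>. \<bar>H \<xi>\<bar> \<le> B" by (rule W1inf_bounded[OF H])
  have w: "is_weak_derivative H (weak_deriv H)" "weak_deriv H \<in> borel_measurable borel"
    using D by (auto simp: is_bounded_weak_derivative_def)
  show "\<bar>H \<xi> - H k\<bar> \<le> M_plus H k * (\<xi> - k)" if "k \<le> \<xi>"
  proof (cases "k = \<xi>")
    case False
    then have "k < \<xi>" using that by simp
    then show ?thesis
      by (rule weak_derivative_lipschitz[OF c B w])
        (use Linf_norm_AE[OF D, of "{k<..}"] in \<open>auto simp: M_plus_def elim!: eventually_mono\<close>)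
  qed simp
  show "\<bar>H \<xi> - H k\<bar> \<le> M_minus H k * (k - \<xi>)" if "\<xi> \<le> k"
  proof (cases "k = \<xi>")
    case False
    then have "\<xi> < k" using that by simp
    then have "\<bar>H k - H \<xi>\<bar> \<le> M_minus H k * (k - \<xi>)"
      by (rule weak_derivative_lipschitz[OF c B w])
        (use Linf_norm_AE[OF D, of "{..<k}"] in \<open>auto simp: M_minus_def elim!: eventually_mono\<close>)
    then show ?thesis by (simp add: abs_minus_commute)
  qed simp
qed

text \<open>
  Division by zero yields \<open>0\<close>, so a large ratio forces \<open>M k > 0\<close>.
\<close>

lemma frequently_ratio_bound:
  assumes "Limsup F (\<lambda>k. ereal (d k / M k)) \<ge> ereal C0" and C0: "0 < C0"
    and d: "\<And>k. 0 \<le> d k"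
  shows "\<exists>\<^sub>F k in F. 0 < (M k :: real) \<and> C0 / 2 * M k \<le> d k"
proof -
  have "\<exists>\<^sub>F k in F. C0 / 2 < d k / M k"
  proof (rule ccontr)
    assume "\<not> (\<exists>\<^sub>F k in F. C0 / 2 < d k / M k)"
    then have "\<forall>\<^sub>F k in F. ereal (d k / M k) \<le> ereal (C0 / 2)"
      by (simp add: not_frequently not_less)
    from Limsup_bounded[OF this] have "ereal C0 \<le> ereal (C0 / 2)" using assms(1) by (rule order_trans[rotated])
    then show False using C0 by simp
  qed
  then show ?thesis
  proof (rule frequently_elim1)
    fix k assume k: "C0 / 2 < d k / M k"
    then have "0 < d k / M k" using C0 by linarith
    then have "0 < M k" using d[of k] by (simp add: zero_less_divide_iff)
    then show "0 < M k \<and> C0 / 2 * M k \<le> d k" using k by (simp add: pos_less_divide_eq)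
  qed
qed

lemma nondegenerate_plus:
  assumes H: "W1inf H" and h: "H5_i H \<or> H6_i H"
  shows "\<exists>hp. ((\<lambda>\<xi>. 1 * H (1 * \<xi>)) \<longlongrightarrow> hp) at_top \<and> nondegenerate_at_infinity (\<lambda>\<xi>. 1 * H (1 * \<xi>)) hp"
  using h
proof
  assume "H5_i H"
  then obtain Hp C0 where l: "(H \<longlongrightarrow> Hp) at_top" and C0: "0 < C0"
    and L: "Limsup at_top (\<lambda>k. ereal (\<bar>H k - Hp\<bar> / M_plus H k)) \<ge> ereal C0"
    by (auto simp: H5_i_def)
  have "\<exists>k\<ge>k0. \<exists>M>0. C0 / 2 * M \<le> \<bar>H k - Hp\<bar> \<and> (\<forall>\<xi>\<ge>k. \<bar>H \<xi> - H k\<bar> \<le> M * (\<xi> - k))" for k0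
  proof -
    have "\<exists>\<^sub>F k in at_top. 0 < M_plus H k \<and> C0 / 2 * M_plus H k \<le> \<bar>H k - Hp\<bar>"
      by (rule frequently_ratio_bound[OF L C0]) simp
    then obtain k where "k0 \<le> k" "0 < M_plus H k" "C0 / 2 * M_plus H k \<le> \<bar>H k - Hp\<bar>"
      using eventually_ge_at_top[of k0] by (metis (mono_tags, lifting) frequently_eventually_frequently frequently_ex)
    then show ?thesis using M_plus_lipschitz[OF H] by blast
  qed
  then have "nondegenerate_at_infinity H Hp"
    unfolding nondegenerate_at_infinity_def using C0 half_gt_zero by blast
  then show ?thesis using l by auto
next
  assume "H6_i H"
  then obtain Hp k where "(H \<longlongrightarrow> Hp) at_top" "(\<forall>\<xi>\<ge>k. Hp < H \<xi>) \<or> (\<forall>\<xi>\<ge>k. H \<xi> < Hp)"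
    by (auto simp: H6_i_def)
  then show ?thesis unfolding nondegenerate_at_infinity_def by auto
qed

lemma nondegenerate_minus:
  assumes H: "W1inf H" and h: "H5_ii H \<or> H6_ii H"
  shows "\<exists>hp. ((\<lambda>\<xi>. -1 * H (-1 * \<xi>)) \<longlongrightarrow> hp) at_top \<and> nondegenerate_at_infinity (\<lambda>\<xi>. -1 * H (-1 * \<xi>)) hp"
  using h
proof
  assume "H5_ii H"
  then obtain Hm C0 where l: "(H \<longlongrightarrow> Hm) at_bot" and C0: "0 < C0"
    and L: "Limsup at_bot (\<lambda>k. ereal (\<bar>H k - Hm\<bar> / M_minus H k)) \<ge> ereal C0"
    by (auto simp: H5_ii_def)
  have "\<exists>k\<ge>k0. \<exists>M>0. C0 / 2 * M \<le> \<bar>- H (- k) - - Hm\<bar> \<and> (\<forall>\<xi>\<ge>k. \<bar>- H (- \<xi>) - - H (- k)\<bar> \<le> M * (\<xi> - k))" for k0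
  proof -
    have "\<exists>\<^sub>F k in at_bot. 0 < M_minus H k \<and> C0 / 2 * M_minus H k \<le> \<bar>H k - Hm\<bar>"
      by (rule frequently_ratio_bound[OF L C0]) simp
    then obtain k where k: "k \<le> - k0" "0 < M_minus H k" "C0 / 2 * M_minus H k \<le> \<bar>H k - Hm\<bar>"
      using eventually_le_at_bot[of "- k0"] by (metis (mono_tags, lifting) frequently_eventually_frequently frequently_ex)
    have "\<bar>- H (- \<xi>) - - H k\<bar> \<le> M_minus H k * (\<xi> - - k)" if "- k \<le> \<xi>" for \<xi>
      using M_minus_lipschitz[OF H, of "- \<xi>" k] that by (simp add: abs_minus_commute add.commute)
    then show ?thesis using k by (intro exI[of _ "- k"] conjI exI[of _ "M_minus H k"]) (auto simp: abs_minus_commute)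
  qed
  then have "nondegenerate_at_infinity (\<lambda>\<xi>. - H (- \<xi>)) (- Hm)"
    unfolding nondegenerate_at_infinity_def using C0 half_gt_zero by blast
  then show ?thesis
    using tendsto_minus[OF l[unfolded filterlim_at_bot_mirror]] by auto
next
  assume "H6_ii H"
  then obtain Hm k where l: "(H \<longlongrightarrow> Hm) at_bot" and k: "(\<forall>\<xi>\<le>k. Hm < H \<xi>) \<or> (\<forall>\<xi>\<le>k. H \<xi> < Hm)"
    by (auto simp: H6_ii_def)
  have "nondegenerate_at_infinity (\<lambda>\<xi>. - H (- \<xi>)) (- Hm)"
    unfolding nondegenerate_at_infinity_def
  proof (rule disjI1, rule exI[of _ "- k"])
    have k': "- \<xi> \<le> k" if "- k \<le> \<xi>" for \<xi> using that by linarith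
    show "(\<forall>\<xi>\<ge>- k. - Hm < - H (- \<xi>)) \<or> (\<forall>\<xi>\<ge>- k. - H (- \<xi>) < - Hm)"
    proof (cases "\<forall>\<xi>\<le>k. Hm < H \<xi>")
      case True
      then have "\<forall>\<xi>\<ge>- k. - H (- \<xi>) < - Hm" using k' by simp
      then show ?thesis ..
    next
      case False
      then have "\<forall>\<xi>\<le>k. H \<xi> < Hm" using k by blast
      then have "\<forall>\<xi>\<ge>- k. - Hm < - H (- \<xi>)" using k' by simp
      then show ?thesis ..
    qed
  qed
  then show ?thesis
    using tendsto_minus[OF l[unfolded filterlim_at_bot_mirror]] by auto
qed

theorem theorem4p7:
  fixes H :: "real \<Rightarrow> real"
    and u0 :: "real set \<Rightarrow> real"
    and u :: "real \<Rightarrow> real set \<Rightarrow> real"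
    and ur :: "real \<Rightarrow> real \<Rightarrow> real"
    and p :: nat and x c :: "nat \<Rightarrow> real" and j :: nat
  assumes "W1inf H"
    and "signed_radon_on UNIV u0"
    and "strict_mono_on {1..p} x"
    and "\<And>i. i \<in> {1..p} \<Longrightarrow> c i \<noteq> 0"
    and "\<And>K. compact K \<Longrightarrow> sing_part u0 K = (\<Sum>i=1..p. c i * indicator K (x i))"
    and "continuous_measure_curve u"
    and "global_entropy_solution H u0 u ur"
    and "\<And>i. i \<in> {1..p} \<Longrightarrow> compatibility_condition H u ur (x i) (c i)"
    and "j \<in> {1..p}"
    and "(c j > 0 \<and> (H5_i H \<or> H6_i H)) \<or> (c j < 0 \<and> (H5_ii H \<or> H6_ii H))"
  shows "waiting_time u (x j) < \<infinity>"
proof -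
  obtain B where B: "\<forall>\<xi>. \<bar>H \<xi>\<bar> \<le> B" by (rule W1inf_bounded[OF assms(1)])
  interpret measure_solution H u0 u ur p x c B
  proof
    show "continuous_on UNIV H" using assms(1) by (simp add: W1inf_def)
    show "\<bar>H \<xi>\<bar> \<le> B" for \<xi> using B by simp
    show "inj_on x {1..p}" by (rule strict_mono_on_imp_inj_on[OF assms(3)])
  qed (use assms in auto)
  note cc = assms(8)[OF assms(9)]
  show ?thesis
    using assms(10)
  proof (elim disjE conjE)
    assume "c j > 0" "H5_i H"
    then show ?thesis using nondegenerate_plus[OF assms(1)] waiting_time_finite[OF cc, of 1] by blast
  next
    assume "c j > 0" "H6_i H"
    then show ?thesis using nondegenerate_plus[OF assms(1)] waiting_time_finite[OF cc, of 1] by blast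
  next
    assume "c j < 0" "H5_ii H"
    then show ?thesis using nondegenerate_minus[OF assms(1)] waiting_time_finite[OF cc, of "-1"] by blast
  next
    assume "c j < 0" "H6_ii H"
    then show ?thesis using nondegenerate_minus[OF assms(1)] waiting_time_finite[OF cc, of "-1"] by blast
  qed
qed

end
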